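(* Consider a four-dimensional asymptotically flat spacetime in which the metric near future null infinity can be written, in Bondi coordinates $(u,r,x^I)$ and by $C^{2-}$ functions (i.e. functions of class $C^{1,1}$), in the asymptotic form given in the context. Suppose that $$\Omega_{IJ}:=\omega_{IJ}-\tfrac12\dot h^{(1)}_{IJ}+\tfrac12\dot m\,\omega_{IJ}$$ is positive definite and that $\dot m\le 0$ holds everywhere near future null infinity. Take a point $p$ with sufficiently large radial coordinate value $r=r_0$. Then any photon emitted from $p$ reaches future null infinity if $$0<\frac{1}{\dot r|_p-\dot r_{\rm crit}}=o(r_0)$$ is satisfied, where $\dot r|_p$ is the value at $p$ of $dr/du$ along the photon's worldline, and $\dot r_{\rm crit}$ is defined by $$\dot r_{\rm crit}:=\frac{-(2\Omega_i+1)+\sqrt{4\Omega_i^2-2\Omega_i+1}}{3}\le 0,$$ with $\Omega_i$ the infimum of $\Omega:=\Omega_{IJ}(u,x^K)\phi^I\phi^J$, where $\phi^I$ is a vector satisfying $\sqrt{\omega_{IJ}\phi^I\phi^J}=1$ (so $\Omega_i\ge 0$ when $\Omega_{IJ}$ is positive definite).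
   Context: Bondi coordinates: $u$ is the retarded time, $r$ the areal radius, and $x^I$ the angular coordinates; $\omega_{IJ}$ is the metric of the unit 2-sphere. The metric near future null infinity is $$ds^2=-Ae^B\,du^2-2e^B\,du\,dr+h_{IJ}r^2(dx^I+C^I du)(dx^J+C^J du),$$ where $A,B,C^I,h_{IJ}$ are functions of $u$, $r$, $x^I$, subject to the gauge condition that $\sqrt{\det h_{IJ}}$ equals the volume element of the unit 2-sphere. The nonzero metric components behave as $$g_{uu}=-Ae^B+h_{IJ}C^IC^Jr^2=-1+m\,r^{-1}+O(r^{-2}),\qquad g_{ur}=-e^B=-1-B^{(1)}r^{-2}+O(r^{-3}),$$ $$g_{IJ}=h_{IJ}r^2=\omega_{IJ}r^2+h^{(1)}_{IJ}r+O(r^{0}),\qquad g_{uI}=h_{IJ}C^Jr^2=C^{(1)}_{\ \ I}+O(r^{-1}),$$ where the coefficients $m,B^{(1)},h^{(1)}_{IJ},C^{(1)}_{\ \ I}$ of this expansion in powers of $1/r$ do not depend on $r$. Future null infinity is described by the limit $r\to\infty$ while $u$ is finite. A dot denotes the derivative with respect to the retarded time $u$ (for $r$, along the null geodesic). A photon is a particle whose worldline is a future-directed null geodesic. The condition $0<1/(\dot r|_p-\dot r_{\rm crit})=o(r_0)$ means that $\dot r|_p>\dot r_{\rm crit}$ and that $\dot r|_p-\dot r_{\rm crit}$ is not too small, $o(r_0)$ being the Landau symbol for large $r_0$. *)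

theory Defs
  imports "HOL-Analysis.Analysis" "HOL-Library.Landau_Symbols"
begin

text \<open>
  Points near future null infinity are triples \<open>(u, r, \<xi>)\<close>: retarded time, areal radius, and a
  point \<open>\<xi>\<close> of the unit sphere of \<open>real^3\<close>.  Tensors on the sphere are represented by tensors of
  \<open>real^3\<close>, of which only the values on the tangent plane \<open>{v. v \<bullet> \<xi> = 0}\<close> are used; the round
  metric \<open>\<omega>\<close> is then the inner product.  Angular coordinates \<open>x\<^sup>I\<close> are those of the two stereographic
  charts (\<open>\<sigma> = 1, -1\<close>), restricted to discs of radius 2 so that \<open>\<omega>\<^sub>I\<^sub>J\<close> is uniformly bounded
  above and below in both charts, while the two charts still cover the sphere.
\<close>

type_synonym event = "real \<times> real \<times> (real^3)"
type_synonym scalar_field = "real \<Rightarrow> real \<Rightarrow> real^3 \<Rightarrow> real"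
type_synonym sphere_vector_field = "real \<Rightarrow> real \<Rightarrow> real^3 \<Rightarrow> real^3"
type_synonym sphere_form_field = "real \<Rightarrow> real \<Rightarrow> real^3 \<Rightarrow> real^3 \<Rightarrow> real^3 \<Rightarrow> real"


subsection \<open>Coordinates\<close>

definition near_scri :: "real set \<Rightarrow> real \<Rightarrow> event set" where
  "near_scri U R0 = {(u, r, \<xi>). u \<in> U \<and> R0 < r \<and> norm \<xi> = 1}"

text \<open>Chart coordinates are numbered \<open>1 = u\<close>, \<open>2 = r\<close>, and \<open>3\<close>, \<open>4\<close> for the two angles.\<close>

definition chart_region :: "real set \<Rightarrow> real \<Rightarrow> (real^4) set" where
  "chart_region U R0 = {x. x$1 \<in> U \<and> R0 < x$2 \<and> (x$3)\<^sup>2 + (x$4)\<^sup>2 < 2\<^sup>2}"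

definition sphere_point :: "real \<Rightarrow> real^4 \<Rightarrow> real^3" where
  "sphere_point \<sigma> x =
     (1 / (1 + (x$3)\<^sup>2 + (x$4)\<^sup>2)) *\<^sub>R
       vector [2 * x$3, 2 * x$4, \<sigma> * (1 - (x$3)\<^sup>2 - (x$4)\<^sup>2)]"

definition chart_map :: "real \<Rightarrow> real^4 \<Rightarrow> event" where
  "chart_map \<sigma> x = (x$1, x$2, sphere_point \<sigma> x)"

definition coord_vector :: "real \<Rightarrow> real^4 \<Rightarrow> 4 \<Rightarrow> event" where
  "coord_vector \<sigma> x a = frechet_derivative (chart_map \<sigma>) (at x) (axis a 1)"

definition ang :: "2 \<Rightarrow> 4" where
  "ang I = (if I = 1 then 3 else 4)"

definition ang_vector :: "real \<Rightarrow> real^4 \<Rightarrow> 2 \<Rightarrow> real^3" where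
  "ang_vector \<sigma> x I = snd (snd (coord_vector \<sigma> x (ang I)))"

definition omega_comp :: "real \<Rightarrow> real^4 \<Rightarrow> real^2^2" where
  "omega_comp \<sigma> x = (\<chi> I J. ang_vector \<sigma> x I \<bullet> ang_vector \<sigma> x J)"

definition pd :: "4 \<Rightarrow> (real^4 \<Rightarrow> real) \<Rightarrow> real^4 \<Rightarrow> real" where
  "pd a f x = frechet_derivative f (at x) (axis a 1)"


subsection \<open>The metric\<close>

definition bondi_metric ::
  "scalar_field \<Rightarrow> scalar_field \<Rightarrow> sphere_vector_field \<Rightarrow> sphere_form_field
     \<Rightarrow> event \<Rightarrow> event \<Rightarrow> event \<Rightarrow> real" where
  "bondi_metric A B C h p v w =
     (case (p, v, w) of ((u, r, \<xi>), (du, dr, d\<xi>), (du', dr', d\<xi>')) \<Rightarrow>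
        - A u r \<xi> * exp (B u r \<xi>) * du * du'
        - exp (B u r \<xi>) * (du * dr' + dr * du')
        + r\<^sup>2 * h u r \<xi> (d\<xi> + du *\<^sub>R C u r \<xi>) (d\<xi>' + du' *\<^sub>R C u r \<xi>))"

definition metric_comp ::
  "scalar_field \<Rightarrow> scalar_field \<Rightarrow> sphere_vector_field \<Rightarrow> sphere_form_field
     \<Rightarrow> real \<Rightarrow> real^4 \<Rightarrow> real^4^4" where
  "metric_comp A B C h \<sigma> x =
     (\<chi> a b. bondi_metric A B C h (chart_map \<sigma> x) (coord_vector \<sigma> x a) (coord_vector \<sigma> x b))"

definition C11_on :: "(real^4) set \<Rightarrow> (real^4 \<Rightarrow> real) \<Rightarrow> bool" where
  "C11_on S f \<longleftrightarrow>
     (\<exists>D. (\<forall>x\<in>S. (f has_derivative (\<lambda>v. D x \<bullet> v)) (at x)) \<and>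
          (\<forall>x\<in>S. \<exists>\<epsilon>>0. \<exists>L. L-lipschitz_on (ball x \<epsilon> \<inter> S) D))"

text \<open>The last conjunct but one is the Bondi gauge condition on the angular determinant.\<close>

definition bondi_spacetime ::
  "real set \<Rightarrow> real \<Rightarrow> scalar_field \<Rightarrow> scalar_field \<Rightarrow> sphere_vector_field
     \<Rightarrow> sphere_form_field \<Rightarrow> bool" where
  "bondi_spacetime U R0 A B C h \<longleftrightarrow>
     (\<forall>(u, r, \<xi>) \<in> near_scri U R0.
        C u r \<xi> \<bullet> \<xi> = 0 \<and> bilinear (h u r \<xi>) \<and>
        (\<forall>v w. h u r \<xi> v w = h u r \<xi> w v) \<and>
        (\<forall>v. v \<bullet> \<xi> = 0 \<longrightarrow> v \<noteq> 0 \<longrightarrow> 0 < h u r \<xi> v v)) \<and>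
     (\<forall>\<sigma>\<in>{1, -1}. \<forall>x\<in>chart_region U R0.
        sqrt (det (\<chi> I J. h (x$1) (x$2) (sphere_point \<sigma> x)
                             (ang_vector \<sigma> x I) (ang_vector \<sigma> x J) :: real^2^2))
          = sqrt (det (omega_comp \<sigma> x))) \<and>
     (\<forall>\<sigma>\<in>{1, -1}. \<forall>a b. C11_on (chart_region U R0) (\<lambda>x. metric_comp A B C h \<sigma> x $ a $ b))"


subsection \<open>Asymptotic expansion\<close>

text \<open>
  The Landau symbol \<open>O(r\<^sup>-\<^sup>k)\<close> for functions of the chart coordinates.  It is uniform in \<open>u\<close> and in the
  angles, and it may be differentiated once: derivatives along \<open>u\<close> and the angles keep the order,
  a derivative along \<open>r\<close> gains a factor \<open>1/r\<close>.
\<close>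

definition bigO_r :: "real set \<Rightarrow> nat \<Rightarrow> (real^4 \<Rightarrow> real) \<Rightarrow> bool" where
  "bigO_r U k f \<longleftrightarrow>
     (\<exists>K. \<exists>R>0. \<forall>x\<in>chart_region U R.
        f differentiable (at x) \<and> \<bar>f x\<bar> \<le> K / (x$2) ^ k \<and>
        (\<forall>a. \<bar>pd a f x\<bar> \<le> K / (x$2) ^ (if a = 2 then Suc k else k)))"

text \<open>
  The covector \<open>C\<^sup>(\<^sup>1\<^sup>)\<^sub>I\<close> is represented through the inner product.  The expansion is
  uniform: its coefficients, too, are \<open>O(1)\<close> in the above sense.
\<close>

definition bondi_expansion ::
  "real set \<Rightarrow> scalar_field \<Rightarrow> scalar_field \<Rightarrow> sphere_vector_field \<Rightarrow> sphere_form_field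
     \<Rightarrow> (real \<Rightarrow> real^3 \<Rightarrow> real) \<Rightarrow> (real \<Rightarrow> real^3 \<Rightarrow> real)
     \<Rightarrow> (real \<Rightarrow> real^3 \<Rightarrow> real^3 \<Rightarrow> real^3 \<Rightarrow> real) \<Rightarrow> (real \<Rightarrow> real^3 \<Rightarrow> real^3) \<Rightarrow> bool" where
  "bondi_expansion U A B C h m B1 h1 C1 \<longleftrightarrow>
     (\<forall>u\<in>U. \<forall>\<xi>. norm \<xi> = 1 \<longrightarrow> bilinear (h1 u \<xi>)) \<and>
     (\<forall>\<sigma>\<in>{1, -1}.
        bigO_r U 0 (\<lambda>x. m (x$1) (sphere_point \<sigma> x)) \<and>
        bigO_r U 0 (\<lambda>x. B1 (x$1) (sphere_point \<sigma> x)) \<and>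
        (\<forall>I J. bigO_r U 0 (\<lambda>x. h1 (x$1) (sphere_point \<sigma> x) (ang_vector \<sigma> x I) (ang_vector \<sigma> x J))) \<and>
        (\<forall>I. bigO_r U 0 (\<lambda>x. C1 (x$1) (sphere_point \<sigma> x) \<bullet> ang_vector \<sigma> x I)) \<and>
        bigO_r U 2 (\<lambda>x. metric_comp A B C h \<sigma> x $ 1 $ 1
                        - (- 1 + m (x$1) (sphere_point \<sigma> x) / x$2)) \<and>
        bigO_r U 3 (\<lambda>x. metric_comp A B C h \<sigma> x $ 1 $ 2
                        - (- 1 - B1 (x$1) (sphere_point \<sigma> x) / (x$2)\<^sup>2)) \<and>
        (\<forall>I J. bigO_r U 0 (\<lambda>x. metric_comp A B C h \<sigma> x $ ang I $ ang J
                        - (omega_comp \<sigma> x $ I $ J * (x$2)\<^sup>2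
                           + h1 (x$1) (sphere_point \<sigma> x) (ang_vector \<sigma> x I) (ang_vector \<sigma> x J) * x$2))) \<and>
        (\<forall>I. bigO_r U 1 (\<lambda>x. metric_comp A B C h \<sigma> x $ 1 $ ang I
                        - C1 (x$1) (sphere_point \<sigma> x) \<bullet> ang_vector \<sigma> x I)))"

definition mdot :: "(real \<Rightarrow> real^3 \<Rightarrow> real) \<Rightarrow> real \<Rightarrow> real^3 \<Rightarrow> real" where
  "mdot m u \<xi> = deriv (\<lambda>s. m s \<xi>) u"

definition Omega_form ::
  "(real \<Rightarrow> real^3 \<Rightarrow> real) \<Rightarrow> (real \<Rightarrow> real^3 \<Rightarrow> real^3 \<Rightarrow> real^3 \<Rightarrow> real)
     \<Rightarrow> real \<Rightarrow> real^3 \<Rightarrow> real^3 \<Rightarrow> real^3 \<Rightarrow> real" where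
  "Omega_form m h1 u \<xi> \<phi> \<psi> =
     \<phi> \<bullet> \<psi> - 1/2 * deriv (\<lambda>s. h1 s \<xi> \<phi> \<psi>) u + 1/2 * mdot m u \<xi> * (\<phi> \<bullet> \<psi>)"

definition Omega_inf ::
  "real set \<Rightarrow> (real \<Rightarrow> real^3 \<Rightarrow> real) \<Rightarrow> (real \<Rightarrow> real^3 \<Rightarrow> real^3 \<Rightarrow> real^3 \<Rightarrow> real) \<Rightarrow> real" where
  "Omega_inf U m h1 =
     Inf {Omega_form m h1 u \<xi> \<phi> \<phi> | u \<xi> \<phi>. u \<in> U \<and> norm \<xi> = 1 \<and> \<phi> \<bullet> \<xi> = 0 \<and> norm \<phi> = 1}"

definition rdot_crit :: "real \<Rightarrow> real" where
  "rdot_crit \<Omega> = (- (2 * \<Omega> + 1) + sqrt (4 * \<Omega>\<^sup>2 - 2 * \<Omega> + 1)) / 3"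


subsection \<open>Photons\<close>

definition christoffel :: "(real^4 \<Rightarrow> real^4^4) \<Rightarrow> real^4 \<Rightarrow> 4 \<Rightarrow> 4 \<Rightarrow> 4 \<Rightarrow> real" where
  "christoffel g x a b c =
     1/2 * (\<Sum>d\<in>UNIV. matrix_inv (g x) $ a $ d *
       (pd b (\<lambda>y. g y $ d $ c) x + pd c (\<lambda>y. g y $ d $ b) x - pd d (\<lambda>y. g y $ b $ c) x))"

definition param_domain :: "ereal \<Rightarrow> real set" where
  "param_domain b = {t. 0 \<le> t \<and> ereal t < b}"

text \<open>
  A chart vector \<open>v\<close> that is null and nonzero is future-directed iff it points to the same side of
  the light cone as the outgoing null vector \<open>\<partial>\<^sub>r\<close>, that is, \<open>u\<close> increases, or \<open>u\<close> is stationary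
  and \<open>v\<close> is a positive multiple of \<open>\<partial>\<^sub>r\<close>.
\<close>

definition future_null :: "(real^4 \<Rightarrow> real^4^4) \<Rightarrow> real^4 \<Rightarrow> real^4 \<Rightarrow> bool" where
  "future_null g x v \<longleftrightarrow> v \<bullet> (g x *v v) = 0 \<and> (0 < v$1 \<or> v$1 = 0 \<and> 0 < v$2)"

definition future_null_geodesic ::
  "real set \<Rightarrow> real \<Rightarrow> scalar_field \<Rightarrow> scalar_field \<Rightarrow> sphere_vector_field \<Rightarrow> sphere_form_field
     \<Rightarrow> ereal \<Rightarrow> (real \<Rightarrow> event) \<Rightarrow> bool" where
  "future_null_geodesic U R0 A B C h b \<gamma> \<longleftrightarrow>
     (\<forall>t0\<in>param_domain b. \<exists>\<sigma>\<in>{1, -1}. \<exists>\<epsilon>>0. \<exists>x v.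
        \<forall>t\<in>param_domain b. \<bar>t - t0\<bar> < \<epsilon> \<longrightarrow>
          x t \<in> chart_region U R0 \<and> \<gamma> t = chart_map \<sigma> (x t) \<and>
          (x has_vector_derivative v t) (at t within param_domain b) \<and>
          (v has_vector_derivative
             (\<chi> a. - (\<Sum>c\<in>UNIV. \<Sum>d\<in>UNIV.
                christoffel (metric_comp A B C h \<sigma>) (x t) a c d * v t $ c * v t $ d)))
            (at t within param_domain b) \<and>
          future_null (metric_comp A B C h \<sigma>) (x t) (v t))"

text \<open>
  A photon emitted from \<open>p\<close> at parameter value 0: a future-directed null geodesic on \<open>[0, b)\<close> that is
  future-inextendible, that is, has no future endpoint.  Only the region \<open>near_scri\<close> is modelled; in a
  larger spacetime, \<open>\<gamma>\<close> is the part of the worldline up to its first exit, if any, from this region.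
\<close>

definition photon_from ::
  "real set \<Rightarrow> real \<Rightarrow> scalar_field \<Rightarrow> scalar_field \<Rightarrow> sphere_vector_field \<Rightarrow> sphere_form_field
     \<Rightarrow> event \<Rightarrow> ereal \<Rightarrow> (real \<Rightarrow> event) \<Rightarrow> bool" where
  "photon_from U R0 A B C h p b \<gamma> \<longleftrightarrow>
     0 < b \<and> \<gamma> 0 = p \<and> future_null_geodesic U R0 A B C h b \<gamma> \<and>
     \<not> (\<exists>q\<in>near_scri U R0. ((\<lambda>s. \<gamma> (real_of_ereal s)) \<longlongrightarrow> q) (at_left b))"

definition initial_rdot :: "ereal \<Rightarrow> (real \<Rightarrow> event) \<Rightarrow> real \<Rightarrow> bool" where
  "initial_rdot b \<gamma> y \<longleftrightarrow>
     (\<exists>du dr. ((\<lambda>t. fst (\<gamma> t)) has_real_derivative du) (at 0 within param_domain b) \<and>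
              ((\<lambda>t. fst (snd (\<gamma> t))) has_real_derivative dr) (at 0 within param_domain b) \<and>
              du \<noteq> 0 \<and> y = dr / du)"

definition reaches_scri :: "ereal \<Rightarrow> (real \<Rightarrow> event) \<Rightarrow> bool" where
  "reaches_scri b \<gamma> \<longleftrightarrow>
     filterlim (\<lambda>s. fst (snd (\<gamma> (real_of_ereal s)))) at_top (at_left b) \<and>
     (\<exists>u_end. ((\<lambda>s. fst (\<gamma> (real_of_ereal s))) \<longlongrightarrow> u_end) (at_left b))"

end

theory Submission
  imports Defs
begin

text \<open>
  Write \<open>x = dr/du\<close> and \<open>q = r\<^sup>2 \<omega>(d\<xi>/du, d\<xi>/du)\<close> along a null geodesic.  The null condition is
  \<open>q = 1 + 2 x\<close> up to a relative error \<open>O(1/r)\<close>, and the geodesic equation gives, up to \<open>O((1 + q)\<^sup>2/r\<^sup>2)\<close>,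
  \<open>r dx/du = q (\<Omega>(\<phi>,\<phi>) + x) + (1 - q) dm/du / 2\<close> with \<open>\<phi>\<close> the direction of \<open>d\<xi>/du\<close>.  The mass loss has a
  sign and its integral is bounded, so it disappears when \<open>x\<close> is replaced by \<open>Y = x - m/(2r)\<close>:
  \<open>r dY/du \<ge> (1 + 2 x) (\<Omega>\<^sub>i + x) - O((1 + x)\<^sup>2/r)\<close>.  With \<open>t = x - x\<^sub>c\<close>, where \<open>x\<^sub>c\<close> is the critical value, the
  main term is at least \<open>x\<^sub>c\<^sup>2/2 + t/3 + 2 t\<^sup>2\<close>, and it dominates the error as long as \<open>r t\<close> is large.
  Then \<open>Y\<close> increases, and so does \<open>ln r - L/(Y + 2)\<close> with \<open>L = 18/|x\<^sub>c|\<close>, so that \<open>r\<close> never drops below a fixed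
  fraction of \<open>r\<^sub>0\<close> and \<open>r t\<close> remains large.  Finally \<open>r/(Y - x\<^sub>c) + 3u/10\<close> decreases, which bounds \<open>u\<close>, and
  \<open>r + u\<close> increases at a rate controlling the angular velocity: either \<open>r\<close> tends to infinity or the
  worldline has an endpoint.
\<close>

section \<open>Growth of the radial velocity and the radial motion of a ray\<close>


text \<open>The critical value is the larger root of
  \<open>(1 + 2 * x) * (\<Omega> + x) = x\<^sup>2 / 2\<close>, that is, of \<open>3 * x\<^sup>2 + 2
  * (2 * \<Omega> + 1) * x + 2 * \<Omega> = 0\<close>. There the main term is not zero but
  \<open>x\<^sub>c\<^sup>2 / 2\<close>, and this reserve stops an inward ray: while
  \<open>x\<^sub>c < x < 0\<close>, \<open>ln r\<close> falls at most at the rate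
  \<open>|x\<^sub>c| / r\<close> and \<open>Y\<close> rises at least at the rate
  \<open>x\<^sub>c\<^sup>2 / (2 * r)\<close>, so the ratio of the two rates is bounded. For
  \<open>\<Omega> = 0\<close> the reserve vanishes, but then \<open>x\<^sub>c = 0\<close> and the
  ray never turns inward. The estimates need lower bounds for \<open>r\<close> and for
  \<open>r * t\<close>, and these bounds are themselves consequences of the estimates. A
  first-failure argument breaks the circle, because the estimates return both bounds with a margin.
  The hypothesis with \<open>o(r0)\<close> makes \<open>r * t\<close> at emission exceed a constant
  fixed beforehand. The affine parameter is kept throughout; derivatives along \<open>u\<close> are
  quotients by \<open>w = du/dt\<close>, so \<open>w > 0\<close> has to be propagated as
  well.\<close>

lemma rdot_crit_bounds:
  assumes "0 \<le> \<Omega>"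
  shows "rdot_crit \<Omega> \<le> 0" and "- 1/2 \<le> rdot_crit \<Omega>"
proof -
  have "sqrt (4 * \<Omega>\<^sup>2 - 2 * \<Omega> + 1) \<le> 2 * \<Omega> + 1"
    by (rule real_le_lsqrt) (use assms in \<open>auto simp: power2_eq_square algebra_simps\<close>)
  then show "rdot_crit \<Omega> \<le> 0"
    by (simp add: rdot_crit_def)
  \<comment> \<open>The value \<open>- 1/2\<close> is the limit of the critical value for large
    \<open>\<Omega>\<close>; to leading order it is the radial velocity for \<open>q = 0\<close>,
    that is, of a ray falling in without angular motion.\<close>
  have "2 * \<Omega> - 1/2 \<le> sqrt (4 * \<Omega>\<^sup>2 - 2 * \<Omega> + 1)"
    by (rule real_le_rsqrt) (auto simp: power2_eq_square algebra_simps)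
  then show "- 1/2 \<le> rdot_crit \<Omega>"
    by (simp add: rdot_crit_def field_simps)
qed

text \<open>Equality holds at \<open>t = 0\<close> by the choice of \<open>xc\<close>. In the
  expansion about that point the quadratic coefficient is exactly 2 and the linear one is
  \<open>4 * xc + 2 * \<Omega> + 1\<close>, so it remains to bound the latter below by 1/3.\<close>

lemma growth_rate_ge:
  assumes "0 \<le> \<Omega>" and "0 \<le> t"
  defines "xc \<equiv> rdot_crit \<Omega>"
  shows "xc\<^sup>2 / 2 + t / 3 + 2 * t\<^sup>2 \<le> (1 + 2 * (xc + t)) * (\<Omega> + (xc + t))"
proof -
  define d where "d = sqrt (4 * \<Omega>\<^sup>2 - 2 * \<Omega> + 1)"
  have "0 \<le> 4 * \<Omega>\<^sup>2 - 2 * \<Omega> + 1"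
    using zero_le_power2[of "2 * \<Omega> - 1/2"] by (simp add: power2_eq_square algebra_simps)
  then have d2: "d\<^sup>2 = 4 * \<Omega>\<^sup>2 - 2 * \<Omega> + 1"
    by (simp add: d_def)
  \<comment> \<open>The difference of the squares is
    \<open>3 * (\<Omega> - 1/2)\<^sup>2\<close>.\<close>
  have d: "\<Omega> + 1/2 \<le> d"
    unfolding d_def using zero_le_power2[of "\<Omega> - 1/2"]
    by (intro real_le_rsqrt) (simp add: power2_eq_square algebra_simps)
  have xc: "xc = (d - 2 * \<Omega> - 1) / 3"
    by (simp add: xc_def rdot_crit_def d_def)
  have "(1 + 2 * (xc + t)) * (\<Omega> + (xc + t)) - 2 * t\<^sup>2
      = xc\<^sup>2 / 2 + (4 * d - 2 * \<Omega> - 1) / 3 * t + (d\<^sup>2 - (4 * \<Omega>\<^sup>2 - 2 * \<Omega> + 1)) / 6"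
    unfolding xc by (simp add: power2_eq_square field_simps)
  moreover have "1 / 3 * t \<le> (4 * d - 2 * \<Omega> - 1) / 3 * t"
    by (rule mult_right_mono) (use d assms in auto)
  ultimately show ?thesis
    using d2 by simp
qed

text \<open>
  The error terms are absorbed by \<open>t / 6 + t\<^sup>2 / 2\<close>, which is possible exactly because \<open>t * r\<close> is large.
\<close>

lemma modified_rdot_growth:
  fixes K \<Omega> q x r y :: real
  defines "xc \<equiv> rdot_crit \<Omega>"
  defines "t \<equiv> x - xc"
  assumes "0 \<le> \<Omega>" "1 \<le> K" "0 \<le> q"
    and null: "\<bar>q - 1 - 2 * x\<bar> \<le> K * (1 + q) / r"
    and y: "q * (\<Omega> + x) / r - K * (1 + q)\<^sup>2 / r\<^sup>2 \<le> y"
    and r: "48 * K * (\<Omega> + 5) \<le> r" and t: "48 * K * (\<Omega> + 5) \<le> t * r"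
  shows "(xc\<^sup>2 / 2 + t / 6 + 3/2 * t\<^sup>2) / r \<le> y" and "1 + q \<le> 4 * (1 + x)"
proof -
  note xc = rdot_crit_bounds[OF \<open>0 \<le> \<Omega>\<close>, folded xc_def]
  have K5: "240 * K \<le> 48 * K * (\<Omega> + 5)" 
    using assms mult_nonneg_nonneg[of K \<Omega>] by (simp add: algebra_simps)
  have r0: "0 < r" "240 * K \<le> r"
    using K5 r \<open>1 \<le> K\<close> by linarith+
  have "0 < t * r" using K5 t assms by linarith
  then have t0: "0 < t" using r0 by (simp add: zero_less_mult_iff)
  \<comment> \<open>The error of the null relation contains \<open>q\<close> itself; since
    \<open>2 * K \<le> r\<close>, at most half of \<open>1 + q\<close> has to be moved to the other
    side.\<close>
  have "2 * (K * (1 + q) / r) \<le> 1 + q"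
    using r0 assms mult_right_mono[of "2*K" r "1+q"] by (simp add: field_simps)
  moreover have "q - 1 - 2 * x \<le> K * (1 + q) / r" using null by (rule abs_le_D1)
  ultimately have "2 * (q - 1 - 2 * x) \<le> 1 + q" by argo
  then show q4: "1 + q \<le> 4 * (1 + x)" by argo
  then have q: "1 + q \<le> 4 * (1 + t)" using xc t_def by simp
  have "K * (1 + q) / r \<le> 4 * K * (1 + t) / r"
  proof -
    have "K * (1 + q) \<le> K * (4 * (1 + t))" using q \<open>1 \<le> K\<close> by (intro mult_left_mono) auto
    then have "K * (1 + q) / r \<le> K * (4 * (1 + t)) / r" using r0 by (intro divide_right_mono) auto
    then show ?thesis by (simp add: mult_ac)
  qed
  then have d: "\<bar>q - (1 + 2 * x)\<bar> \<le> 4 * K * (1 + t) / r" using null by linarith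
  have o: "\<bar>\<Omega> + x\<bar> \<le> (\<Omega> + 1) * (1 + t)"
    using xc t0 mult_nonneg_nonneg[of \<Omega> t] assms(3) by (auto simp: t_def algebra_simps abs_le_iff)
  have "\<bar>(q - (1 + 2 * x)) * (\<Omega> + x)\<bar> \<le> (4 * K * (1 + t) / r) * ((\<Omega> + 1) * (1 + t))"
    unfolding abs_mult using t0 r0 assms by (intro mult_mono d o) auto
  then have "(1 + 2 * x) * (\<Omega> + x) - 4 * K * (\<Omega> + 1) * (1 + t)\<^sup>2 / r \<le> q * (\<Omega> + x)"
    by (simp add: power2_eq_square field_simps)
  moreover have "K * (1 + q)\<^sup>2 / r \<le> 16 * K * (1 + t)\<^sup>2 / r"
  proof -
    have "(1 + q)\<^sup>2 \<le> (4 * (1 + t))\<^sup>2" using q assms by (intro power_mono) auto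
    then have "K * (1 + q)\<^sup>2 \<le> K * (4 * (1 + t))\<^sup>2" using assms by (intro mult_left_mono) auto
    also have "K * (4 * (1 + t))\<^sup>2 = 16 * K * (1 + t)\<^sup>2" by (simp only: power_mult_distrib) simp
    finally show ?thesis using r0 by (intro divide_right_mono) auto
  qed
  moreover have "xc\<^sup>2 / 2 + t / 3 + 2 * t\<^sup>2 \<le> (1 + 2 * x) * (\<Omega> + x)"
    using growth_rate_ge[OF assms(3), of t] t0 by (simp add: xc_def t_def)
  \<comment> \<open>The coefficients add up to \<open>4 * K * (\<Omega> + 5)\<close>; doubled by
    \<open>(1 + t)\<^sup>2 \<le> 2 + 2 * t\<^sup>2\<close>, this is one sixth of the threshold. The
    constant part is absorbed through \<open>t * r\<close>, the quadratic part through
    \<open>r\<close>.\<close>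
  moreover have "4 * K * (\<Omega> + 1) * (1 + t)\<^sup>2 / r + 16 * K * (1 + t)\<^sup>2 / r \<le> t / 6 + t\<^sup>2 / 2"
  proof -
    have "(1 + t)\<^sup>2 \<le> 2 + 2 * t\<^sup>2"
      using zero_le_power2[of "1 - t"] by (simp add: power2_eq_square algebra_simps)
    then have "4 * K * (\<Omega> + 5) * (1 + t)\<^sup>2 \<le> 4 * K * (\<Omega> + 5) * (2 + 2 * t\<^sup>2)"
      using assms by (intro mult_left_mono) auto
    also have "\<dots> = 48 * K * (\<Omega> + 5) / 6 + 48 * K * (\<Omega> + 5) * t\<^sup>2 / 6" by (simp add: field_simps)
    also have "\<dots> \<le> t * r / 6 + r * t\<^sup>2 / 6"
      using t mult_right_mono[OF r, of "t\<^sup>2"] by (simp add: field_simps)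
    also have "\<dots> \<le> t * r / 6 + r * t\<^sup>2 / 2" using r0 by simp
    finally show ?thesis using r0 by (simp add: field_simps)
  qed
  ultimately have "xc\<^sup>2 / 2 + t / 6 + 3/2 * t\<^sup>2 \<le> q * (\<Omega> + x) - K * (1 + q)\<^sup>2 / r"
    by argo
  then have "(xc\<^sup>2 / 2 + t / 6 + 3/2 * t\<^sup>2) / r \<le> (q * (\<Omega> + x) - K * (1 + q)\<^sup>2 / r) / r"
    using r0 by (intro divide_right_mono) auto
  also have "\<dots> \<le> y"
    using y by (simp add: diff_divide_distrib power2_eq_square)
  finally show "(xc\<^sup>2 / 2 + t / 6 + 3/2 * t\<^sup>2) / r \<le> y" .
qed


section \<open>Monotone functions on the half-open parameter interval\<close>

lemma at_within_param_domain:
  assumes "0 < t" and "t < s" and "s \<in> param_domain b"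
  shows "at t within param_domain b = at t"
proof -
  have "{0<..<s} \<subseteq> param_domain b"
    using assms le_less_trans[of "ereal _" "ereal s" b] by (auto simp: param_domain_def)
  then show ?thesis
    using assms by (intro at_within_open_subset[of t "{0<..<s}"]) auto
qed

lemma param_domain_down:
  "t \<in> param_domain b \<Longrightarrow> 0 \<le> s \<Longrightarrow> s \<le> t \<Longrightarrow> s \<in> param_domain b"
  using le_less_trans[of "ereal s" "ereal t" b] by (auto simp: param_domain_def)

lemma deriv_nonneg_mono_param_domain:
  fixes f f' :: "real \<Rightarrow> real"
  assumes t: "t \<in> param_domain b" and s: "0 \<le> s" "s \<le> t"
    and cont: "continuous_on {s..t} f"
    and deriv: "\<And>z. s < z \<Longrightarrow> z < t \<Longrightarrow> \<exists>y\<ge>0. (f has_real_derivative y) (at z within param_domain b)"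
  shows "f s \<le> f t"
proof (rule DERIV_nonneg_imp_increasing_open[OF s(2) _ cont])
  fix z assume "s < z" "z < t"
  then show "\<exists>y. (f has_real_derivative y) (at z) \<and> 0 \<le> y"
    using deriv[of z] at_within_param_domain[of z t b] t s by auto
qed

text \<open>The filter \<open>at_left b\<close> over the extended reals treats a finite and an
  infinite affine range alike; between \<open>ereal t\<close> and \<open>b\<close> every argument is
  a finite real.\<close>

lemma eventually_at_left_param_domain:
  assumes "t \<in> param_domain b"
  shows "\<forall>\<^sub>F s in at_left b. real_of_ereal s \<in> param_domain b \<and> t \<le> real_of_ereal s"
proof -
  have "ereal t < b" using assms by (simp add: param_domain_def)
  then have "\<forall>\<^sub>F s in at_left b. s \<in> {ereal t<..<b}"
    unfolding eventually_at_left[OF \<open>ereal t < b\<close>] by auto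
  then show ?thesis
  proof eventually_elim
    case (elim s)
    then obtain z where "s = ereal z" by (cases s) auto
    with elim assms show ?case by (auto simp: param_domain_def)
  qed
qed

text \<open>The bound kept with the limit transfers inequalities to the endpoint, and the
  unboundedness kept with the divergence lets an a priori bound discard the second
  alternative.\<close>

lemma mono_param_domain_limit:
  fixes f :: "real \<Rightarrow> real"
  assumes "0 < b"
    and mono: "\<And>s t. t \<in> param_domain b \<Longrightarrow> 0 \<le> s \<Longrightarrow> s \<le> t \<Longrightarrow> f s \<le> f t"
  obtains (limit) l where "((\<lambda>s. f (real_of_ereal s)) \<longlongrightarrow> l) (at_left b)"
      and "\<And>t. t \<in> param_domain b \<Longrightarrow> f t \<le> l"
    | (infinite) "filterlim (\<lambda>s. f (real_of_ereal s)) at_top (at_left b)"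
        and "\<not> bdd_above (f ` param_domain b)"
proof (cases "bdd_above (f ` param_domain b)")
  case True
  define l where "l = Sup (f ` param_domain b)"
  have D0: "0 \<in> param_domain b" using assms by (auto simp: param_domain_def zero_ereal_def)
  have le: "f t \<le> l" if "t \<in> param_domain b" for t
    unfolding l_def using True that by (intro cSup_upper) auto
  have "((\<lambda>s. f (real_of_ereal s)) \<longlongrightarrow> l) (at_left b)"
  proof (rule increasing_tendsto)
    show "\<forall>\<^sub>F s in at_left b. f (real_of_ereal s) \<le> l"
      using eventually_at_left_param_domain[OF D0] by eventually_elim (auto intro: le)
    fix x assume "x < l"
    then obtain t where t: "t \<in> param_domain b" "x < f t"
      unfolding l_def using D0 True by (subst (asm) less_cSup_iff) auto
    show "\<forall>\<^sub>F s in at_left b. x < f (real_of_ereal s)"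
      using eventually_at_left_param_domain[OF t(1)]
    proof eventually_elim
      case (elim s)
      then have "f t \<le> f (real_of_ereal s)" using t by (intro mono) (auto simp: param_domain_def)
      with t show ?case by simp
    qed
  qed
  with le show ?thesis by (rule limit[rotated])
next
  case False
  have "filterlim (\<lambda>s. f (real_of_ereal s)) at_top (at_left b)"
    unfolding filterlim_at_top
  proof
    fix Z
    obtain t where t: "t \<in> param_domain b" "Z < f t"
      using False unfolding bdd_above_def by (auto simp: not_le)
    show "\<forall>\<^sub>F s in at_left b. Z \<le> f (real_of_ereal s)"
      using eventually_at_left_param_domain[OF t(1)]
    proof eventually_elim
      case (elim s)
      then have "f t \<le> f (real_of_ereal s)" using t by (intro mono) (auto simp: param_domain_def)
      with t show ?case by simp
    qed
  qed
  with False show ?thesis by (rule infinite[rotated])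
qed

text \<open>A photon stripped of charts and metric. \<open>w\<close> and \<open>p\<close> are the
  derivatives of \<open>u\<close> and \<open>r\<close> in the affine parameter, \<open>M\<close> is
  the mass aspect along the ray, and \<open>a1\<close>, \<open>a2\<close>, \<open>n\<close> are the
  two accelerations and the mass loss with powers of \<open>w\<close> divided out. The last estimate
  bounds the derivative of \<open>p / w - M / (2 * r)\<close> along \<open>u\<close> from below.
  \<open>K\<close> is both the error constant and the radius beyond which the errors are controlled;
  the estimates are demanded only for \<open>0 < w\<close>, where \<open>p / w\<close> has its
  meaning.\<close>

locale null_ray =
  fixes b :: ereal and u r w p M :: "real \<Rightarrow> real" and \<xi> :: "real \<Rightarrow> real^3" and K \<Omega> :: real
  assumes b_pos: "0 < b" and K: "1 \<le> K" and Omega: "0 \<le> \<Omega>"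
    and du: "\<And>t. t \<in> param_domain b \<Longrightarrow> (u has_real_derivative w t) (at t within param_domain b)"
    and dr: "\<And>t. t \<in> param_domain b \<Longrightarrow> (r has_real_derivative p t) (at t within param_domain b)"
    and cont_w: "continuous_on (param_domain b) w"
    and cont_p: "continuous_on (param_domain b) p"
    and cont_M: "continuous_on (param_domain b) M"
    and cont_xi: "continuous_on (param_domain b) \<xi>"
    and norm_xi: "\<And>t. t \<in> param_domain b \<Longrightarrow> norm (\<xi> t) = 1"
    and estimates: "\<And>t. t \<in> param_domain b \<Longrightarrow> K < r t \<Longrightarrow> 0 < w t \<Longrightarrow> \<exists>a1 a2 n q \<xi>'.
       (w has_real_derivative a1 * (w t)\<^sup>2) (at t within param_domain b) \<and>
       (p has_real_derivative a2 * (w t)\<^sup>2) (at t within param_domain b) \<and>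
       (M has_real_derivative n * w t) (at t within param_domain b) \<and>
       (\<xi> has_vector_derivative \<xi>') (at t within param_domain b) \<and>
       \<bar>M t\<bar> \<le> K \<and> 0 \<le> q \<and> \<bar>q - 1 - 2 * (p t / w t)\<bar> \<le> K * (1 + q) / r t \<and>
       \<bar>a1\<bar> \<le> K * (1 + q) \<and> norm \<xi>' \<le> K * (1 + q) * w t \<and>
       q * (\<Omega> + p t / w t) / r t - K * (1 + q)\<^sup>2 / (r t)\<^sup>2
         \<le> a2 - p t / w t * a1 - (n / (2 * r t) - M t * (p t / w t) / (2 * (r t)\<^sup>2))"
begin

abbreviation (input) D where "D \<equiv> param_domain b"
definition rdot where "rdot t = p t / w t"
definition xc where "xc = rdot_crit \<Omega>"
definition excess where "excess t = rdot t - xc"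
text \<open>Subtracting \<open>M / (2 r)\<close> removes the mass loss term from the radial acceleration.\<close>
definition Y where "Y t = rdot t - M t / (2 * r t)"
definition K4 where "K4 = 48 * K * (\<Omega> + 5)"

text \<open>The third clause is \<open>K4 \<le> excess t * r t\<close> multiplied by
  \<open>w t\<close>: without the quotient it passes to a limit before \<open>w\<close> is known to
  be positive there.\<close>

definition good where
  "good t \<longleftrightarrow> K4 \<le> r t \<and> 0 < w t \<and> K4 * w t \<le> (p t - xc * w t) * r t"

lemma K4: "240 * K \<le> K4" "0 < K4"
proof -
  have "0 \<le> K * \<Omega>" using K Omega by simp
  then show "240 * K \<le> K4" by (simp add: K4_def algebra_simps)
  then show "0 < K4" using K by linarith
qed

lemma xc: "xc \<le> 0" "- 1/2 \<le> xc"
  using rdot_crit_bounds[OF Omega] by (auto simp: xc_def)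

lemma goodD:
  assumes "good t"
  shows "0 < w t" "K4 \<le> r t" "K4 \<le> excess t * r t" "0 < r t" "0 < excess t" "- 1/2 < rdot t"
    "240 \<le> r t"
proof -
  show 1: "0 < w t" "K4 \<le> r t" using assms by (auto simp: good_def)
  then show r: "0 < r t" using K4 by simp
  show "240 \<le> r t" using 1 K4 K by simp
  show 2: "K4 \<le> excess t * r t"
    using assms 1 by (simp add: good_def excess_def rdot_def field_simps)
  then have "0 < excess t * r t" using K4 by linarith
  then show "0 < excess t" using r by (simp add: zero_less_mult_iff)
  then show "- 1/2 < rdot t" using xc by (simp add: excess_def)
qed

text \<open>Here \<open>y\<close> is the derivative of \<open>Y\<close> along \<open>u\<close>, and
  the factor \<open>w t\<close> converts it to the affine parameter. Bounds in \<open>q\<close>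
  become bounds in \<open>rdot\<close> through \<open>1 + q \<le> 4 * (1 + rdot t)\<close>.\<close>

lemma good_derivatives:
  assumes t: "t \<in> D" and g: "good t"
  obtains y a1 \<xi>' where "(Y has_real_derivative y * w t) (at t within D)"
    and "(xc\<^sup>2 / 2 + excess t / 6 + 3/2 * (excess t)\<^sup>2) / r t \<le> y"
    and "(w has_real_derivative a1 * (w t)\<^sup>2) (at t within D)"
    and "\<bar>a1\<bar> \<le> 4 * K * (1 + rdot t)"
    and "(\<xi> has_vector_derivative \<xi>') (at t within D)"
    and "norm \<xi>' \<le> 4 * K * (1 + rdot t) * w t"
    and "\<bar>M t\<bar> \<le> K" and "\<bar>Y t - rdot t\<bar> \<le> K / (2 * r t)"
proof -
  note gd = goodD[OF g]
  have "K < r t" using gd(2) K4 K by linarith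
  from estimates[OF t this gd(1)] obtain a1 a2 n q \<xi>' where
    dw: "(w has_real_derivative a1 * (w t)\<^sup>2) (at t within D)" and
    dp: "(p has_real_derivative a2 * (w t)\<^sup>2) (at t within D)" and
    dM: "(M has_real_derivative n * w t) (at t within D)" and
    dxi: "(\<xi> has_vector_derivative \<xi>') (at t within D)" and
    M: "\<bar>M t\<bar> \<le> K" and q: "0 \<le> q" and null: "\<bar>q - 1 - 2 * rdot t\<bar> \<le> K * (1 + q) / r t" and
    a1: "\<bar>a1\<bar> \<le> K * (1 + q)" and xi': "norm \<xi>' \<le> K * (1 + q) * w t" and
    y: "q * (\<Omega> + rdot t) / r t - K * (1 + q)\<^sup>2 / (r t)\<^sup>2
         \<le> a2 - rdot t * a1 - (n / (2 * r t) - M t * rdot t / (2 * (r t)\<^sup>2))"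
    unfolding rdot_def by blast
  define y where "y = a2 - rdot t * a1 - (n / (2 * r t) - M t * rdot t / (2 * (r t)\<^sup>2))"
  have growth: "(xc\<^sup>2 / 2 + excess t / 6 + 3/2 * (excess t)\<^sup>2) / r t \<le> y" "1 + q \<le> 4 * (1 + rdot t)"
    using modified_rdot_growth[OF Omega K q null y] gd
    by (auto simp: xc_def excess_def K4_def y_def)
  have q4: "K * (1 + q) \<le> 4 * K * (1 + rdot t)"
    using mult_left_mono[OF growth(2), of K] K by simp
  have "(Y has_real_derivative ((a2 * (w t)\<^sup>2 * w t - p t * (a1 * (w t)\<^sup>2)) / (w t * w t)
      - (n * w t * (2 * r t) - M t * (2 * p t)) / (2 * r t * (2 * r t)))) (at t within D)"
    unfolding Y_def[abs_def] rdot_def[abs_def]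
    by (rule derivative_eq_intros dw dp dM dr[OF t] refl | use gd in simp)+
  moreover have "((a2 * (w t)\<^sup>2 * w t - p t * (a1 * (w t)\<^sup>2)) / (w t * w t)
      - (n * w t * (2 * r t) - M t * (2 * p t)) / (2 * r t * (2 * r t))) = y * w t"
    using gd by (simp add: y_def rdot_def field_simps power2_eq_square)
  ultimately have "(Y has_real_derivative y * w t) (at t within D)" by simp
  moreover have "norm \<xi>' \<le> 4 * K * (1 + rdot t) * w t"
    using xi' mult_right_mono[OF q4, of "w t"] gd by linarith
  moreover have "\<bar>Y t - rdot t\<bar> \<le> K / (2 * r t)"
    using M gd by (simp add: Y_def divide_right_mono)
  ultimately show ?thesis
    using that[of y a1 \<xi>'] growth(1) dw dxi M a1 q4 by simp
qed

section \<open>Monotone quantities along a good ray\<close>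

lemma continuous_D: "continuous_on D u" "continuous_on D r"
  using du dr by (auto intro!: DERIV_continuous_on)

lemma continuous_Y: "T \<subseteq> D \<Longrightarrow> (\<And>t. t \<in> T \<Longrightarrow> good t) \<Longrightarrow> continuous_on T Y"
  unfolding Y_def[abs_def] rdot_def[abs_def]
proof (intro continuous_intros)
  assume T: "T \<subseteq> D" and g: "\<And>t. t \<in> T \<Longrightarrow> good t"
  show "continuous_on T p" "continuous_on T w" "continuous_on T M" "continuous_on T r"
    using T by (auto intro: continuous_on_subset cont_w cont_p cont_M continuous_D)
  show "\<forall>t\<in>T. w t \<noteq> 0" "\<forall>t\<in>T. 2 * r t \<noteq> 0"
    using goodD(1,4)[OF g] by force+
qed

lemma Y_mono:
  assumes "t \<in> D" "0 \<le> s" "s \<le> t" and g: "\<And>z. z \<in> {s..t} \<Longrightarrow> good z"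
  shows "Y s \<le> Y t"
proof (rule deriv_nonneg_mono_param_domain[OF assms(1-3)])
  show "continuous_on {s..t} Y"
    using assms param_domain_down by (intro continuous_Y) auto
  fix z assume z: "s < z" "z < t"
  have zD: "z \<in> D" using param_domain_down[OF assms(1), of z] z assms by auto
  have gz: "good z" using g z by auto
  show "\<exists>y\<ge>0. (Y has_real_derivative y) (at z within D)"
  proof (rule good_derivatives[OF zD gz])
    fix y assume d: "(Y has_real_derivative y * w z) (at z within D)"
      and "(xc\<^sup>2 / 2 + excess z / 6 + 3/2 * (excess z)\<^sup>2) / r z \<le> y"
    moreover have "0 \<le> (xc\<^sup>2 / 2 + excess z / 6 + 3/2 * (excess z)\<^sup>2) / r z"
      using goodD[OF gz] by simp
    ultimately have "0 \<le> y" by linarith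
    then have "0 \<le> y * w z" using goodD(1)[OF gz] by simp
    with d show ?thesis by blast
  qed
qed

text \<open>The shift from \<open>rdot\<close> to \<open>Y\<close> is at most
  \<open>K / (2 * r)\<close>, while \<open>r\<close> and \<open>excess * r\<close> are both at least
  \<open>240 * K\<close>; hence the factor 480, once relative to the excess and once relative to
  1.\<close>

lemma Y_bounds:
  assumes t: "t \<in> D" and g: "good t"
  shows "480 * (Y t - rdot t) \<le> excess t" and "480 * (rdot t - Y t) \<le> excess t"
    and "480 * (Y t - rdot t) \<le> 1" and "480 * (rdot t - Y t) \<le> 1"
proof -
  note gd = goodD[OF g]
  have 1: "\<bar>Y t - rdot t\<bar> \<le> K / (2 * r t)" by (rule good_derivatives[OF t g])
  have "240 * K \<le> excess t * r t" "240 * K \<le> r t" using gd K4 by linarith+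
  then have "480 * (K / (2 * r t)) \<le> excess t" "480 * (K / (2 * r t)) \<le> 1"
    using gd by (auto simp: field_simps)
  moreover have "Y t - rdot t \<le> K / (2 * r t)" "rdot t - Y t \<le> K / (2 * r t)"
    using 1 by (auto simp: abs_le_iff)
  ultimately show "480 * (Y t - rdot t) \<le> excess t" "480 * (rdot t - Y t) \<le> excess t"
    "480 * (Y t - rdot t) \<le> 1" "480 * (rdot t - Y t) \<le> 1" by argo+
qed

text \<open>The factor 18 is \<open>2 * 9\<close>: the reserve in the growth of \<open>Y\<close> is
  \<open>xc\<^sup>2 / 2\<close>, and \<open>(Y + 2)\<^sup>2 \<le> 9\<close> while the ray moves
  inwards. For \<open>xc = 0\<close> division by zero gives \<open>L = 0\<close>, as it should be:
  then \<open>rdot\<close> is positive and \<open>ln r\<close> increases unaided.\<close>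

definition L where "L = 18 / \<bar>xc\<bar>"

text \<open>While \<open>rdot < 0\<close>, the term \<open>- L / (Y + 2)\<close> grows along
  \<open>u\<close> at least at the rate \<open>L * xc\<^sup>2 / (18 * r) = |xc| / r\<close>, which
  covers the loss of \<open>ln r\<close>. The reciprocal is chosen because it is bounded: however
  large \<open>Y\<close> becomes, the total loss of \<open>ln r\<close> is at most
  \<open>L\<close>.\<close>

lemma log_radius_mono:
  assumes "t \<in> D" "0 \<le> s" "s \<le> t" and g: "\<And>z. z \<in> {s..t} \<Longrightarrow> good z"
  shows "ln (r s) - L / (Y s + 2) \<le> ln (r t) - L / (Y t + 2)"
proof (rule deriv_nonneg_mono_param_domain[OF assms(1-3)])
  have sub: "{s..t} \<subseteq> D" using assms param_domain_down by auto
  have pos: "0 < r z" "0 < Y z + 2" if "z \<in> {s..t}" for z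
  proof -
    have "z \<in> D" using that sub by auto
    from Y_bounds(4)[OF this g[OF that]] goodD(6)[OF g[OF that]] show "0 < Y z + 2" by argo
    show "0 < r z" by (rule goodD(4)[OF g[OF that]])
  qed
  show "continuous_on {s..t} (\<lambda>t. ln (r t) - L / (Y t + 2))"
    using pos by (intro continuous_intros continuous_Y[OF sub g] continuous_on_subset[OF continuous_D(2) sub])
      (auto simp: less_le)
  fix z assume z: "s < z" "z < t"
  then have zz: "z \<in> {s..t}" by auto
  have zD: "z \<in> D" and gz: "good z" using zz sub g by auto
  note gd = goodD[OF gz]
  show "\<exists>y\<ge>0. ((\<lambda>t. ln (r t) - L / (Y t + 2)) has_real_derivative y) (at z within D)"
  proof (rule good_derivatives[OF zD gz])
    fix y assume dY: "(Y has_real_derivative y * w z) (at z within D)"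
      and y: "(xc\<^sup>2 / 2 + excess z / 6 + 3/2 * (excess z)\<^sup>2) / r z \<le> y"
    have "((\<lambda>t. ln (r t) - L / (Y t + 2)) has_real_derivative
        (p z / r z + L * (y * w z) / (Y z + 2)\<^sup>2)) (at z within D)"
      by (rule derivative_eq_intros dr[OF zD] dY refl | use pos[OF zz] in \<open>simp add: power2_eq_square\<close>)+
    moreover have "0 \<le> p z / r z + L * (y * w z) / (Y z + 2)\<^sup>2"
    proof -
      have "xc\<^sup>2 / 2 / r z \<le> (xc\<^sup>2 / 2 + excess z / 6 + 3/2 * (excess z)\<^sup>2) / r z"
        using gd by (intro divide_right_mono) auto
      then have ry: "xc\<^sup>2 / 2 / r z \<le> y" using y by linarith
      then have y0: "0 \<le> y" using gd by (smt (verit) divide_nonneg_pos zero_le_power2)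
      have L0: "0 \<le> L" by (simp add: L_def)
      have "- (rdot z) / r z \<le> L * y / (Y z + 2)\<^sup>2"
      proof (cases "0 \<le> rdot z")
        case True
        then have "- (rdot z) / r z \<le> 0" using gd by simp
        also have "0 \<le> L * y / (Y z + 2)\<^sup>2" using y0 L0 by simp
        finally show ?thesis .
      next
        case False
        then have neg: "xc < rdot z" "rdot z < 0" "xc < 0" using gd by (auto simp: excess_def)
        have "(Y z + 2)\<^sup>2 \<le> 3\<^sup>2"
          using Y_bounds(3)[OF zD gz] neg pos[OF zz] by (intro power_mono) argo+
        then have Y9: "(Y z + 2)\<^sup>2 \<le> 9" by simp
        have "- (rdot z) / r z \<le> - xc / r z"
          using neg gd by (intro divide_right_mono) auto
        also have "\<dots> = L * (xc\<^sup>2 / 2 / r z) / 9"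
          using neg by (simp add: L_def field_simps power2_eq_square)
        also have "\<dots> \<le> L * y / 9"
          using ry L0 by (intro divide_right_mono mult_left_mono) auto
        also have "\<dots> \<le> L * y / (Y z + 2)\<^sup>2"
          using Y9 L0 y0 pos[OF zz] by (intro divide_left_mono) auto
        finally show ?thesis .
      qed
      then have "0 \<le> (rdot z / r z + L * y / (Y z + 2)\<^sup>2) * w z"
        using gd by (intro mult_nonneg_nonneg) auto
      also have "\<dots> = p z / r z + L * (y * w z) / (Y z + 2)\<^sup>2"
        using gd by (simp add: rdot_def distrib_right)
      finally show ?thesis .
    qed
    ultimately show ?thesis by blast
  qed
qed

text \<open>The logarithmic estimate keeps the radius above \<open>exp (- L)\<close> times its
  initial value; the factor 1/2 turns this into a strict inequality.\<close>

definition c where "c = exp (- L) / 2"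
text \<open>Solved from \<open>2 * c * (M0 - K / 2) = K4 + K\<close>: the \<open>K / 2\<close>
  covers the shift from \<open>rdot\<close> to \<open>Y\<close> at emission, and
  \<open>2 * c\<close> the possible loss of radius.\<close>

definition M0 where "M0 = K / 2 + (K4 + K) / (2 * c)"

lemma c: "0 < c" "2 * c \<le> 1"
  by (auto simp: c_def L_def)

text \<open>Up to and including a first failure of the strict conditions \<open>P\<close>, the weak
  conditions \<open>good\<close> hold. Then \<open>Y\<close> has not decreased and
  \<open>ln r\<close> has lost at most \<open>L\<close>, which gives the strict conditions back at
  the failure time itself.\<close>

lemma all_good:
  assumes w0: "0 < w 0" and start: "M0 / r 0 \<le> rdot 0 - xc" and far: "K4 \<le> c * r 0"
    and t: "t \<in> D"
  shows "good t" and "c * r 0 < r t"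
proof -
  define P where "P t \<longleftrightarrow> c * r 0 < r t \<and> 0 < w t \<and> K4 * w t < (p t - xc * w t) * r t" for t
  have r00: "0 < r 0" 
    using far K4 c by (smt (verit) zero_less_mult_iff)
  have D0: "0 \<in> D" using b_pos by (simp add: param_domain_def zero_ereal_def)
  have M0c: "K4 + K = 2 * c * (M0 - K / 2)" using c by (simp add: M0_def field_simps)
  have M0K: "K4 + K \<le> M0 - K / 2"
    unfolding M0c using c K K4 M0c by (intro mult_left_le_one_le) (auto simp: M0_def)
  have "K4 < M0" using M0K K by linarith
  also have "M0 \<le> (rdot 0 - xc) * r 0" using start r00 by (simp add: field_simps)
  finally have "K4 * w 0 < (rdot 0 - xc) * r 0 * w 0" using w0 by simp
  also have "\<dots> = (p 0 - xc * w 0) * r 0" using w0 by (simp add: rdot_def field_simps)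
  finally have P0: "P 0"
    using c r00 w0 mult_right_mono[OF c(2), of "r 0"] mult_pos_pos[OF c(1) r00] by (simp add: P_def)
  have PI: "P t" if t: "t \<in> D" for t
  proof (rule ccontr)
    assume nP: "\<not> P t"
    have sub: "{0..t} \<subseteq> D" using param_domain_down[OF t] by auto
    \<comment> \<open>The set of failures is written as a union of conditions closed under limits,
      so that it is compact and has a least element.\<close>
    define S where "S = {s \<in> {0..t}. r s \<le> c * r 0} \<union> {s \<in> {0..t}. w s \<le> 0}
        \<union> {s \<in> {0..t}. (p s - xc * w s) * r s \<le> K4 * w s}"
    have S_iff: "s \<in> S \<longleftrightarrow> s \<in> {0..t} \<and> \<not> P s" for s
      by (auto simp: S_def P_def)
    have "closed S"
      unfolding S_def
      by (intro closed_Un continuous_on_closed_Collect_le continuous_intros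
          continuous_on_subset[OF cont_w sub] continuous_on_subset[OF cont_p sub]
          continuous_on_subset[OF continuous_D(2) sub])
    moreover have "S \<subseteq> {0..t}" by (auto simp: S_iff)
    ultimately have "compact S" by (metis bounded_closed_interval bounded_subset compact_eq_bounded_closed cbox_interval)
    moreover have "S \<noteq> {}" using nP t by (auto simp: S_iff param_domain_def)
    ultimately obtain T where T: "T \<in> S" "\<And>s. s \<in> S \<Longrightarrow> T \<le> s"
      using compact_attains_inf by metis
    have nPT: "\<not> P T" and T0: "0 \<le> T" "T \<le> t" using T by (auto simp: S_iff)
    have Tpos: "0 < T" using nPT P0 T0 by (cases "T = 0") auto
    have before: "P s" if "0 \<le> s" "s < T" for s
      using T(2)[of s] that T0 by (force simp: S_iff)
    have TD: "T \<in> D" using T0 sub by auto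
    have subT: "{0..T} \<subseteq> D" using T0 sub by auto
    note contT = continuous_on_subset[OF cont_w subT] continuous_on_subset[OF cont_p subT]
      continuous_on_subset[OF continuous_D(2) subT]
    have good_before: "good s" if "0 \<le> s" "s < T" for s
      using before[OF that] far by (auto simp: good_def P_def)
    have cl: "closure {0..<T} = {0..T}" using Tpos by simp
    have rT: "c * r 0 \<le> r T"
      by (rule continuous_ge_on_closure[of "{0..<T}"])
        (use contT before Tpos in \<open>auto simp: cl P_def less_imp_le\<close>)
    have "0 \<le> (p T - xc * w T) * r T - K4 * w T"
      by (rule continuous_ge_on_closure[of "{0..<T}"])
        (use contT before Tpos in \<open>auto simp: cl P_def less_imp_le intro!: continuous_intros\<close>)
    \<comment> \<open>Positivity of \<open>w\<close> is the one condition that a limit may lose.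
      With \<open>B\<close> bounding \<open>|w + p|\<close>, the derivative
      \<open>a1 * w\<^sup>2\<close> is at least \<open>- 4 * K * B * w\<close>, so \<open>w\<close>
      decays at most exponentially.\<close>
    moreover have wT: "0 < w T"
    proof -
      have "bounded ((\<lambda>s. \<bar>w s + p s\<bar>) ` {0..T})"
        by (intro compact_imp_bounded compact_continuous_image continuous_intros contT) auto
      then obtain B where B: "\<And>s. s \<in> {0..T} \<Longrightarrow> \<bar>w s + p s\<bar> \<le> B"
        unfolding bounded_iff by fastforce
      have "w 0 * exp (4 * K * B * 0) \<le> w T * exp (4 * K * B * T)"
      proof (rule deriv_nonneg_mono_param_domain[OF TD _ T0(1)])
        show "continuous_on {0..T} (\<lambda>a. w a * exp (4 * K * B * a))"
          by (intro continuous_intros contT)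
        fix z assume z: "0 < z" "z < T"
        then have zD: "z \<in> D" using subT by auto
        have gz: "good z" using good_before z by auto
        note gd = goodD[OF gz]
        show "\<exists>y\<ge>0. ((\<lambda>a. w a * exp (4 * K * B * a)) has_real_derivative y) (at z within D)"
        proof (rule good_derivatives[OF zD gz])
          fix a1 assume dw: "(w has_real_derivative a1 * (w z)\<^sup>2) (at z within D)"
            and a1: "\<bar>a1\<bar> \<le> 4 * K * (1 + rdot z)"
          have "((\<lambda>a. w a * exp (4 * K * B * a)) has_real_derivative
             (a1 * (w z)\<^sup>2 + 4 * K * B * w z) * exp (4 * K * B * z)) (at z within D)"
            by (rule derivative_eq_intros dw refl | simp add: algebra_simps)+
          moreover have "0 \<le> a1 * (w z)\<^sup>2 + 4 * K * B * w z"
          proof -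
            have "- (a1 * w z) \<le> 4 * K * (1 + rdot z) * w z"
              using a1 gd mult_right_mono[of "- a1" "4 * K * (1 + rdot z)" "w z"] by simp
            also have "\<dots> = 4 * K * (w z + p z)"
              using gd by (simp add: rdot_def field_simps)
            also have "\<dots> \<le> 4 * K * B"
              using B[of z] z K by (intro mult_left_mono) auto
            finally have "0 \<le> a1 * w z + 4 * K * B" by linarith
            then have "0 \<le> (a1 * w z + 4 * K * B) * w z" using gd by simp
            then show ?thesis by (simp add: power2_eq_square algebra_simps)
          qed
          ultimately show ?thesis by (meson exp_ge_zero mult_nonneg_nonneg)
        qed
      qed auto
      then have "0 < w T * exp (4 * K * B * T)" using w0 by simp
      then show ?thesis by (simp add: zero_less_mult_iff)
    qed
    ultimately have gT: "good T" using rT far by (simp add: good_def)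
    have gall: "good z" if "z \<in> {0..T}" for z
      using good_before[of z] gT that by (cases "z = T") auto
    have g0: "good 0" using gall T0 by auto
    note gd = goodD[OF gT]
    have Y0T: "Y 0 \<le> Y T" using Y_mono[OF TD _ T0(1)] gall by auto
    have L0: "0 \<le> L" by (simp add: L_def)
    \<comment> \<open>From \<open>rdot > - 1/2\<close> and the small shift,
      \<open>Y 0 > - 1\<close>; so the initial weight is at most \<open>L\<close>.\<close>
    have "1 \<le> Y 0 + 2" using Y_bounds(4)[OF D0 g0] goodD(6)[OF g0] by argo
    then have "L / (Y 0 + 2) \<le> L" using L0 by (simp add: divide_le_eq mult_le_cancel_left1)
    moreover have "0 \<le> L / (Y T + 2)" using Y_bounds(4)[OF TD gT] goodD(6)[OF gT] L0
      by (intro divide_nonneg_nonneg) argo+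
    moreover have "ln (r 0) - L / (Y 0 + 2) \<le> ln (r T) - L / (Y T + 2)"
      using log_radius_mono[OF TD _ T0(1)] gall by auto
    ultimately have "ln (r 0) - L \<le> ln (r T)" by linarith
    then have "exp (ln (r 0) - L) \<le> r T" using gd by (metis exp_le_cancel_iff exp_ln)
    then have r2c: "2 * c * r 0 \<le> r T" using r00 by (simp add: c_def exp_diff exp_minus field_simps)
    then have "c * r 0 < r T" using mult_pos_pos[OF c(1) r00] by linarith
    moreover have "K4 * w T < (p T - xc * w T) * r T"
    proof -
      have eY: "excess T \<ge> M0 / r 0 - K / (2 * r 0) - K / (2 * r T)"
      proof -
        have "\<bar>Y 0 - rdot 0\<bar> \<le> K / (2 * r 0)" by (rule good_derivatives[OF D0 g0])
        moreover have "\<bar>Y T - rdot T\<bar> \<le> K / (2 * r T)" by (rule good_derivatives[OF TD gT])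
        ultimately show ?thesis using Y0T start unfolding excess_def by argo
      qed
      \<comment> \<open>Of the extra \<open>K\<close>, one half pays for the shift between
        \<open>Y\<close> and \<open>rdot\<close> at \<open>T\<close>; the other half makes the
        conclusion strict.\<close>
      have "K4 + K = 2 * c * (M0 - K / 2)" by (rule M0c)
      also have "\<dots> \<le> r T / r 0 * (M0 - K / 2)"
        using r2c r00 M0K K K4 by (intro mult_right_mono) (auto simp: field_simps)
      also have "\<dots> = (M0 / r 0 - K / (2 * r 0) - K / (2 * r T)) * r T + K / 2"
        using r00 gd by (simp add: field_simps)
      also have "\<dots> \<le> excess T * r T + K / 2"
        using mult_right_mono[OF eY, of "r T"] gd by simp
      finally have "K4 < excess T * r T" using K by linarith
      then have "K4 * w T < excess T * r T * w T" using wT by simp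
      also have "\<dots> = (p T - xc * w T) * r T" using wT by (simp add: excess_def rdot_def field_simps)
      finally show ?thesis .
    qed
    ultimately have "P T" using wT by (simp add: P_def)
    with nPT show False by contradiction
  qed
  show "good t" "c * r 0 < r t" using PI[OF t] far by (auto simp: P_def good_def)
qed

section \<open>Bounded retarded time and the end of a ray\<close>

lemma mono_if_good:
  assumes g: "\<And>t. t \<in> D \<Longrightarrow> good t" and f: "continuous_on D f"
    and "\<And>z. z \<in> D \<Longrightarrow> \<exists>y\<ge>0. (f has_real_derivative y) (at z within D)"
    and t: "t \<in> D" "0 \<le> s" "s \<le> t"
  shows "f s \<le> f t"
  using t by (intro deriv_nonneg_mono_param_domain[OF t] assms(3) continuous_on_subset[OF f])
    (auto intro: param_domain_down)

text \<open>With \<open>\<tau> = Y - xc\<close> and \<open>e\<close> the excess, the derivative of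
  \<open>r / \<tau>\<close> along \<open>u\<close> is
  \<open>(rdot * \<tau> - r * y) / \<tau>\<^sup>2\<close>. Here \<open>rdot \<le> e\<close> because
  \<open>xc \<le> 0\<close>, \<open>r * y \<ge> 3/2 * e\<^sup>2\<close>, and \<open>\<tau>\<close>
  is at most slightly larger than \<open>e\<close>. As 3/2 exceeds 1, the numerator is below about
  \<open>- 1/2 * e\<^sup>2\<close>, and 3/10 leaves room for the rounding.\<close>

lemma u_bounded:
  assumes g: "\<And>t. t \<in> D \<Longrightarrow> good t"
  shows "\<exists>B. \<forall>t\<in>D. u t \<le> B"
proof -
  define V where "V t = - (3/10) * u t - r t / (Y t - xc)" for t
  have T: "0 < Y t - xc" if "t \<in> D" for t
    using Y_bounds(2)[OF that g[OF that]] goodD(5)[OF g[OF that]] unfolding excess_def by argo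
  have "V 0 \<le> V t" if t: "t \<in> D" for t
  proof (rule mono_if_good[OF g _ _ t])
    show "continuous_on D V"
      unfolding V_def[abs_def] using T
      by (intro continuous_intros continuous_D continuous_Y g) (auto simp: less_le)
    fix z assume z: "z \<in> D"
    note gd = goodD[OF g[OF z]]
    show "\<exists>y\<ge>0. (V has_real_derivative y) (at z within D)"
    proof (rule good_derivatives[OF z g[OF z]])
      fix y assume dY: "(Y has_real_derivative y * w z) (at z within D)"
        and y: "(xc\<^sup>2 / 2 + excess z / 6 + 3/2 * (excess z)\<^sup>2) / r z \<le> y"
      define e where "e = excess z"
      define \<tau> where "\<tau> = Y z - xc"
      have e: "0 < e" "480 * (\<tau> - e) \<le> e" "0 < \<tau>" "rdot z \<le> e"
        using gd Y_bounds(1)[OF z g[OF z]] T[OF z] xc by (auto simp: e_def \<tau>_def excess_def)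
      have "(V has_real_derivative
         - (3/10) * w z - (p z * \<tau> - r z * (y * w z)) / (\<tau> * \<tau>)) (at z within D)"
        unfolding V_def[abs_def] \<tau>_def
        by (rule derivative_eq_intros du[OF z] dr[OF z] dY refl | use T[OF z] in simp)+
      also have "- (3/10) * w z - (p z * \<tau> - r z * (y * w z)) / (\<tau> * \<tau>)
          = w z * ((r z * y - rdot z * \<tau> - 3/10 * (\<tau> * \<tau>)) / (\<tau> * \<tau>))"
        using gd e by (simp add: rdot_def field_simps)
      finally have dV: "(V has_real_derivative
          w z * ((r z * y - rdot z * \<tau> - 3/10 * (\<tau> * \<tau>)) / (\<tau> * \<tau>))) (at z within D)" .
      have "3/2 * e\<^sup>2 \<le> xc\<^sup>2 / 2 + e / 6 + 3/2 * e\<^sup>2" using e by simp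
      also have "\<dots> \<le> r z * y" using y gd by (simp add: e_def field_simps)
      finally have ry: "3/2 * (e * e) \<le> r z * y" by (simp add: power2_eq_square)
      have te: "\<tau> \<le> 481/480 * e" using e(2) by argo
      have "rdot z * \<tau> \<le> e * \<tau>" using e by (intro mult_right_mono) auto
      also have "\<dots> \<le> e * (481/480 * e)" using te e by (intro mult_left_mono) auto
      finally have 1: "rdot z * \<tau> \<le> 481/480 * (e * e)" by simp
      have "\<tau> * \<tau> \<le> (481/480 * e) * (481/480 * e)" using te e by (intro mult_mono) auto
      also have "\<dots> \<le> 1.1 * (e * e)" by simp
      finally have 2: "\<tau> * \<tau> \<le> 1.1 * (e * e)" .
      have "0 \<le> e * e" by simp
      then have "0 \<le> r z * y - rdot z * \<tau> - 3/10 * (\<tau> * \<tau>)" using 1 2 ry by linarith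
      then show ?thesis using dV e gd by (intro exI conjI) auto
    qed
  qed (use t in \<open>auto simp: param_domain_def\<close>)
  note V_mono = this
  have "u t \<le> - (10/3) * V 0" if "t \<in> D" for t
  proof -
    have "V 0 \<le> V t" by (rule V_mono[OF that])
    moreover have "0 < r t / (Y t - xc)" using T[OF that] goodD(4)[OF g[OF that]] by simp
    ultimately show ?thesis unfolding V_def[of t] by simp
  qed
  then show ?thesis by blast
qed

text \<open>The radius need not be monotone, but \<open>r + u\<close> is, since
  \<open>rdot > - 1\<close>. Its derivative \<open>(rdot + 1) * w\<close> bounds the speed of
  \<open>\<xi>\<close> up to the factor \<open>4 * K\<close>, so each coordinate of
  \<open>\<xi>\<close> becomes monotone after \<open>4 * K * (r + u)\<close> is added. If
  \<open>r + u\<close> is bounded, everything therefore converges.\<close>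

theorem escape_or_limit:
  assumes g: "\<And>t. t \<in> D \<Longrightarrow> good t"
  obtains u_end where "((\<lambda>s. u (real_of_ereal s)) \<longlongrightarrow> u_end) (at_left b)"
    and "\<And>t. t \<in> D \<Longrightarrow> u t \<le> u_end"
    and "filterlim (\<lambda>s. r (real_of_ereal s)) at_top (at_left b) \<or>
      (\<exists>r_end \<xi>_end. ((\<lambda>s. r (real_of_ereal s)) \<longlongrightarrow> r_end) (at_left b) \<and>
         ((\<lambda>s. \<xi> (real_of_ereal s)) \<longlongrightarrow> \<xi>_end) (at_left b))"
proof -
  obtain B where B: "\<And>t. t \<in> D \<Longrightarrow> u t \<le> B" using u_bounded[OF g] by blast
  have u_mono: "u s \<le> u t" if "t \<in> D" "0 \<le> s" "s \<le> t" for s t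
    by (rule mono_if_good[OF g continuous_D(1) _ that]) (use du goodD(1)[OF g] in \<open>blast intro: less_imp_le\<close>)+
  have dG: "((\<lambda>t. r t + u t) has_real_derivative (rdot z + 1) * w z) (at z within D)" if z: "z \<in> D" for z
    by (rule derivative_eq_intros du[OF z] dr[OF z] refl
        | use goodD(1)[OF g[OF z]] in \<open>simp add: rdot_def field_simps\<close>)+
  have G_mono: "r s + u s \<le> r t + u t" if "t \<in> D" "0 \<le> s" "s \<le> t" for s t
  proof (rule mono_if_good[OF g _ _ that])
    show "continuous_on D (\<lambda>t. r t + u t)" by (intro continuous_intros continuous_D)
    show "\<exists>y\<ge>0. ((\<lambda>t. r t + u t) has_real_derivative y) (at z within D)" if z: "z \<in> D" for z
      using dG[OF z] goodD(1,6)[OF g[OF z]] by (intro exI[of _ "(rdot z + 1) * w z"]) auto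
  qed
  show ?thesis
  proof (rule mono_param_domain_limit[OF b_pos u_mono])
    assume "\<not> bdd_above (u ` D)"
    with B show ?thesis by (auto simp: bdd_above_def)
  next
    fix u_end assume u_end: "((\<lambda>s. u (real_of_ereal s)) \<longlongrightarrow> u_end) (at_left b)"
      and u_le: "\<And>t. t \<in> D \<Longrightarrow> u t \<le> u_end"
    have "filterlim (\<lambda>s. r (real_of_ereal s)) at_top (at_left b) \<or>
      (\<exists>r_end \<xi>_end. ((\<lambda>s. r (real_of_ereal s)) \<longlongrightarrow> r_end) (at_left b) \<and>
         ((\<lambda>s. \<xi> (real_of_ereal s)) \<longlongrightarrow> \<xi>_end) (at_left b))"
    proof (rule mono_param_domain_limit[OF b_pos G_mono])
      assume "filterlim (\<lambda>s. r (real_of_ereal s) + u (real_of_ereal s)) at_top (at_left b)"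
      then have "filterlim (\<lambda>s. - u (real_of_ereal s) + (r (real_of_ereal s) + u (real_of_ereal s))) at_top (at_left b)"
        by (rule filterlim_tendsto_add_at_top[OF tendsto_minus[OF u_end]])
      then show ?thesis by simp
    next
      fix l assume l: "((\<lambda>s. r (real_of_ereal s) + u (real_of_ereal s)) \<longlongrightarrow> l) (at_left b)"
        and Gl: "\<And>t. t \<in> D \<Longrightarrow> r t + u t \<le> l"
      have r_lim: "((\<lambda>s. r (real_of_ereal s)) \<longlongrightarrow> l - u_end) (at_left b)"
        using tendsto_diff[OF l u_end] by simp
      have "\<exists>z. ((\<lambda>s. \<xi> (real_of_ereal s) $ i) \<longlongrightarrow> z) (at_left b)" for i
      proof -
        define H where "H t = 4 * K * (r t + u t) + \<xi> t $ i" for t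
        have mono: "H s \<le> H t" if "t \<in> D" "0 \<le> s" "s \<le> t" for s t
        proof (rule mono_if_good[OF g _ _ that])
          show "continuous_on D H"
            unfolding H_def[abs_def] by (intro continuous_intros continuous_D cont_xi)
          show "\<exists>y\<ge>0. (H has_real_derivative y) (at z within D)" if z: "z \<in> D" for z
          proof (rule good_derivatives[OF z g[OF z]])
            fix \<xi>' assume dxi: "(\<xi> has_vector_derivative \<xi>') (at z within D)"
              and xi': "norm \<xi>' \<le> 4 * K * (1 + rdot z) * w z"
            have "((\<lambda>t. \<xi> t $ i) has_real_derivative \<xi>' $ i) (at z within D)"
              using bounded_linear.has_vector_derivative[OF bounded_linear_vec_nth dxi]
              by (simp add: has_real_derivative_iff_has_vector_derivative)
            then have "(H has_real_derivative 4 * K * ((rdot z + 1) * w z) + \<xi>' $ i) (at z within D)"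
              unfolding H_def[abs_def] by (intro DERIV_add DERIV_cmult dG z)
            moreover have "\<bar>\<xi>' $ i\<bar> \<le> 4 * K * ((rdot z + 1) * w z)"
              using xi' component_le_norm_cart[of \<xi>' i] by (simp add: algebra_simps)
            ultimately show ?thesis by (intro exI conjI) (auto simp: abs_le_iff)
          qed
        qed
        show ?thesis
        proof (rule mono_param_domain_limit[OF b_pos mono])
          assume "\<not> bdd_above (H ` D)"
          moreover have "H t \<le> 4 * K * l + 1" if "t \<in> D" for t
            unfolding H_def using component_le_norm_cart[of "\<xi> t" i] norm_xi[OF that] Gl[OF that] K
            by (intro add_mono mult_left_mono) auto
          ultimately show ?thesis by (auto simp: bdd_above_def)
        next
          fix k assume "((\<lambda>s. H (real_of_ereal s)) \<longlongrightarrow> k) (at_left b)"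
          from tendsto_diff[OF this tendsto_mult_left[OF l, of "4 * K"]]
          show ?thesis unfolding H_def by auto
        qed
      qed
      then obtain z where "\<And>i. ((\<lambda>s. \<xi> (real_of_ereal s) $ i) \<longlongrightarrow> z i) (at_left b)" by metis
      then have "((\<lambda>s. \<xi> (real_of_ereal s)) \<longlongrightarrow> (\<chi> i. z i)) (at_left b)"
        by (intro vec_tendstoI) simp
      with r_lim show ?thesis by blast
    qed
    with u_end u_le show ?thesis by (rule that)
  qed
qed

end

section \<open>Null vectors and the geodesic equation at a point of the asymptotic region\<close>


lemma abs_mult_le: "\<bar>a\<bar> \<le> A \<Longrightarrow> \<bar>b\<bar> \<le> B \<Longrightarrow> \<bar>a * b\<bar> \<le> A * (B::real)"
  unfolding abs_mult by (rule mult_mono) auto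

lemma abs_add_le: "\<bar>a\<bar> \<le> A \<Longrightarrow> \<bar>b\<bar> \<le> B \<Longrightarrow> \<bar>a + b\<bar> \<le> A + (B::real)"
  and abs_diff_le: "\<bar>a\<bar> \<le> A \<Longrightarrow> \<bar>b\<bar> \<le> B \<Longrightarrow> \<bar>a - b\<bar> \<le> A + (B::real)"
  by linarith+

lemma rdot_bound:
  fixes q x X b :: real
  assumes "\<bar>q - 1 - 2 * x\<bar> \<le> 37 * X + 2 * b" "b \<le> 1/100 * \<bar>x\<bar>" "X \<le> (1 + q) / 100" "0 \<le> q"
  shows "\<bar>x\<bar> \<le> 1 + q"
proof -
  have "100 * X \<le> 1 + q" using assms(3) by simp
  then show ?thesis using assms(1,2,4) by linarith
qed

lemma sum_shuffle:
  "(a1 + a2 + a3 + a4 + a5 + a6 + a7 + a8 + a9 - a10) - (b1 + b3 - b10)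
    = (a1 - b1) + a2 + (a3 - b3) + a4 + a5 + a6 + a7 + a8 + a9 - (a10 - (b10::real))"
  by simp

text \<open>
  \<open>g\<close> and \<open>dg\<close> are the metric components and their first derivatives at a point, \<open>l\<^sup>2\<close> is the conformal
  factor of the round metric in the stereographic chart, and \<open>\<mu>\<close>, \<open>\<eta>\<close> stand for the \<open>u\<close>-derivatives
  of \<open>m\<close> and \<open>h\<^sup>(\<^sup>1\<^sup>)\<close>.
\<close>

locale asymptotic_point =
  fixes g :: "4 \<Rightarrow> 4 \<Rightarrow> real" and dg :: "4 \<Rightarrow> 4 \<Rightarrow> 4 \<Rightarrow> real" and K r l \<mu> :: real
    and \<eta> :: "4 \<Rightarrow> 4 \<Rightarrow> real"
  assumes K: "1 \<le> K" and r: "100 * K \<le> r" and l: "2/5 \<le> l" "l \<le> 2"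
    and sym: "\<And>a b. g a b = g b a" "\<And>c a b. dg c a b = dg c b a"
    and g2: "\<And>a. a \<in> {2,3,4} \<Longrightarrow> g 2 a = 0" "\<And>a c. a \<in> {2,3,4} \<Longrightarrow> dg c 2 a = 0"
    and uu: "\<bar>g 1 1 + 1\<bar> \<le> K / r" "\<bar>dg 1 1 1 - \<mu> / r\<bar> \<le> K / r^2" "\<bar>dg 2 1 1\<bar> \<le> K / r^2"
      "\<And>I. I \<in> {3,4} \<Longrightarrow> \<bar>dg I 1 1\<bar> \<le> K / r"
    and ur: "\<bar>g 1 2 + 1\<bar> \<le> K / r^2" "\<bar>dg 1 1 2\<bar> \<le> K / r^2" "\<bar>dg 2 1 2\<bar> \<le> K / r^3"
      "\<And>I. I \<in> {3,4} \<Longrightarrow> \<bar>dg I 1 2\<bar> \<le> K / r^2"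
    and uI: "\<And>I. I \<in> {3,4} \<Longrightarrow> \<bar>g 1 I\<bar> \<le> K" "\<And>I. I \<in> {3,4} \<Longrightarrow> \<bar>dg 1 1 I\<bar> \<le> K"
      "\<And>I. I \<in> {3,4} \<Longrightarrow> \<bar>dg 2 1 I\<bar> \<le> K / r"
      "\<And>I J. I \<in> {3,4} \<Longrightarrow> J \<in> {3,4} \<Longrightarrow> \<bar>dg J 1 I\<bar> \<le> K"
    and IJ: "\<And>I J. I \<in> {3,4} \<Longrightarrow> J \<in> {3,4} \<Longrightarrow> \<bar>g I J - (if I = J then l^2 else 0) * r^2\<bar> \<le> K * r"
      "\<And>I J. I \<in> {3,4} \<Longrightarrow> J \<in> {3,4} \<Longrightarrow> \<bar>dg 1 I J - \<eta> I J * r\<bar> \<le> K"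
      "\<And>I J. I \<in> {3,4} \<Longrightarrow> J \<in> {3,4} \<Longrightarrow> \<bar>dg 2 I J - (if I = J then l^2 else 0) * (2 * r)\<bar> \<le> K"
      "\<And>I J k. I \<in> {3,4} \<Longrightarrow> J \<in> {3,4} \<Longrightarrow> k \<in> {3,4} \<Longrightarrow> \<bar>dg k I J\<bar> \<le> K * r^2"
    and mu: "\<bar>\<mu>\<bar> \<le> K" and eta: "\<And>I J. I \<in> {3,4} \<Longrightarrow> J \<in> {3,4} \<Longrightarrow> \<bar>\<eta> I J\<bar> \<le> K"
begin

lemma r1: "100 \<le> r" "1 \<le> r" "0 < r"
  using K r by auto

text \<open>The radial row contains only \<open>g 1 2\<close>, which gives \<open>v 1 = 0\<close>;
  the angular block is diagonally dominant for large \<open>r\<close>, which gives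
  \<open>v 3 = v 4 = 0\<close>; the first row then leaves \<open>v 2\<close>. This makes the inverse
  in the Christoffel symbols a genuine one.\<close>

lemma nondegenerate:
  assumes "\<And>e. g e 1 * v 1 + g e 2 * v 2 + g e 3 * v 3 + g e 4 * v 4 = 0"
  shows "v 1 = 0" "v 2 = 0" "v 3 = 0" "v 4 = 0"
proof -
  have "K / r^2 \<le> K / r" using r1 K by (intro divide_left_mono) (auto simp: power2_eq_square)
  also have "K / r < 1" using r r1 K by (simp add: field_simps)
  finally have F: "g 1 2 \<noteq> 0" using ur(1) by auto
  show v1: "v 1 = 0" using assms[of 2] g2(1) sym(1)[of 2 1] F by auto
  have 34: "(g I I) \<ge> r^2 / 10" if "I \<in> {3,4}" for I
  proof -
    have "K * r \<le> r^2 / 100" using mult_right_mono[OF r, of r] r1 by (simp add: power2_eq_square)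
    moreover have "(2/5)^2 * r^2 \<le> l^2 * r^2" using l by (intro mult_right_mono power_mono) auto
    ultimately show ?thesis using IJ(1)[OF that that] by (auto simp: abs_le_iff power2_eq_square)
  qed
  have off: "\<bar>g 3 4\<bar> \<le> r^2 / 100"
  proof -
    have "K * r \<le> r^2 / 100" using mult_right_mono[OF r, of r] r1 by (simp add: power2_eq_square)
    then show ?thesis using IJ(1)[of 3 4] by simp
  qed
  have rr: "0 < r^2" using r1 by simp
  have e: "g 3 3 * v 3 + g 3 4 * v 4 = 0" "g 3 4 * v 3 + g 4 4 * v 4 = 0"
    using assms[of 3] assms[of 4] v1 g2(1) sym(1)[of 3 2] sym(1)[of 4 2] sym(1)[of 4 3] by auto
  have d: "0 < g 3 3 * g 4 4 - g 3 4 * g 3 4"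
  proof -
    have "\<bar>g 3 4\<bar> * \<bar>g 3 4\<bar> \<le> r^2 / 100 * (r^2 / 100)" using off by (intro mult_mono) auto
    moreover have "r^2 / 10 * (r^2 / 10) \<le> g 3 3 * g 4 4"
    proof (rule mult_mono)
      show "r^2 / 10 \<le> g 3 3" "r^2 / 10 \<le> g 4 4" using 34 by auto
      then show "0 \<le> g 3 3" using rr by linarith
    qed simp
    moreover have "0 < r^2 * r^2" using rr by simp
    moreover have "\<bar>g 3 4\<bar> * \<bar>g 3 4\<bar> = g 3 4 * g 3 4" by simp
    ultimately show ?thesis by linarith
  qed
  have "(g 3 3 * g 4 4 - g 3 4 * g 3 4) * v 3 = 0" using e by algebra
  then show "v 3 = 0" using d by simp
  have "(g 3 3 * g 4 4 - g 3 4 * g 3 4) * v 4 = 0" using e by algebra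
  then show v4: "v 4 = 0" using d by simp
  show "v 2 = 0" using assms[of 1] v1 v4 \<open>v 3 = 0\<close> F by simp
qed

end

text \<open>Velocity and acceleration are divided by \<open>du/dt\<close> and its square, so
  \<open>v 2\<close> is \<open>dr/du\<close>; \<open>a 1\<close> need not vanish, since the
  parameter stays affine. The geodesic equation is stated with a lowered index, which keeps the
  inverse metric out of the estimates.\<close>

locale asymptotic_photon = asymptotic_point +
  fixes v a :: "4 \<Rightarrow> real"
  assumes v1: "v 1 = 1"
    and null: "(\<Sum>c\<in>UNIV. \<Sum>d\<in>UNIV. g c d * v c * v d) = 0"
    and geodesic: "\<And>e. (\<Sum>c\<in>UNIV. g e c * a c) =
      - (\<Sum>c\<in>UNIV. \<Sum>d\<in>UNIV. 1/2 * (dg c e d + dg d e c - dg e c d) * v c * v d)"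
begin

definition q where "q = r^2 * l^2 * ((v 3)^2 + (v 4)^2)"

abbreviation (input) e where "e \<equiv> 1 + q"

lemma q_nonneg: "0 \<le> q" by (simp add: q_def)

lemma q_le: "q / r \<le> K * e / r" "0 \<le> q / r"
proof -
  have "1 * e \<le> K * e" using K q_nonneg by (intro mult_right_mono) auto
  then show "q / r \<le> K * e / r" using r1 by (intro divide_right_mono) auto
  show "0 \<le> q / r" using q_nonneg r1 by simp
qed

text \<open>The lower bound 2/5 for \<open>l\<close> gives the factor 25/4, rounded up to 7.\<close>

lemma vv: "(v 3)^2 + (v 4)^2 \<le> 7 * q / r^2"
proof -
  have "(2/5)^2 * ((v 3)^2 + (v 4)^2) \<le> l^2 * ((v 3)^2 + (v 4)^2)"
    using l by (intro mult_right_mono power_mono) auto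
  also have "\<dots> = q / r^2" using r1 by (simp add: q_def)
  finally have "4 * ((v 3)^2 + (v 4)^2) \<le> 25 * (q / r^2)" by (simp add: power_divide mult.commute)
  moreover have "0 \<le> q / r^2" using r1 by (simp add: q_def)
  ultimately have "4 * ((v 3)^2 + (v 4)^2) \<le> 28 * (q / r^2)" by linarith
  then show ?thesis by simp
qed

lemma ZZ:
  assumes "I \<in> {3,4}" "J \<in> {3,4}"
  shows "\<bar>v I * v J\<bar> \<le> 7 * e / r^2"
proof -
  have "\<bar>v I * v J\<bar> \<le> (v 3)^2 + (v 4)^2"
  proof -
    have "0 \<le> \<bar>v 3\<bar> * \<bar>v 4\<bar>" by simp
    then have "\<bar>v 3\<bar> * \<bar>v 4\<bar> \<le> v 3 * v 3 + v 4 * v 4"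
      using sum_squares_bound[of "\<bar>v 3\<bar>" "\<bar>v 4\<bar>"] unfolding power2_abs power2_eq_square mult.assoc
      by linarith
    then show ?thesis using assms by (auto simp: abs_mult power2_eq_square mult.commute)
  qed
  also note vv
  also have "7 * q / r^2 \<le> 7 * e / r^2" by (intro divide_right_mono) auto
  finally show ?thesis .
qed

text \<open>A single angular component is of size \<open>sqrt q / r\<close>; replacing
  \<open>sqrt q\<close> by \<open>1 + q\<close> makes all errors polynomial in
  \<open>1 + q\<close>.\<close>

lemma Z:
  assumes "I \<in> {3,4}"
  shows "\<bar>v I\<bar> \<le> 2 * e / r"
proof -
  have "(v I)^2 \<le> 7 * q / r^2" using vv assms by (auto intro: order_trans[rotated])
  also have "\<dots> \<le> (2 * e / r)^2"
    using q_nonneg by (simp add: power_divide power_mult_distrib divide_right_mono)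
      (simp add: power2_eq_square algebra_simps divide_right_mono)
  finally show ?thesis
    using q_nonneg r1 by (intro power2_le_imp_le[of "\<bar>v I\<bar>" "2 * e / r"]) auto
qed


section \<open>The null relation and the accelerations\<close>

lemma units:
  "K / r^2 \<le> K * e / r^2" "K * e / r^2 \<le> K * e^2 / r^2" "K * e / r^3 \<le> K * e / r^2"
  "K * e^2 / r^3 \<le> K * e^2 / r^2"
proof -
  note [simp] = r1(3)[THEN less_imp_le]
  have Ke: "0 \<le> K" using K by simp
  have 1: "1 \<le> e" using q_nonneg by simp
  have 3: "z / r^3 \<le> z / r^2" if "0 \<le> z" for z
    using that r1 by (intro divide_left_mono power_increasing) auto
  show "K / r^2 \<le> K * e / r^2" "K * e / r^2 \<le> K * e^2 / r^2"
    using 1 Ke by (auto intro!: divide_right_mono mult_left_mono simp: power2_eq_square mult_le_cancel_left1)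
  show "K * e / r^3 \<le> K * e / r^2" "K * e^2 / r^3 \<le> K * e^2 / r^2"
    using 1 Ke by (auto intro!: 3)
qed

lemma quadratic_form:
  fixes f :: "4 \<Rightarrow> 4 \<Rightarrow> real"
  assumes "\<And>I J. I \<in> {3,4} \<Longrightarrow> J \<in> {3,4} \<Longrightarrow> \<bar>f I J\<bar> \<le> F"
  shows "\<bar>f 3 3 * v 3 * v 3 + f 3 4 * v 3 * v 4 + f 4 3 * v 4 * v 3 + f 4 4 * v 4 * v 4\<bar> \<le> 28 * F * e / r^2"
proof -
  have "\<bar>f I J * v I * v J\<bar> \<le> 7 * F * e / r^2" if "I \<in> {3,4}" "J \<in> {3,4}" for I J
    using abs_mult_le[OF assms[OF that] ZZ[OF that]] by (simp add: mult.assoc mult.left_commute)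
  from this[of 3 3] this[of 3 4] this[of 4 3] this[of 4 4] show ?thesis by simp
qed

lemma linear_form:
  fixes f :: "4 \<Rightarrow> real"
  assumes "\<And>I. I \<in> {3,4} \<Longrightarrow> \<bar>f I\<bar> \<le> F"
  shows "\<bar>f 3 * v 3 + f 4 * v 4\<bar> \<le> 4 * F * e / r"
proof -
  have "\<bar>f I * v I\<bar> \<le> 2 * F * e / r" if "I \<in> {3,4}" for I
    using abs_mult_le[OF assms[OF that] Z[OF that]] by (simp add: mult.assoc mult.left_commute)
  from this[of 3] this[of 4] show ?thesis by simp
qed

text \<open>To leading order the null condition reads \<open>- 1 - 2 * v 2 + q = 0\<close>. The
  error \<open>(g 1 2 + 1) * v 2\<close> involves the unknown \<open>v 2\<close>, so a first pass
  with the crude factor 1/100 yields \<open>\<bar>v 2\<bar> \<le> 1 + q\<close>, and a second pass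
  inserts this.\<close>

lemma null_estimate: "\<bar>q - 1 - 2 * v 2\<bar> \<le> 39 * K * e / r" and rdot_le: "\<bar>v 2\<bar> \<le> e"
proof -
  have eq: "g 1 1 + 2 * (g 1 2 * v 2) + 2 * (g 1 3 * v 3 + g 1 4 * v 4)
     + (g 3 3 * v 3 * v 3 + g 3 4 * v 3 * v 4 + g 4 3 * v 4 * v 3 + g 4 4 * v 4 * v 4) = 0"
    using null v1 g2(1) sym(1)[of 3 2] sym(1)[of 4 2] sym(1)[of 3 1] sym(1)[of 4 1] sym(1)[of 2 1]
    by (simp add: sum_4 algebra_simps)
  define X where "X = K * e / r"
  define f where "f I J = g I J - (if I = J then l^2 else 0) * r^2" for I J
  have "\<bar>f 3 3 * v 3 * v 3 + f 3 4 * v 3 * v 4 + f 4 3 * v 4 * v 3 + f 4 4 * v 4 * v 4\<bar> \<le> 28 * (K * r) * e / r^2"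
    by (rule quadratic_form) (use IJ(1) in \<open>auto simp: f_def\<close>)
  also have "28 * (K * r) * e / r^2 = 28 * X" using r1 by (simp add: X_def power2_eq_square)
  also have "f 3 3 * v 3 * v 3 + f 3 4 * v 3 * v 4 + f 4 3 * v 4 * v 3 + f 4 4 * v 4 * v 4
      = (g 3 3 * v 3 * v 3 + g 3 4 * v 3 * v 4 + g 4 3 * v 4 * v 3 + g 4 4 * v 4 * v 4) - q"
    by (simp add: f_def q_def power2_eq_square algebra_simps)
  finally have A: "\<bar>(g 3 3 * v 3 * v 3 + g 3 4 * v 3 * v 4 + g 4 3 * v 4 * v 3 + g 4 4 * v 4 * v 4) - q\<bar> \<le> 28 * X" .
  have B: "\<bar>g 1 3 * v 3 + g 1 4 * v 4\<bar> \<le> 4 * X"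
    using linear_form[of "g 1" K] uI(1) by (simp add: X_def)
  have C: "\<bar>g 1 1 + 1\<bar> \<le> X"
  proof -
    have "K * 1 \<le> K * e" using K q_nonneg by (intro mult_left_mono) auto
    then have "K / r \<le> X" using r1 unfolding X_def by (intro divide_right_mono) auto
    then show ?thesis using uu(1) by linarith
  qed
  have "K / r^2 \<le> K / r / 100"
    using r1 K by (auto simp: power2_eq_square field_simps)
  then have "\<bar>g 1 2 + 1\<bar> \<le> K / r / 100" using ur(1) by linarith
  then have D: "\<bar>(g 1 2 + 1) * v 2\<bar> \<le> K / r / 100 * \<bar>v 2\<bar>" by (intro abs_mult_le) auto
  have Kr: "K / r \<le> 1/100" using r r1 by (simp add: field_simps)
  have X: "X \<le> e / 100"
    using mult_right_mono[OF Kr, of e] q_nonneg by (simp add: X_def)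
  have "K / r / 100 * \<bar>v 2\<bar> \<le> 1/100 * \<bar>v 2\<bar>" 
    using divide_right_mono[OF Kr, of 100] by (intro mult_right_mono) auto
  with D have D': "\<bar>(g 1 2 + 1) * v 2\<bar> \<le> 1/100 * \<bar>v 2\<bar>" by linarith
  have id: "q - 1 - 2 * v 2 = - (g 1 1 + 1) - 2 * ((g 1 2 + 1) * v 2) - 2 * (g 1 3 * v 3 + g 1 4 * v 4)
    - ((g 3 3 * v 3 * v 3 + g 3 4 * v 3 * v 4 + g 4 3 * v 4 * v 3 + g 4 4 * v 4 * v 4) - q)"
    using eq by (simp add: algebra_simps)
  have b1: "\<bar>q - 1 - 2 * v 2\<bar> \<le> 37 * X + 2 * \<bar>(g 1 2 + 1) * v 2\<bar>"
  proof -
    have "\<bar>- a - 2 * b - 2 * c - d\<bar> \<le> 37 * X + 2 * \<bar>b\<bar>"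
      if "\<bar>a\<bar> \<le> X" "\<bar>c\<bar> \<le> 4 * X" "\<bar>d\<bar> \<le> 28 * X" for a b c d :: real
      using that by linarith
    from this[OF C B A] show ?thesis unfolding id .
  qed
  then show v2: "\<bar>v 2\<bar> \<le> e" by (rule rdot_bound[OF _ D' X q_nonneg])
  have "K / r / 100 * \<bar>v 2\<bar> \<le> K / r / 100 * e" using v2 K r1 by (intro mult_left_mono) auto
  also have "\<dots> = X / 100" by (simp add: X_def)
  finally have "\<bar>(g 1 2 + 1) * v 2\<bar> \<le> X / 100" by (rule order_trans[OF D])
  moreover have "0 \<le> X" using C by linarith
  moreover have "p \<le> 39 * X" if "p \<le> 37 * X + 2 * b" "b \<le> X / 100" "0 \<le> X" for p b
    using that by linarith
  ultimately have "\<bar>q - 1 - 2 * v 2\<bar> \<le> 39 * X" using b1 by blast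
  then show "\<bar>q - 1 - 2 * v 2\<bar> \<le> 39 * K * e / r" by (simp add: X_def mult.assoc)
qed

text \<open>The radial row of the lowered equation involves no acceleration but \<open>a 1\<close>.
  Its leading source is \<open>1/2 * dg 2 I J * v I * v J\<close>, about \<open>q / r\<close>, and
  \<open>g 1 2\<close> is about \<open>- 1\<close>. As in the null relation, a crude bound for
  \<open>a 1\<close> is inserted into the error term.\<close>

lemma u_acceleration: "\<bar>a 1 + q / r\<bar> \<le> 25 * K * e / r^2" and u_acceleration_le: "\<bar>a 1\<bar> \<le> 26 * K * e / r"
proof -
  define X where "X = K * e / r^2"
  define W where "W = - dg 1 1 2 - (dg 3 1 2 * v 3 + dg 4 1 2 * v 4) + 1/2 * dg 2 1 1
     + (dg 2 1 3 * v 3 + dg 2 1 4 * v 4)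
     + 1/2 * (dg 2 3 3 * v 3 * v 3 + dg 2 3 4 * v 3 * v 4 + dg 2 4 3 * v 4 * v 3 + dg 2 4 4 * v 4 * v 4)"
  have eq: "g 1 2 * a 1 = W"
    unfolding W_def
    using geodesic[of 2] v1 g2(1) g2(2)[of 2] g2(2)[of 3] g2(2)[of 4] sym(1)[of 2 1] sym(2)[of _ 2 1]
      sym(2)[of _ 3 1] sym(2)[of _ 4 1] sym(2)[of _ 3 2] sym(2)[of _ 4 2]
    by (simp add: sum_4 algebra_simps)
  have l1: "\<bar>dg 3 1 2 * v 3 + dg 4 1 2 * v 4\<bar> \<le> 4 * X"
  proof -
    have "\<bar>dg 3 1 2 * v 3 + dg 4 1 2 * v 4\<bar> \<le> 4 * (K / r^2) * e / r"
      by (rule linear_form) (use ur(4) in auto)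
    also have "\<dots> = 4 * (K * e / r^3)" by (simp add: power2_eq_square power3_eq_cube)
    finally show ?thesis using units(3) by (simp add: X_def)
  qed
  have l2: "\<bar>dg 2 1 3 * v 3 + dg 2 1 4 * v 4\<bar> \<le> 4 * X"
  proof -
    have "\<bar>dg 2 1 3 * v 3 + dg 2 1 4 * v 4\<bar> \<le> 4 * (K / r) * e / r"
      by (rule linear_form) (use uI(3) in auto)
    then show ?thesis by (simp add: X_def power2_eq_square mult.assoc)
  qed
  define f where "f I J = dg 2 I J - (if I = J then l^2 else 0) * (2 * r)" for I J
  have "\<bar>f 3 3 * v 3 * v 3 + f 3 4 * v 3 * v 4 + f 4 3 * v 4 * v 3 + f 4 4 * v 4 * v 4\<bar> \<le> 28 * K * e / r^2"
    by (rule quadratic_form) (use IJ(3) in \<open>auto simp: f_def\<close>)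
  also have "f 3 3 * v 3 * v 3 + f 3 4 * v 3 * v 4 + f 4 3 * v 4 * v 3 + f 4 4 * v 4 * v 4 =
    (dg 2 3 3 * v 3 * v 3 + dg 2 3 4 * v 3 * v 4 + dg 2 4 3 * v 4 * v 3 + dg 2 4 4 * v 4 * v 4) - 2 * (q / r)"
  proof -
    have "q / r = r * l^2 * ((v 3)^2 + (v 4)^2)" using r1 by (simp add: q_def power2_eq_square)
    then show ?thesis by (simp add: f_def power2_eq_square algebra_simps)
  qed
  finally have Q: "\<bar>(dg 2 3 3 * v 3 * v 3 + dg 2 3 4 * v 3 * v 4 + dg 2 4 3 * v 4 * v 3 + dg 2 4 4 * v 4 * v 4) - 2 * (q / r)\<bar> \<le> 28 * X"
    by (simp add: X_def)
  have "\<bar>dg 1 1 2\<bar> \<le> X" "\<bar>dg 2 1 1\<bar> \<le> X" using ur(2) uu(3) units(1) by (auto simp: X_def)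
  moreover have "\<bar>W - q / r\<bar> \<le> 24 * X"
    if "\<bar>s1\<bar> \<le> 4 * X" "\<bar>s2\<bar> \<le> 4 * X" "\<bar>s3 - 2 * y\<bar> \<le> 28 * X" "\<bar>d1\<bar> \<le> X" "\<bar>d2\<bar> \<le> X"
      "W = - d1 - s1 + 1/2 * d2 + s2 + 1/2 * s3" "y = q / r" for s1 s2 s3 d1 d2 y
    using that by linarith
  ultimately have W: "\<bar>W - q / r\<bar> \<le> 24 * X"
    using l1 l2 Q W_def by blast
  have fa: "a 1 + q / r = - (W - q / r) + (g 1 2 + 1) * a 1" using eq by (simp add: algebra_simps)
  have d: "\<bar>(g 1 2 + 1) * a 1\<bar> \<le> K / r^2 * \<bar>a 1\<bar>" using ur(1) by (intro abs_mult_le) auto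
  have Kr: "K / r \<le> 1/100" using r r1 by (simp add: field_simps)
  have Kr2: "K / r^2 \<le> 1/10000"
  proof -
    have "K / r^2 = K / r * (1 / r)" by (simp add: power2_eq_square)
    also have "\<dots> \<le> 1/100 * (1/100)" using Kr r1 K by (intro mult_mono) auto
    finally show ?thesis by simp
  qed
  have Xr: "X = K * e / r * (1 / r)" by (simp add: X_def power2_eq_square)
  have Ker: "0 \<le> K * e / r" using K r1 q_nonneg by simp
  have "X \<le> K * e / r * (1/100)" unfolding Xr using r1 Ker by (intro mult_left_mono) auto
  then have Xle: "X \<le> K * e / r / 100" by simp
  have "K / r^2 * \<bar>a 1\<bar> \<le> 1/10000 * \<bar>a 1\<bar>" using Kr2 by (intro mult_right_mono) auto
  moreover have "\<bar>a 1\<bar> \<le> 2 * \<kappa>"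
    if "y \<le> \<kappa>" "0 \<le> y" "a 1 + y = - z + d" "\<bar>z\<bar> \<le> 24 * X" "100 * X \<le> \<kappa>" "\<bar>d\<bar> \<le> k" "k \<le> 1/10000 * \<bar>a 1\<bar>"
    for y \<kappa> z d k
    using that by linarith
  moreover have "100 * X \<le> K * e / r" using Xle by simp
  ultimately have a1: "\<bar>a 1\<bar> \<le> 2 * (K * e / r)"
    using q_le fa d W by blast
  then show "\<bar>a 1\<bar> \<le> 26 * K * e / r" using Ker by simp
  have "K / r^2 * \<bar>a 1\<bar> \<le> K / r^2 * (2 * (K * e / r))" using a1 K by (intro mult_left_mono) auto
  also have "\<dots> = X * (2 * (K / r))" by (simp add: X_def power2_eq_square)
  also have "\<dots> \<le> X * 1" 
  proof (rule mult_left_mono)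
    show "2 * (K / r) \<le> 1" using Kr by linarith
    show "0 \<le> X" using K q_nonneg by (simp add: X_def)
  qed
  finally have "K / r^2 * \<bar>a 1\<bar> \<le> X" by simp
  then have "\<bar>(g 1 2 + 1) * a 1\<bar> \<le> X" by (rule order_trans[OF d])
  from abs_add_le[OF _ this, of "- (W - q / r)" "24 * X"] have "\<bar>a 1 + q / r\<bar> \<le> 25 * X"
    using W unfolding fa abs_minus_cancel by simp
  then show "\<bar>a 1 + q / r\<bar> \<le> 25 * K * e / r^2" by (simp add: X_def mult.assoc)
qed

text \<open>An order of magnitude suffices, because the angular accelerations enter the radial one
  multiplied by \<open>g 1 I\<close>, which is only \<open>O(1)\<close>.\<close>

lemma angular_acceleration:
  assumes I: "I \<in> {3,4}"
  shows "\<bar>a I\<bar> \<le> 1600 * K^2 * e^2 / r^2"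
proof -
  have e1: "1 \<le> e" using q_nonneg by simp
  then have ee: "e \<le> e^2" by (simp add: power2_eq_square)
  define X where "X = K^2 * e^2"
  have K1: "K \<le> K^2" using K by (simp add: power2_eq_square)
  have units: "K \<le> X" "K * e \<le> X" "K * e^2 \<le> X" "K^2 * e \<le> X" "K * e / r \<le> X" "K^2 * e / r \<le> X" "K * e^2 / r \<le> X"
  proof -
    show K2e: "K^2 * e \<le> X" "K * e^2 \<le> X" using ee K1 K by (auto simp: X_def intro!: mult_left_mono mult_right_mono)
    have "K * e \<le> K^2 * e" using K1 e1 by (intro mult_right_mono) auto
    then show Ke: "K * e \<le> X" using K2e by linarith
    have "K \<le> K * e" using e1 K by (simp add: mult_le_cancel_left1)
    then show "K \<le> X" using Ke by linarith
    have "z / r \<le> X" if "z \<le> X" "0 \<le> z" for z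
    proof -
      have "z / r \<le> z / 1" using r1 that by (intro divide_left_mono) auto
      then show ?thesis using that by simp
    qed
    then show "K * e / r \<le> X" "K^2 * e / r \<le> X" "K * e^2 / r \<le> X"
      using K2e Ke K e1 by auto
  qed
  have bound: "\<bar>g I 3 * a 3 + g I 4 * a 4\<bar> \<le> 130 * X" if I: "I \<in> {3,4}" for I
  proof -
    have I2: "dg c I 2 = 0" "g I 2 = 0" "dg c 2 I = 0" for c using g2[of I] sym(1)[of I 2] sym(2)[of c I 2] I by auto
    have h: "(if b then 1/2 * z else 0) = (1/2::real) * (if b then z else 0)" for b z by simp
    have "g I 1 * a 1 + g I 3 * a 3 + g I 4 * a 4
       = - (dg 1 I 1 + dg 2 I 1 * v 2 + (dg 3 I 1 * v 3 + dg 4 I 1 * v 4)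
            + (dg 1 I 3 * v 3 + dg 1 I 4 * v 4) + v 2 * (dg 2 I 3 * v 3 + dg 2 I 4 * v 4)
            + (dg 3 I 3 * v 3 * v 3 + dg 3 I 4 * v 3 * v 4 + dg 4 I 3 * v 4 * v 3 + dg 4 I 4 * v 4 * v 4)
            - 1/2 * dg I 1 1 - dg I 1 2 * v 2 - (dg I 1 3 * v 3 + dg I 1 4 * v 4)
            - 1/2 * (dg I 3 3 * v 3 * v 3 + dg I 3 4 * v 3 * v 4 + dg I 4 3 * v 4 * v 3 + dg I 4 4 * v 4 * v 4))"
      using geodesic[of I] v1 I2 sym(2)[of I 2 1] sym(2)[of I 3 1] sym(2)[of I 4 1] g2(2)[of 2 I] g2(2)[of 3 I] g2(2)[of 4 I]
        sym(2)[of I 3 2] sym(2)[of I 4 2]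
      by (simp add: sum_4 algebra_simps)
    moreover have "\<bar>g I 1 * a 1\<bar> \<le> 26 * X"
    proof -
      have "\<bar>g I 1 * a 1\<bar> \<le> K * (26 * K * e / r)"
        using uI(1)[OF I] sym(1)[of I 1] u_acceleration_le by (intro abs_mult_le) auto
      also have "K * (26 * K * e / r) = 26 * (K^2 * e / r)" by (simp add: power2_eq_square)
      finally show ?thesis using units(6) by linarith
    qed
    moreover have "\<bar>dg 1 I 1\<bar> \<le> X" using uI(2)[OF I] sym(2)[of 1 I 1] units by simp
    moreover have "\<bar>dg 2 I 1 * v 2\<bar> \<le> X"
      using abs_mult_le[OF uI(3)[OF I] rdot_le] sym(2)[of 2 I 1] units by simp
    moreover have "\<bar>dg 3 I 1 * v 3 + dg 4 I 1 * v 4\<bar> \<le> 4 * X"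
      using linear_form[of "\<lambda>J. dg J I 1" K] uI(4)[OF I] sym(2)[of _ I 1] units by (simp add: mult.assoc)
    moreover have "\<bar>dg 1 I 3 * v 3 + dg 1 I 4 * v 4\<bar> \<le> 8 * X"
    proof -
      have "\<bar>dg 1 I J\<bar> \<le> 2 * K * r" if J: "J \<in> {3,4}" for J
      proof -
        have "\<bar>\<eta> I J * r\<bar> \<le> K * r" using eta[OF I J] r1 by (intro abs_mult_le) auto
        moreover have "K * 1 \<le> K * r" using r1 K by (intro mult_left_mono) auto
        ultimately show ?thesis using IJ(2)[OF I J] by linarith
      qed
      from linear_form[of "dg 1 I", OF this]
      have "\<bar>dg 1 I 3 * v 3 + dg 1 I 4 * v 4\<bar> \<le> 8 * (K * e)" using r1 by simp
      then show ?thesis using units by linarith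
    qed
    moreover have "\<bar>v 2 * (dg 2 I 3 * v 3 + dg 2 I 4 * v 4)\<bar> \<le> 36 * X"
    proof -
      have "\<bar>dg 2 I J\<bar> \<le> 9 * K * r" if J: "J \<in> {3,4}" for J
      proof -
        have "l^2 \<le> 2^2" using l by (intro power_mono) auto
        then have "\<bar>(if I = J then l^2 else 0) * (2 * r)\<bar> \<le> 4 * (2 * r)" using r1 by (intro abs_mult_le) auto
        moreover have "K * 1 \<le> K * r" "1 * r \<le> K * r" using r1 K by (intro mult_left_mono mult_right_mono; simp)+
        ultimately show ?thesis using IJ(3)[OF I J] by linarith
      qed
      from abs_mult_le[OF rdot_le linear_form[of "dg 2 I", OF this]]
      have "\<bar>v 2 * (dg 2 I 3 * v 3 + dg 2 I 4 * v 4)\<bar> \<le> 36 * (K * e^2)" using r1 by (simp add: power2_eq_square mult_ac)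
      then show ?thesis using units by linarith
    qed
    moreover have "\<bar>dg 3 I 3 * v 3 * v 3 + dg 3 I 4 * v 3 * v 4 + dg 4 I 3 * v 4 * v 3 + dg 4 I 4 * v 4 * v 4\<bar> \<le> 28 * X"
    proof -
      have "\<bar>dg 3 I 3 * v 3 * v 3 + dg 3 I 4 * v 3 * v 4 + dg 4 I 3 * v 4 * v 3 + dg 4 I 4 * v 4 * v 4\<bar> \<le> 28 * (K * r^2) * e / r^2"
        by (rule quadratic_form[of "\<lambda>k J. dg k I J"]) (use IJ(4) I in auto)
      then show ?thesis using units r1 by simp
    qed
    moreover have "\<bar>1/2 * dg I 1 1\<bar> \<le> X"
    proof -
      have "K / r \<le> K" using r1 K by (simp add: divide_le_eq mult_le_cancel_left1)
      then show ?thesis using uu(4)[OF I] units by simp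
    qed
    moreover have "\<bar>dg I 1 2 * v 2\<bar> \<le> X"
    proof -
      have "K / r^2 \<le> K" using r1 K one_le_power[OF r1(2), of 2] by (simp add: divide_le_eq mult_le_cancel_left1)
      then have "\<bar>dg I 1 2\<bar> \<le> K" using ur(4)[OF I] by linarith
      from abs_mult_le[OF this rdot_le] show ?thesis using units by linarith
    qed
    moreover have "\<bar>dg I 1 3 * v 3 + dg I 1 4 * v 4\<bar> \<le> 4 * X"
      using linear_form[of "\<lambda>J. dg I 1 J" K] uI(4) I units by (simp add: mult.assoc)
    moreover have "\<bar>1/2 * (dg I 3 3 * v 3 * v 3 + dg I 3 4 * v 3 * v 4 + dg I 4 3 * v 4 * v 3 + dg I 4 4 * v 4 * v 4)\<bar> \<le> 14 * X"
    proof -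
      have "\<bar>dg I 3 3 * v 3 * v 3 + dg I 3 4 * v 3 * v 4 + dg I 4 3 * v 4 * v 3 + dg I 4 4 * v 4 * v 4\<bar> \<le> 28 * (K * r^2) * e / r^2"
        by (rule quadratic_form) (use IJ(4) I in auto)
      then show ?thesis using units r1 by simp
    qed
    moreover have "0 \<le> X" by (simp add: X_def)
    moreover have "\<bar>y\<bar> \<le> 130 * X"
      if "b + y3 + y4 = - (d1 + d2 + d3 + d4 + d5 + d6 - d7 - d8 - d9 - d10)" "y = y3 + y4"
        "\<bar>b\<bar> \<le> 26 * X" "\<bar>d1\<bar> \<le> X" "\<bar>d2\<bar> \<le> X" "\<bar>d3\<bar> \<le> 4 * X" "\<bar>d4\<bar> \<le> 8 * X" "\<bar>d5\<bar> \<le> 36 * X"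
        "\<bar>d6\<bar> \<le> 28 * X" "\<bar>d7\<bar> \<le> X" "\<bar>d8\<bar> \<le> X" "\<bar>d9\<bar> \<le> 4 * X" "\<bar>d10\<bar> \<le> 14 * X" "0 \<le> X"
      for y y3 y4 b d1 d2 d3 d4 d5 d6 d7 d8 d9 d10
    proof -
      have "y = - (b + d1 + d2 + d3 + d4 + d5 + d6 - d7 - d8 - d9 - d10)" using that(1,2) by linarith
      then have "\<bar>y\<bar> \<le> 26 * X + X + X + 4 * X + 8 * X + 36 * X + 28 * X + X + X + 4 * X + 14 * X"
        using that by (simp only: abs_minus_cancel abs_add_le abs_diff_le)
      then show ?thesis using \<open>0 \<le> X\<close> by linarith
    qed
    ultimately show ?thesis by blast
  qed
  have Krr: "K * r \<le> r^2 / 100" using mult_right_mono[OF r, of r] r1 by (simp add: power2_eq_square)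
  have diag: "g I I \<ge> r^2 / 10" if "I \<in> {3,4}" for I
  proof -
    have "(2/5)^2 * r^2 \<le> l^2 * r^2" using l by (intro mult_right_mono power_mono) auto
    then show ?thesis using Krr IJ(1)[OF that that] by (auto simp: abs_le_iff power2_eq_square)
  qed
  have off: "\<bar>g 3 4\<bar> \<le> r^2 / 100" using IJ(1)[of 3 4] Krr by simp
  \<comment> \<open>Applied to the angular component of larger absolute value, so that the
    off-diagonal term is absorbed by the diagonal one.\<close>
  have key: "\<bar>s\<bar> \<le> 12 * (130 * X) / r^2"
    if "\<bar>G * s + H * t\<bar> \<le> 130 * X" "r^2 / 10 \<le> G" "\<bar>H\<bar> \<le> r^2 / 100" "\<bar>t\<bar> \<le> \<bar>s\<bar>" for s t G H
  proof -
    have "r^2 / 10 * \<bar>s\<bar> \<le> G * \<bar>s\<bar>" using that by (intro mult_right_mono) auto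
    also have "0 \<le> r^2 / 10" using r1 by simp
    then have "G * \<bar>s\<bar> = \<bar>G * s\<bar>" using that by (simp add: abs_mult)
    also have "\<dots> \<le> 130 * X + \<bar>H * t\<bar>" using that by linarith
    also have "\<bar>H * t\<bar> \<le> r^2 / 100 * \<bar>s\<bar>" using that by (intro abs_mult_le) auto
    finally have "r^2 * \<bar>s\<bar> * 9 \<le> 100 * (130 * X)" by (simp add: field_simps)
    moreover have "0 \<le> X" by (simp add: X_def)
    ultimately have "\<bar>s\<bar> * r^2 \<le> 12 * (130 * X)" by (simp add: mult.commute)
    then show ?thesis using r1 by (simp add: pos_le_divide_eq)
  qed
  have "\<bar>a 3\<bar> \<le> 12 * (130 * X) / r^2 \<and> \<bar>a 4\<bar> \<le> 12 * (130 * X) / r^2"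
  proof (cases "\<bar>a 4\<bar> \<le> \<bar>a 3\<bar>")
    case True
    then show ?thesis using key[OF bound[of 3] diag[of 3] off] by auto
  next
    case False
    then have "\<bar>a 3\<bar> \<le> \<bar>a 4\<bar>" by simp
    moreover have "\<bar>g 4 4 * a 4 + g 3 4 * a 3\<bar> \<le> 130 * X" using bound[of 4] sym(1)[of 4 3] by (simp add: add.commute)
    ultimately show ?thesis using key[OF _ diag[of 4] off, of "a 4" "a 3"] by auto
  qed
  then have "\<bar>a I\<bar> \<le> 12 * (130 * X) / r^2" using I by auto
  also have "\<dots> \<le> 1600 * X / r^2" using X_def by (intro divide_right_mono) auto
  finally show ?thesis by (simp add: X_def mult.assoc)
qed

definition eta_form where
  "eta_form = \<eta> 3 3 * v 3 * v 3 + \<eta> 3 4 * v 3 * v 4 + \<eta> 4 3 * v 4 * v 3 + \<eta> 4 4 * v 4 * v 4"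

text \<open>Row 1 of the lowered equation, solved for \<open>a 2\<close>. The three leading terms
  come from \<open>g 1 1 * a 1\<close>, from half the \<open>u\<close>-derivative of
  \<open>g 1 1\<close>, and from minus half the \<open>u\<close>-derivative of the angular block.
  The last is of order \<open>1 / r\<close> because that derivative grows like \<open>r\<close>
  while two angular velocities contribute \<open>1 / r\<^sup>2\<close>.\<close>

lemma r_acceleration:
  "\<bar>a 2 - (q / r + \<mu> / (2 * r) - r / 2 * eta_form)\<bar> \<le> 11000 * K^5 * e^2 / r^2"
proof -
  have e1: "1 \<le> e" using q_nonneg by simp
  define X where "X = K * e^2 / r^2"
  have X0: "0 \<le> X" using K by (simp add: X_def)
  have KX: "X \<le> K^n * X" for n
    using one_le_power[OF K, of n] mult_right_mono[of 1 "K^n" X] X0 by simp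
  have KX3: "K * X \<le> K^3 * X" "K^2 * X \<le> K^3 * X"
    using K X0 by (auto intro!: mult_right_mono power_increasing self_le_power)
  have uX: "K / r^2 \<le> X" "K * e / r^2 \<le> X" "K * e^2 / r^3 \<le> X"
    using units by (auto simp: X_def)
  define main where "main = q / r + \<mu> / (2 * r) - r / 2 * eta_form"
  define W where "W = g 1 1 * a 1 + (g 1 3 * a 3 + g 1 4 * a 4) + 1/2 * dg 1 1 1 + dg 2 1 1 * v 2
     + (dg 3 1 1 * v 3 + dg 4 1 1 * v 4) + dg 2 1 2 * (v 2 * v 2)
     + v 2 * (dg 3 1 2 * v 3 + dg 4 1 2 * v 4) + v 2 * (dg 2 1 3 * v 3 + dg 2 1 4 * v 4)
     + (dg 3 1 3 * v 3 * v 3 + dg 3 1 4 * v 3 * v 4 + dg 4 1 3 * v 4 * v 3 + dg 4 1 4 * v 4 * v 4)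
     - 1/2 * (dg 1 3 3 * v 3 * v 3 + dg 1 3 4 * v 3 * v 4 + dg 1 4 3 * v 4 * v 3 + dg 1 4 4 * v 4 * v 4)"
  have eq: "- (g 1 2 * a 2) = W"
    unfolding W_def
    using geodesic[of 1] v1 g2(2)[of 2] g2(2)[of 3] g2(2)[of 4] sym(2)[of _ 2 1]
      sym(2)[of _ 3 1] sym(2)[of _ 4 1] sym(2)[of _ 3 2] sym(2)[of _ 4 2]
    by (simp add: sum_4 algebra_simps)
  have t1: "\<bar>g 1 1 * a 1 - q / r\<bar> \<le> 51 * (K * X)"
  proof -
    have "\<bar>(g 1 1 + 1) * a 1\<bar> \<le> K / r * (26 * K * e / r)" by (rule abs_mult_le[OF uu(1) u_acceleration_le])
    also have "\<dots> = 26 * (K * (K * e / r^2))" by (simp add: power2_eq_square)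
    also have "\<dots> \<le> 26 * (K * X)" using uX K by (intro mult_left_mono) auto
    finally have "\<bar>(g 1 1 + 1) * a 1\<bar> \<le> 26 * (K * X)" .
    moreover have "25 * K * e / r^2 \<le> 25 * (K * X)" using uX(2) KX[of 1] by simp
    then have "\<bar>a 1 + q / r\<bar> \<le> 25 * (K * X)" using u_acceleration by linarith
    moreover have "g 1 1 * a 1 - q / r = (g 1 1 + 1) * a 1 - (a 1 + q / r)" by (simp add: algebra_simps)
    ultimately show ?thesis by linarith
  qed
  have t2: "\<bar>g 1 3 * a 3 + g 1 4 * a 4\<bar> \<le> 3200 * (K^2 * X)"
  proof -
    have "\<bar>g 1 I * a I\<bar> \<le> 1600 * (K^2 * X)" if "I \<in> {3,4}" for I
      using abs_mult_le[OF uI(1)[OF that] angular_acceleration[OF that]] by (simp add: X_def power2_eq_square mult_ac)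
    from this[of 3] this[of 4] show ?thesis by simp
  qed
  have t3: "\<bar>1/2 * dg 1 1 1 - \<mu> / (2 * r)\<bar> \<le> X"
    using uu(2) uX(1) X0 by (simp add: abs_le_iff)
  have t4: "\<bar>dg 2 1 1 * v 2\<bar> \<le> X" using abs_mult_le[OF uu(3) rdot_le] uX by simp
  have t5: "\<bar>dg 3 1 1 * v 3 + dg 4 1 1 * v 4\<bar> \<le> 4 * X"
    using linear_form[of "\<lambda>I. dg I 1 1" "K / r"] uu(4) uX(2) by (simp add: power2_eq_square)
  have t6: "\<bar>dg 2 1 2 * (v 2 * v 2)\<bar> \<le> X"
    using abs_mult_le[OF ur(3) abs_mult_le[OF rdot_le rdot_le]] uX(3) by (simp add: power2_eq_square)
  have t7: "\<bar>v 2 * (dg 3 1 2 * v 3 + dg 4 1 2 * v 4)\<bar> \<le> 4 * X"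
  proof -
    have "\<bar>v 2 * (dg 3 1 2 * v 3 + dg 4 1 2 * v 4)\<bar> \<le> e * (4 * (K / r^2) * e / r)"
      by (intro abs_mult_le rdot_le linear_form ur(4))
    also have "\<dots> = 4 * (K * e^2 / r^3)" by (simp add: power2_eq_square power3_eq_cube)
    finally show ?thesis using uX(3) by simp
  qed
  have t8: "\<bar>v 2 * (dg 2 1 3 * v 3 + dg 2 1 4 * v 4)\<bar> \<le> 4 * X"
  proof -
    have "\<bar>v 2 * (dg 2 1 3 * v 3 + dg 2 1 4 * v 4)\<bar> \<le> e * (4 * (K / r) * e / r)"
      by (intro abs_mult_le rdot_le linear_form uI(3))
    also have "\<dots> = 4 * X" by (simp add: X_def power2_eq_square mult_ac)
    finally show ?thesis .
  qed
  have t9: "\<bar>dg 3 1 3 * v 3 * v 3 + dg 3 1 4 * v 3 * v 4 + dg 4 1 3 * v 4 * v 3 + dg 4 1 4 * v 4 * v 4\<bar> \<le> 28 * X"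
    using quadratic_form[of "\<lambda>J I. dg J 1 I" K] uI(4) uX(2) by simp
  have t10: "\<bar>1/2 * (dg 1 3 3 * v 3 * v 3 + dg 1 3 4 * v 3 * v 4 + dg 1 4 3 * v 4 * v 3 + dg 1 4 4 * v 4 * v 4)
      - r / 2 * eta_form\<bar> \<le> 14 * X"
  proof -
    have "\<bar>(dg 1 3 3 - \<eta> 3 3 * r) * v 3 * v 3 + (dg 1 3 4 - \<eta> 3 4 * r) * v 3 * v 4
        + (dg 1 4 3 - \<eta> 4 3 * r) * v 4 * v 3 + (dg 1 4 4 - \<eta> 4 4 * r) * v 4 * v 4\<bar> \<le> 28 * K * e / r^2"
      by (rule quadratic_form[of "\<lambda>I J. dg 1 I J - \<eta> I J * r"]) (use IJ(2) in auto)
    also have "28 * K * e / r^2 \<le> 28 * X" using uX(2) by simp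
    finally show ?thesis by (simp add: eta_form_def algebra_simps)
  qed
  have "K * X = K^1 * X" by simp
  then have Wm: "\<bar>W - main\<bar> \<le> 3400 * (K^3 * X)"
  proof -
    have "W - main = (g 1 1 * a 1 - q / r) + (g 1 3 * a 3 + g 1 4 * a 4) + (1/2 * dg 1 1 1 - \<mu> / (2 * r))
      + dg 2 1 1 * v 2 + (dg 3 1 1 * v 3 + dg 4 1 1 * v 4) + dg 2 1 2 * (v 2 * v 2)
      + v 2 * (dg 3 1 2 * v 3 + dg 4 1 2 * v 4) + v 2 * (dg 2 1 3 * v 3 + dg 2 1 4 * v 4)
      + (dg 3 1 3 * v 3 * v 3 + dg 3 1 4 * v 3 * v 4 + dg 4 1 3 * v 4 * v 3 + dg 4 1 4 * v 4 * v 4)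
      - (1/2 * (dg 1 3 3 * v 3 * v 3 + dg 1 3 4 * v 3 * v 4 + dg 1 4 3 * v 4 * v 3 + dg 1 4 4 * v 4 * v 4)
        - r / 2 * eta_form)"
      unfolding W_def main_def by (rule sum_shuffle)
    then have "\<bar>W - main\<bar> \<le> 51 * (K * X) + 3200 * (K^2 * X) + X + X + 4 * X + X + 4 * X + 4 * X + 28 * X + 14 * X"
      by (simp only: abs_add_le abs_diff_le t1 t2 t3 t4 t5 t6 t7 t8 t9 t10)
    then show ?thesis using KX3 KX[of 3] by linarith
  qed
  have m: "\<bar>main\<bar> \<le> 16 * (K * e / r)"
  proof -
    have "\<bar>eta_form\<bar> \<le> 28 * K * e / r^2"
      unfolding eta_form_def by (rule quadratic_form) (use eta in auto)
    from abs_mult_le[OF _ this, of "r / 2" "r / 2"] have "\<bar>r / 2 * eta_form\<bar> \<le> 14 * (K * e / r)"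
      using r1 by (simp add: power2_eq_square)
    moreover have "\<bar>q / r\<bar> \<le> K * e / r" using q_le by simp
    moreover have "\<bar>\<mu> / (2 * r)\<bar> \<le> K * e / r"
    proof -
      have "\<bar>\<mu> / (2 * r)\<bar> = \<bar>\<mu>\<bar> / (2 * r)" using r1 by simp
      also have "\<dots> \<le> K / (2 * r)" using mu r1 by (intro divide_right_mono) auto
      also have "\<dots> \<le> K * e / r" using K r1 e1 mult_mono[of K "2 * K" 1 e] by (simp add: field_simps)
      finally show ?thesis .
    qed
    ultimately have "\<bar>main\<bar> \<le> K * e / r + K * e / r + 14 * (K * e / r)"
      unfolding main_def by (intro abs_diff_le abs_add_le)
    then show ?thesis by linarith
  qed
  have rr: "1 \<le> r^2" using r1 one_le_power[OF r1(2), of 2] by simp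
  have "\<bar>W\<bar> * (K / r^2) \<le> 3416 * (K^4 * X)"
  proof -
    have "16 * (K * e / r) * (K / r^2) \<le> 16 * (K * X)"
    proof -
      have "16 * (K * e / r) * (K / r^2) = 16 * (K * (K * e / r^3))"
        by (simp add: power2_eq_square power3_eq_cube mult_ac)
      also have "\<dots> \<le> 16 * (K * X)" using units(3) uX(2) K by (intro mult_left_mono) auto
      finally show ?thesis .
    qed
    moreover have "K * X \<le> K^4 * X" using X0 K by (intro mult_right_mono self_le_power) auto
    moreover have "3400 * (K^3 * X) * (K / r^2) \<le> 3400 * (K^4 * X)"
    proof -
      have "3400 * (K^3 * X) * (K / r^2) = 3400 * (K^4 * X) / r^2" by (simp add: eval_nat_numeral)
      also have "\<dots> \<le> 3400 * (K^4 * X) / 1" using rr X0 K by (intro divide_left_mono) auto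
      finally show ?thesis by simp
    qed
    moreover have "\<bar>W\<bar> * (K / r^2) \<le> (16 * (K * e / r) + 3400 * (K^3 * X)) * (K / r^2)"
      using m Wm K by (intro mult_right_mono) auto
    ultimately show ?thesis unfolding distrib_right by linarith
  qed
  \<comment> \<open>The equation is implicit, \<open>a 2 - W = (g 1 2 + 1) * a 2\<close>; the small
    factor first bounds \<open>a 2\<close> by \<open>2 * \<bar>W\<bar>\<close>.\<close>
  moreover have "\<bar>a 2 - W\<bar> \<le> 2 * (\<bar>W\<bar> * (K / r^2))"
  proof -
    have "K / r^2 \<le> K / r" using r1 K by (intro divide_left_mono) (auto simp: power2_eq_square)
    also have "K / r \<le> 1/100" using r r1 by (simp add: field_simps)
    finally have small: "K / r^2 \<le> 1/100" .
    have d: "a 2 - W = (g 1 2 + 1) * a 2" using eq by (simp add: algebra_simps)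
    have b: "\<bar>(g 1 2 + 1) * a 2\<bar> \<le> K / r^2 * \<bar>a 2\<bar>" using ur(1) by (intro abs_mult_le) auto
    also have "\<dots> \<le> 1/100 * \<bar>a 2\<bar>" using small by (intro mult_right_mono) auto
    finally have "\<bar>a 2\<bar> \<le> 2 * \<bar>W\<bar>" using d by linarith
    then have "K / r^2 * \<bar>a 2\<bar> \<le> K / r^2 * (2 * \<bar>W\<bar>)" using K by (intro mult_left_mono) auto
    with b show ?thesis by (simp add: d mult_ac)
  qed
  ultimately have "\<bar>a 2 - W\<bar> \<le> 6832 * (K^4 * X)" by linarith
  moreover have "K^3 * X \<le> K^4 * X" using X0 K by (intro mult_right_mono power_increasing) auto
  ultimately have "\<bar>a 2 - main\<bar> \<le> 11000 * (K^4 * X)" using Wm KX[of 4] X0 by linarith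
  also have "11000 * (K^4 * X) = 11000 * K^5 * e^2 / r^2" by (simp add: X_def eval_nat_numeral)
  finally show ?thesis by (simp add: main_def)
qed

text \<open>The right side is the derivative of \<open>v 2 - M / (2 * r)\<close> along
  \<open>u\<close> when \<open>n\<close> is that of \<open>M\<close>. Since \<open>n\<close> is
  close to \<open>\<mu>\<close>, the term \<open>\<mu> / (2 * r)\<close> of the radial acceleration
  cancels. What remains of it is at least \<open>q * \<Omega> / r\<close> by assumption, and
  \<open>- v 2 * a 1\<close> supplies \<open>q * v 2 / r\<close>.\<close>

lemma modified_acceleration:
  assumes n: "\<bar>n - \<mu>\<bar> \<le> 5 * K * e / r" and M: "\<bar>M\<bar> \<le> K"
    and \<Omega>: "q * \<Omega> \<le> q - r^2 / 2 * eta_form"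
  shows "q * (\<Omega> + v 2) / r - 12000 * K^5 * e^2 / r^2
    \<le> a 2 - v 2 * a 1 - (n / (2 * r) - M * v 2 / (2 * r^2))"
proof -
  define X where "X = K^5 * e^2 / r^2"
  have KX: "K * e^2 / r^2 \<le> X" "K * e / r^2 \<le> X"
  proof -
    have "K * e^2 \<le> K^5 * e^2" using K by (intro mult_right_mono self_le_power) auto
    then show "K * e^2 / r^2 \<le> X" using r1 unfolding X_def by (intro divide_right_mono) auto
    then show "K * e / r^2 \<le> X" using units(2) by linarith
  qed
  have X0: "0 \<le> X" using K by (simp add: X_def)
  have 1: "\<bar>v 2 * (a 1 + q / r)\<bar> \<le> 25 * X"
  proof -
    have "\<bar>v 2 * (a 1 + q / r)\<bar> \<le> e * (25 * K * e / r^2)"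
      by (rule abs_mult_le[OF rdot_le u_acceleration])
    also have "\<dots> = 25 * (K * e^2 / r^2)" by (simp add: power2_eq_square)
    finally show ?thesis using KX by linarith
  qed
  have 2: "\<bar>(n - \<mu>) / (2 * r)\<bar> \<le> 3 * X"
  proof -
    have "\<bar>(n - \<mu>) / (2 * r)\<bar> = \<bar>n - \<mu>\<bar> / (2 * r)" using r1 by simp
    also have "\<dots> \<le> 5 * K * e / r / (2 * r)" using n r1 by (intro divide_right_mono) auto
    also have "\<dots> = 5/2 * (K * e / r^2)" by (simp add: power2_eq_square)
    finally show ?thesis using KX(2) X0 by linarith
  qed
  have 3: "\<bar>M * v 2 / (2 * r^2)\<bar> \<le> X"
  proof -
    have "\<bar>M * v 2 / (2 * r^2)\<bar> = \<bar>M * v 2\<bar> / (2 * r^2)" by simp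
    also have "\<dots> \<le> K * e / (2 * r^2)" using abs_mult_le[OF M rdot_le] by (intro divide_right_mono) auto
    also have "\<dots> \<le> K * e / r^2" using K q_nonneg r1 by (intro divide_left_mono) auto
    finally show ?thesis using KX by linarith
  qed
  have 4: "\<bar>a 2 - (q / r + \<mu> / (2 * r) - r / 2 * eta_form)\<bar> \<le> 11000 * X"
    using r_acceleration by (simp add: X_def mult.assoc)
  have "q * \<Omega> / r \<le> (q - r^2 / 2 * eta_form) / r"
    using \<Omega> r1 by (intro divide_right_mono) auto
  also have "\<dots> = q / r - r / 2 * eta_form" using r1 by (simp add: diff_divide_distrib power2_eq_square)
  finally have 5: "q * \<Omega> / r \<le> q / r - r / 2 * eta_form" .
  have "a 2 - v 2 * a 1 - (n / (2 * r) - M * v 2 / (2 * r^2))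
      = (a 2 - (q / r + \<mu> / (2 * r) - r / 2 * eta_form)) - v 2 * (a 1 + q / r) - (n - \<mu>) / (2 * r)
        + M * v 2 / (2 * r^2) + (q / r - r / 2 * eta_form) + q * v 2 / r"
    using r1 by (simp add: field_simps)
  moreover have "12000 * K^5 * e^2 / r^2 = 12000 * X" "q * (\<Omega> + v 2) / r = q * \<Omega> / r + q * v 2 / r"
    by (auto simp: X_def distrib_left add_divide_distrib)
  moreover have "y + f - 12000 * X \<le> b - c - d + g + z + f"
    if "\<bar>b\<bar> \<le> 11000 * X" "\<bar>c\<bar> \<le> 25 * X" "\<bar>d\<bar> \<le> 3 * X" "\<bar>g\<bar> \<le> X" "y \<le> z" for y z b c d g f
    using that X0 by linarith
  from this[OF 4 1 2 3 5, of "q * v 2 / r"] show ?thesis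
    by (simp only: calculation)
qed

text \<open>The left side is the speed of the point of the sphere, \<open>sqrt q / r\<close>; the
  decay in \<open>r\<close> is given away, since a comparison with the growth of
  \<open>r + u\<close> is all that is wanted.\<close>

lemma angular_speed: "l * sqrt ((v 3)^2 + (v 4)^2) \<le> e"
proof -
  have "(l * sqrt ((v 3)^2 + (v 4)^2))^2 = l^2 * ((v 3)^2 + (v 4)^2)"
    by (simp add: power_mult_distrib)
  also have "\<dots> \<le> q"
  proof -
    have "1 * (l^2 * ((v 3)^2 + (v 4)^2)) \<le> r^2 * (l^2 * ((v 3)^2 + (v 4)^2))"
      using r1 by (intro mult_right_mono one_le_power) auto
    then show ?thesis by (simp add: q_def mult.assoc)
  qed
  also have "\<dots> \<le> e^2" using q_nonneg by (simp add: power2_eq_square algebra_simps)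
  finally show ?thesis by (rule power2_le_imp_le) (use q_nonneg in simp)
qed

end

section \<open>Stereographic charts\<close>


lemma has_derivative_vec_nth [derivative_intros]:
  "(f has_derivative f') F \<Longrightarrow> ((\<lambda>x. f x $ i) has_derivative (\<lambda>v. f' v $ i)) F"
  by (rule bounded_linear.has_derivative[OF bounded_linear_vec_nth])

text \<open>The partial derivatives of \<open>sphere_point\<close> along the two angles in closed
  form; every index other than 3 falls into the branch for the angle 4.\<close>

definition sphere_frame :: "real \<Rightarrow> real^4 \<Rightarrow> 4 \<Rightarrow> real^3" where
  "sphere_frame \<sigma> x k = (let d = 1 + (x$3)\<^sup>2 + (x$4)\<^sup>2 in
     if k = 3 then vector [(2 * d - 4 * (x$3)\<^sup>2) / d\<^sup>2, - 4 * x$3 * x$4 / d\<^sup>2, - \<sigma> * 4 * x$3 / d\<^sup>2]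
     else vector [- 4 * x$3 * x$4 / d\<^sup>2, (2 * d - 4 * (x$4)\<^sup>2) / d\<^sup>2, - \<sigma> * 4 * x$4 / d\<^sup>2])"

definition conformal :: "real^4 \<Rightarrow> real" where
  "conformal x = 2 / (1 + (x$3)\<^sup>2 + (x$4)\<^sup>2)"

lemma denominator_pos: "0 < 1 + (x$3)\<^sup>2 + ((x::real^4)$4)\<^sup>2"
  by (smt (verit) zero_le_power2)

lemma has_derivative_sphere_point:
  "(sphere_point \<sigma> has_derivative (\<lambda>v. v$3 *\<^sub>R sphere_frame \<sigma> x 3 + v$4 *\<^sub>R sphere_frame \<sigma> x 4)) (at x)"
proof -
  define d where "d = 1 + (x$3)\<^sup>2 + (x$4)\<^sup>2"
  have d: "d \<noteq> 0" using denominator_pos[of x] by (simp add: d_def)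
  have D: "((\<lambda>x::real^4. 1 + (x$3)\<^sup>2 + (x$4)\<^sup>2) has_derivative (\<lambda>v. 2 * x$3 * v$3 + 2 * x$4 * v$4)) (at x)"
    by (rule has_derivative_eq_rhs, (rule derivative_eq_intros refl)+) (auto simp: fun_eq_iff)
  have I: "((\<lambda>x::real^4. 1 / (1 + (x$3)\<^sup>2 + (x$4)\<^sup>2)) has_derivative
      (\<lambda>v. - (2 * x$3 * v$3 + 2 * x$4 * v$4) / d\<^sup>2)) (at x)"
    by (rule has_derivative_eq_rhs[OF has_derivative_divide[OF has_derivative_const[of 1] D]])
      (unfold d_def[symmetric], use d in \<open>auto simp: power2_eq_square fun_eq_iff field_simps\<close>)
  have c1: "((\<lambda>x::real^4. 1 / (1 + (x$3)\<^sup>2 + (x$4)\<^sup>2) * (2 * x$3)) has_derivative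
      (\<lambda>v. v$3 * ((2 * d - 4 * (x$3)\<^sup>2) / d\<^sup>2) + v$4 * (- 4 * x$3 * x$4 / d\<^sup>2))) (at x)"
    by (rule has_derivative_eq_rhs[OF has_derivative_mult[OF I has_derivative_mult_right[OF has_derivative_vec_nth[OF has_derivative_ident]]]])
      (unfold d_def[symmetric], use d in \<open>auto simp: power2_eq_square fun_eq_iff field_simps\<close>)
  have c2: "((\<lambda>x::real^4. 1 / (1 + (x$3)\<^sup>2 + (x$4)\<^sup>2) * (2 * x$4)) has_derivative
      (\<lambda>v. v$3 * (- 4 * x$3 * x$4 / d\<^sup>2) + v$4 * ((2 * d - 4 * (x$4)\<^sup>2) / d\<^sup>2))) (at x)"
    by (rule has_derivative_eq_rhs[OF has_derivative_mult[OF I has_derivative_mult_right[OF has_derivative_vec_nth[OF has_derivative_ident]]]])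
      (unfold d_def[symmetric], use d in \<open>auto simp: power2_eq_square fun_eq_iff field_simps\<close>)
  \<comment> \<open>The numerator is \<open>2 - d\<close>, so the third coordinate is affine in
    \<open>1 / d\<close> and its derivative follows from \<open>I\<close>.\<close>
  have "1 / (1 + (y$3)\<^sup>2 + (y$4)\<^sup>2) * (\<sigma> * (1 - (y$3)\<^sup>2 - (y$4)\<^sup>2))
      = \<sigma> * (2 * (1 / (1 + (y$3)\<^sup>2 + (y$4)\<^sup>2)) - 1)" for y :: "real^4"
    using denominator_pos[of y] by (simp add: field_simps)
  moreover have "((\<lambda>x::real^4. \<sigma> * (2 * (1 / (1 + (x$3)\<^sup>2 + (x$4)\<^sup>2)) - 1)) has_derivative
      (\<lambda>v. v$3 * (- \<sigma> * 4 * x$3 / d\<^sup>2) + v$4 * (- \<sigma> * 4 * x$4 / d\<^sup>2))) (at x)"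
    by (rule has_derivative_eq_rhs[OF has_derivative_mult_right[OF has_derivative_diff[OF has_derivative_mult_right[OF I] has_derivative_const]]])
      (use d in \<open>auto simp: fun_eq_iff field_simps\<close>)
  ultimately have c3: "((\<lambda>x::real^4. 1 / (1 + (x$3)\<^sup>2 + (x$4)\<^sup>2) * (\<sigma> * (1 - (x$3)\<^sup>2 - (x$4)\<^sup>2))) has_derivative
      (\<lambda>v. v$3 * (- \<sigma> * 4 * x$3 / d\<^sup>2) + v$4 * (- \<sigma> * 4 * x$4 / d\<^sup>2))) (at x)"
    by presburger
  have "((\<lambda>x. sphere_point \<sigma> x $ i) has_derivative
     (\<lambda>v. (v$3 *\<^sub>R sphere_frame \<sigma> x 3 + v$4 *\<^sub>R sphere_frame \<sigma> x 4) $ i)) (at x)" for i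
    using exhaust_3[of i] c1 c2 c3
    by (auto simp: sphere_point_def sphere_frame_def vector_3 Let_def d_def)
  then show ?thesis
    by (subst has_derivative_componentwise_within) (auto simp: Basis_vec_def inner_axis)
qed

lemma has_derivative_chart_map:
  "(chart_map \<sigma> has_derivative
     (\<lambda>v. (v$1, v$2, v$3 *\<^sub>R sphere_frame \<sigma> x 3 + v$4 *\<^sub>R sphere_frame \<sigma> x 4))) (at x)"
  unfolding chart_map_def[abs_def]
  by (intro has_derivative_Pair has_derivative_sphere_point has_derivative_vec_nth has_derivative_ident)

lemma coord_vector_eq:
  "coord_vector \<sigma> x 1 = (1, 0, 0)" "coord_vector \<sigma> x 2 = (0, 1, 0)"
  "coord_vector \<sigma> x 3 = (0, 0, sphere_frame \<sigma> x 3)" "coord_vector \<sigma> x 4 = (0, 0, sphere_frame \<sigma> x 4)"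
  unfolding coord_vector_def frechet_derivative_at[OF has_derivative_chart_map, symmetric]
  by (simp_all add: axis_def)

lemma ang_simps [simp]: "ang 1 = 3" "ang 2 = 4"
  by (simp_all add: ang_def)

lemma ang_vector_eq: "ang_vector \<sigma> x I = sphere_frame \<sigma> x (ang I)"
  using exhaust_2[of I] by (auto simp: ang_vector_def coord_vector_eq)

lemma sphere_frame_inner:
  assumes "\<sigma> \<in> {1, -1}"
  shows "sphere_frame \<sigma> x 3 \<bullet> sphere_frame \<sigma> x 3 = (conformal x)\<^sup>2"
    and "sphere_frame \<sigma> x 4 \<bullet> sphere_frame \<sigma> x 4 = (conformal x)\<^sup>2"
    and "sphere_frame \<sigma> x 3 \<bullet> sphere_frame \<sigma> x 4 = 0"
    and "sphere_frame \<sigma> x 3 \<bullet> sphere_point \<sigma> x = 0"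
    and "sphere_frame \<sigma> x 4 \<bullet> sphere_point \<sigma> x = 0"
    and "norm (sphere_point \<sigma> x) = 1"
proof -
  define a b where "a = x$3" and "b = x$4"
  define d where "d = 1 + a\<^sup>2 + b\<^sup>2"
  have d: "d \<noteq> 0" using denominator_pos[of x] by (simp add: d_def a_def b_def)
  have s: "\<sigma> * \<sigma> = 1" "\<And>y. \<sigma> * (\<sigma> * y) = y" using assms by auto
  have bb: "b * b = d - 1 - a * a" "\<And>y. b * (b * y) = (d - 1 - a * a) * y"
    by (auto simp: d_def power2_eq_square algebra_simps)
  note defs = sphere_frame_def sphere_point_def conformal_def Let_def a_def[symmetric] b_def[symmetric]
    d_def[symmetric] inner_vec_def sum_3 vector_3
  show "sphere_frame \<sigma> x 3 \<bullet> sphere_frame \<sigma> x 3 = (conformal x)\<^sup>2"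
    "sphere_frame \<sigma> x 4 \<bullet> sphere_frame \<sigma> x 4 = (conformal x)\<^sup>2"
    "sphere_frame \<sigma> x 3 \<bullet> sphere_frame \<sigma> x 4 = 0"
    "sphere_frame \<sigma> x 3 \<bullet> sphere_point \<sigma> x = 0"
    "sphere_frame \<sigma> x 4 \<bullet> sphere_point \<sigma> x = 0"
    unfolding defs using d
    by (simp_all add: divide_simps) (simp_all add: power2_eq_square power4_eq_xxxx algebra_simps s bb)
  have "sphere_point \<sigma> x \<bullet> sphere_point \<sigma> x = 1"
    unfolding defs using d
    by (simp_all add: divide_simps) (simp_all add: power2_eq_square algebra_simps s bb)
  then show "norm (sphere_point \<sigma> x) = 1" by (simp add: norm_eq_1)
qed

text \<open>The chart discs have radius 2, whence the lower bound
  \<open>2 / (1 + 4)\<close>.\<close>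

lemma conformal_bounds:
  assumes "x \<in> chart_region U R"
  shows "2/5 \<le> conformal x" "conformal x \<le> 2"
proof -
  have "(x$3)\<^sup>2 + (x$4)\<^sup>2 < 4" "0 \<le> (x$3)\<^sup>2 + (x$4)\<^sup>2" using assms by (auto simp: chart_region_def)
  then show "2/5 \<le> conformal x" "conformal x \<le> 2"
    using denominator_pos[of x] by (simp_all add: conformal_def pos_le_divide_eq pos_divide_le_eq)
qed

lemma open_chart_region: "open U \<Longrightarrow> open (chart_region U R)"
  unfolding chart_region_def Collect_conj_eq
  by (intro open_Int open_Collect_less continuous_intros)
     (auto intro!: open_vimage continuous_intros simp: vimage_def[symmetric])

section \<open>Partial derivatives in a chart\<close>

lemma pd_eq: "(f has_derivative f') (at x) \<Longrightarrow> pd a f x = f' (axis a 1)"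
  unfolding pd_def by (metis frechet_derivative_at)

lemma has_derivative_pd:
  assumes "f differentiable (at x)"
  shows "(f has_derivative (\<lambda>v. \<Sum>a\<in>UNIV. v$a * pd a f x)) (at x)"
proof -
  have d: "(f has_derivative frechet_derivative f (at x)) (at x)"
    using assms frechet_derivative_works by blast
  interpret linear "frechet_derivative f (at x)" using has_derivative_linear[OF d] .
  have "frechet_derivative f (at x) v = (\<Sum>a\<in>UNIV. v$a * pd a f x)" for v
  proof -
    have "frechet_derivative f (at x) v = frechet_derivative f (at x) (\<Sum>a\<in>UNIV. v$a *\<^sub>R axis a 1)"
      by (simp add: basis_expansion scalar_mult_eq_scaleR[symmetric])
    then show ?thesis by (simp add: sum scaleR pd_def)
  qed
  then have "frechet_derivative f (at x) = (\<lambda>v. \<Sum>a\<in>UNIV. v$a * pd a f x)" by (rule ext)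
  with d show ?thesis by simp
qed

lemma frechet_derivative_pd:
  "f differentiable (at x) \<Longrightarrow> (f has_derivative frechet_derivative f (at x)) (at x)"
  by (simp add: frechet_derivative_works[symmetric])

lemma pd_add:
  "f differentiable (at x) \<Longrightarrow> g differentiable (at x) \<Longrightarrow>
     pd a (\<lambda>x. f x + g x) x = pd a f x + pd a g x"
  unfolding pd_def[of a f] pd_def[of a g]
  by (rule pd_eq[OF has_derivative_add[OF frechet_derivative_pd frechet_derivative_pd]])

lemma pd_mult:
  fixes f g :: "real^4 \<Rightarrow> real"
  shows "f differentiable (at x) \<Longrightarrow> g differentiable (at x) \<Longrightarrow>
     pd a (\<lambda>x. f x * g x) x = f x * pd a g x + pd a f x * g x"
  unfolding pd_def[of a f] pd_def[of a g]
  by (rule pd_eq[OF has_derivative_mult[OF frechet_derivative_pd frechet_derivative_pd]])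

lemma pd_minus: "f differentiable (at x) \<Longrightarrow> pd a (\<lambda>x. - f x) x = - pd a f x"
  unfolding pd_def[of a f] by (rule pd_eq[OF has_derivative_minus[OF frechet_derivative_pd]])

lemma pd_const: "pd a (\<lambda>x. c) x = 0"
  by (rule pd_eq[OF has_derivative_const])

lemma pd_coord_power: "pd a (\<lambda>x. (x$b) ^ n) x = (if a = b then real n * (x$b) ^ (n - 1) else 0)"
  by (rule trans[OF pd_eq]) (rule derivative_eq_intros refl | simp add: axis_def)+

lemma pd_inverse_power:
  assumes "x$b \<noteq> 0"
  shows "pd a (\<lambda>x. 1 / (x$b) ^ n) x = (if a = b then - real n / (x$b) ^ (Suc n) else 0)"
proof (rule trans[OF pd_eq])
  have "((\<lambda>x. (x$b) ^ n) has_derivative (\<lambda>v. real n * v$b * (x$b) ^ (n - 1))) (at x)"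
    by (rule derivative_eq_intros refl | simp)+
  then show "((\<lambda>x. 1 / (x$b) ^ n) has_derivative (\<lambda>v. - (real n * v$b * (x$b) ^ (n - 1)) / ((x$b) ^ n * (x$b) ^ n))) (at x)"
    using assms
    by (intro has_derivative_eq_rhs[OF has_derivative_divide[OF has_derivative_const]])
      (auto simp: fun_eq_iff field_simps)
  show "- (real n * axis a 1 $ b * (x$b) ^ (n - 1)) / ((x$b) ^ n * (x$b) ^ n)
    = (if a = b then - real n / (x$b) ^ (Suc n) else 0)"
    using assms by (cases n) (auto simp: axis_def field_simps)
qed

lemma pd_cong_open:
  assumes "open S" "x \<in> S" "\<And>y. y \<in> S \<Longrightarrow> f y = g y"
  shows "pd a f x = pd a g x"
proof -
  have "(f has_derivative D) (at x) \<longleftrightarrow> (g has_derivative D) (at x)" for D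
    using has_derivative_transform_within_open[OF _ assms(1,2), of f D UNIV g]
      has_derivative_transform_within_open[OF _ assms(1,2), of g D UNIV f] assms(3) by auto
  then show ?thesis unfolding pd_def frechet_derivative_def by simp
qed

text \<open>The charts do not move with \<open>u\<close>, so \<open>\<partial>\<^sub>u\<close> in a chart is the derivative at a fixed point of the sphere.\<close>

lemma pd_1_eq_deriv:
  assumes F: "F differentiable (at x)"
    and eq: "\<And>y. y$3 = x$3 \<Longrightarrow> y$4 = x$4 \<Longrightarrow> F y = f (y$1)"
  shows "(f has_real_derivative pd 1 F x) (at (x$1))"
proof -
  have "((\<lambda>s. x + (s - x$1) *\<^sub>R axis 1 1) has_derivative (\<lambda>s. s *\<^sub>R axis 1 1)) (at (x$1))"
    by (rule derivative_eq_intros refl | simp)+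
  moreover have "(F has_derivative (\<lambda>v. \<Sum>a\<in>UNIV. v$a * pd a F x)) (at (x + (x$1 - x$1) *\<^sub>R axis 1 1))"
    using has_derivative_pd[OF F] by simp
  ultimately have "((\<lambda>s. F (x + (s - x$1) *\<^sub>R axis 1 1)) has_derivative
     (\<lambda>s. \<Sum>a\<in>UNIV. (s *\<^sub>R axis 1 1)$a * pd a F x)) (at (x$1))"
    by (rule has_derivative_compose)
  moreover have "F (x + (s - x$1) *\<^sub>R axis 1 1) = f s" for s
    by (subst eq) (auto simp: axis_def)
  moreover have "(\<lambda>s. \<Sum>a\<in>UNIV. (s *\<^sub>R axis 1 1)$a * pd a F x) = (*) (pd 1 F x)"
    by (auto simp: axis_def fun_eq_iff if_distrib[of "\<lambda>z. z * _"] if_distrib[of "\<lambda>z. _ * z"] cong: if_cong)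
  ultimately show ?thesis by (simp add: has_field_derivative_def)
qed

section \<open>From the asymptotic expansion to pointwise bounds\<close>


text \<open>The common shape of the four metric expansions: \<open>c\<close> is the leading term,
  \<open>M\<close> the next coefficient, and \<open>W\<close> its power of the radius, namely
  \<open>1 / r\<close>, \<open>- 1 / r\<^sup>2\<close>, \<open>1\<close> or
  \<open>r\<close>.\<close>

lemma pd_expansion:
  fixes f c M W :: "real^4 \<Rightarrow> real"
  defines "rem \<equiv> \<lambda>y. f y - (c y + M y * W y)"
  assumes "c differentiable (at x)" "M differentiable (at x)" "W differentiable (at x)"
    "rem differentiable (at x)"
  shows "f differentiable (at x)"
    and "pd a f x = pd a c x + (M x * pd a W x + pd a M x * W x) + pd a rem x"
proof -
  have f: "f = (\<lambda>y. (c y + M y * W y) + rem y)" by (simp add: rem_def)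
  show "f differentiable (at x)"
    by (subst f) (intro differentiable_add differentiable_mult assms(2-))
  show "pd a f x = pd a c x + (M x * pd a W x + pd a M x * W x) + pd a rem x"
    by (subst f) (simp add: pd_add pd_mult assms(2-) differentiable_add differentiable_mult)
qed

text \<open>
  One number \<open>K\<close> serves as bound and as radius, so that finitely many expansions are made uniform by
  letting \<open>K\<close> tend to infinity.
\<close>

definition bounded_order :: "real set \<Rightarrow> nat \<Rightarrow> (real^4 \<Rightarrow> real) \<Rightarrow> real \<Rightarrow> bool" where
  "bounded_order U k f K \<longleftrightarrow> (\<forall>x\<in>chart_region U K. f differentiable (at x) \<and>
     \<bar>f x\<bar> \<le> K / (x$2) ^ k \<and> (\<forall>a. \<bar>pd a f x\<bar> \<le> K / (x$2) ^ (if a = 2 then Suc k else k)))"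

lemma bigO_r_eventually:
  assumes "bigO_r U k f"
  shows "\<forall>\<^sub>F K in at_top. bounded_order U k f K"
proof -
  obtain K R where R: "0 < R" and K: "\<And>x. x \<in> chart_region U R \<Longrightarrow> f differentiable (at x) \<and>
     \<bar>f x\<bar> \<le> K / (x$2) ^ k \<and> (\<forall>a. \<bar>pd a f x\<bar> \<le> K / (x$2) ^ (if a = 2 then Suc k else k))"
    using assms unfolding bigO_r_def by metis
  show ?thesis
    using eventually_ge_at_top[of "max K R"]
  proof eventually_elim
    case (elim N)
    show ?case
      unfolding bounded_order_def
    proof
      fix x assume x: "x \<in> chart_region U N"
      then have xR: "x \<in> chart_region U R" and pos: "0 < x$2"
        using elim R by (auto simp: chart_region_def)
      have "K / (x$2) ^ n \<le> N / (x$2) ^ n" for n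
        using elim pos by (intro divide_right_mono) auto
      then show "f differentiable (at x) \<and> \<bar>f x\<bar> \<le> N / (x$2) ^ k \<and>
          (\<forall>a. \<bar>pd a f x\<bar> \<le> N / (x$2) ^ (if a = 2 then Suc k else k))"
        using K[OF xR] order_trans by blast
    qed
  qed
qed

lemma bounded_orderD:
  assumes "bounded_order U k f K" "x \<in> chart_region U K"
  shows "f differentiable (at x)" "\<bar>f x\<bar> \<le> K / (x$2) ^ k" "\<bar>pd 2 f x\<bar> \<le> K / (x$2) ^ Suc k"
    "a \<noteq> 2 \<Longrightarrow> \<bar>pd a f x\<bar> \<le> K / (x$2) ^ k"
proof -
  have "\<forall>a. \<bar>pd a f x\<bar> \<le> K / (x$2) ^ (if a = 2 then Suc k else k)"
    using assms by (simp add: bounded_order_def)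
  from this[rule_format, of 2] this[rule_format, of a] assms
  show "f differentiable (at x)" "\<bar>f x\<bar> \<le> K / (x$2) ^ k" "\<bar>pd 2 f x\<bar> \<le> K / (x$2) ^ Suc k"
    "a \<noteq> 2 \<Longrightarrow> \<bar>pd a f x\<bar> \<le> K / (x$2) ^ k"
    by (auto simp: bounded_order_def)
qed

section \<open>First derivatives of the expanded metric components\<close>

lemma coord_differentiable [simp]:
  "(\<lambda>y::real^4. (y$b) ^ n) differentiable (at x)"
  "x$b \<noteq> 0 \<Longrightarrow> (\<lambda>y::real^4. 1 / (y$b) ^ n) differentiable (at x)"
  "x$b \<noteq> 0 \<Longrightarrow> (\<lambda>y::real^4. - (1 / (y$b) ^ n)) differentiable (at x)"
proof -
  show 1: "(\<lambda>y::real^4. (y$b) ^ n) differentiable (at x)" for n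
    by (intro differentiable_power differentiableI[OF has_derivative_vec_nth[OF has_derivative_ident]])
  show "(\<lambda>y::real^4. 1 / (y$b) ^ n) differentiable (at x)" if "x$b \<noteq> 0"
    using that by (intro differentiable_divide 1 differentiable_const) auto
  then show "(\<lambda>y::real^4. - (1 / (y$b) ^ n)) differentiable (at x)" if "x$b \<noteq> 0"
    using that by (intro differentiable_minus) auto
qed

text \<open>\<open>M\<close> stands for any of the coefficients \<open>m\<close>, \<open>B1\<close>,
  \<open>h1\<close>, \<open>C1\<close> in a chart. Its radial derivative is merely estimated by the
  order assumption, which is already small enough.\<close>

locale expansion_point =
  fixes U :: "real set" and K :: real and x :: "real^4" and M :: "real^4 \<Rightarrow> real"
  assumes M: "bounded_order U 0 M K" and x: "x \<in> chart_region U K" and K: "1 \<le> K"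
begin

definition r where "r = x$2"
definition k where "k n = K / r ^ n"

lemma r: "1 \<le> r" "x$2 = r" "x$2 \<noteq> 0"
  using x K by (auto simp: r_def chart_region_def)

lemma k_antimono: "n \<le> m \<Longrightarrow> k m \<le> k n"
  using r K by (auto simp: k_def intro!: divide_left_mono power_increasing)

lemma k_nonneg: "0 \<le> k n"
  using r K by (simp add: k_def)

lemma k_divide: "\<bar>z\<bar> \<le> k n \<Longrightarrow> \<bar>z / r ^ m\<bar> \<le> k (n + m)"
  using divide_right_mono[of "\<bar>z\<bar>" "k n" "r ^ m"] r by (simp add: k_def abs_div power_add)

lemma bounds:
  assumes "bounded_order U n f K"
  shows "f differentiable (at x)" "\<bar>f x\<bar> \<le> k n" "\<bar>pd 2 f x\<bar> \<le> k (Suc n)" "a \<noteq> 2 \<Longrightarrow> \<bar>pd a f x\<bar> \<le> k n"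
  using bounded_orderD[OF assms x] by (auto simp: k_def r)

lemma uu_bounds:
  assumes rem: "bounded_order U 2 (\<lambda>x. f x - (- 1 + M x / x$2)) K"
  shows "f differentiable (at x)" "\<bar>f x + 1\<bar> \<le> 18 * K / x$2"
    "\<bar>pd 1 f x - pd 1 M x / x$2\<bar> \<le> 18 * K / (x$2)^2"
    "\<bar>pd 2 f x\<bar> \<le> 18 * K / (x$2)^2" "I \<in> {3,4} \<Longrightarrow> \<bar>pd I f x\<bar> \<le> 18 * K / x$2"
proof -
  define R where "R = (\<lambda>x. f x - (- 1 + M x * (1 / (x$2) ^ 1)))"
  have R: "bounded_order U 2 R K" using rem by (simp add: R_def)
  note A = bounds[OF M] and B = bounds[OF R]
  note E = pd_expansion[OF differentiable_const A(1) coord_differentiable(2)[OF r(3)] B(1)[unfolded R_def], folded R_def]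
  show "f differentiable (at x)" by (rule E)
  have p: "pd a f x = (if a = 2 then - (M x / r^2) else 0) + pd a M x / r^1 + pd a R x" for a
    unfolding E(2) pd_const pd_inverse_power[OF r(3)] by (simp add: r(2) power2_eq_square)
  note mono = k_antimono[of 1 2] k_antimono[of 2 3] k_nonneg[of 1] k_nonneg[of 2]
  have 18: "18 * K / x$2 = 18 * k 1" "18 * K / (x$2)^2 = 18 * k 2" by (auto simp: k_def r(2))
  have "f x + 1 = M x / r^1 + R x" by (simp add: R_def r(2))
  moreover have "\<bar>M x / r^1 + R x\<bar> \<le> k (0 + 1) + k 2" by (intro abs_add_le k_divide A B)
  ultimately show "\<bar>f x + 1\<bar> \<le> 18 * K / x$2" unfolding 18 using mono by simp
  have "pd 1 f x - pd 1 M x / x$2 = pd 1 R x" by (simp add: p r(2))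
  then show "\<bar>pd 1 f x - pd 1 M x / x$2\<bar> \<le> 18 * K / (x$2)^2"
    unfolding 18 using B(4)[of 1] mono by simp
  have "pd 2 f x = pd 2 M x / r^1 + pd 2 R x - M x / r^2" by (simp add: p)
  moreover have "\<bar>pd 2 M x / r^1 + pd 2 R x - M x / r^2\<bar> \<le> k (Suc 0 + 1) + k (Suc 2) + k (0 + 2)"
    by (intro abs_add_le abs_diff_le k_divide A B)
  moreover have "k (Suc 0 + 1) + k (Suc 2) + k (0 + 2) = k 2 + k 3 + k 2" by (simp add: eval_nat_numeral)
  ultimately show "\<bar>pd 2 f x\<bar> \<le> 18 * K / (x$2)^2" unfolding 18 using mono by linarith
  assume "I \<in> {3,4}"
  then have I: "I \<noteq> 2" by auto
  have "pd I f x = pd I M x / r^1 + pd I R x" using I by (simp add: p)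
  moreover have "\<bar>pd I M x / r^1 + pd I R x\<bar> \<le> k (0 + 1) + k 2"
    by (intro abs_add_le k_divide A(4) B(4) I)
  ultimately show "\<bar>pd I f x\<bar> \<le> 18 * K / x$2" unfolding 18 using mono by simp
qed

lemma ur_bounds:
  assumes rem: "bounded_order U 3 (\<lambda>x. f x - (- 1 - M x / (x$2)\<^sup>2)) K"
  shows "f differentiable (at x)" "\<bar>f x + 1\<bar> \<le> 18 * K / (x$2)^2"
    "\<bar>pd 1 f x\<bar> \<le> 18 * K / (x$2)^2"
    "\<bar>pd 2 f x\<bar> \<le> 18 * K / (x$2)^3" "I \<in> {3,4} \<Longrightarrow> \<bar>pd I f x\<bar> \<le> 18 * K / (x$2)^2"
proof -
  define R where "R = (\<lambda>x. f x - (- 1 + M x * (- (1 / (x$2)^2))))"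
  have R: "bounded_order U 3 R K" using rem by (simp add: R_def)
  note A = bounds[OF M] and B = bounds[OF R]
  note E = pd_expansion[OF differentiable_const A(1) coord_differentiable(3)[OF r(3)] B(1)[unfolded R_def], folded R_def]
  show "f differentiable (at x)" by (rule E)
  have p: "pd a f x = (if a = 2 then 2 * (M x / r^3) else 0) - pd a M x / r^2 + pd a R x" for a
    unfolding E(2) pd_const pd_minus[OF coord_differentiable(2)[OF r(3)]] pd_inverse_power[OF r(3)]
    by (simp add: r(2) eval_nat_numeral)
  note mono = k_antimono[of 2 3] k_antimono[of 3 4] k_nonneg[of 2] k_nonneg[of 3]
  have 18: "18 * K / (x$2)^2 = 18 * k 2" "18 * K / (x$2)^3 = 18 * k 3" by (auto simp: k_def r(2))
  have "f x + 1 = R x - M x / r^2" by (simp add: R_def r(2))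
  moreover have "\<bar>R x - M x / r^2\<bar> \<le> k 3 + k (0 + 2)" by (intro abs_diff_le k_divide A B)
  ultimately show "\<bar>f x + 1\<bar> \<le> 18 * K / (x$2)^2" unfolding 18 add_0 using mono by linarith
  have q: "\<bar>pd I f x\<bar> \<le> 18 * K / (x$2)^2" if I: "I \<noteq> 2" for I
  proof -
    have "pd I f x = pd I R x - pd I M x / r^2" using I by (simp add: p)
    moreover have "\<bar>pd I R x - pd I M x / r^2\<bar> \<le> k 3 + k (0 + 2)"
      by (intro abs_diff_le k_divide A(4) B(4) I)
    ultimately show ?thesis unfolding 18 add_0 using mono by linarith
  qed
  show "\<bar>pd 1 f x\<bar> \<le> 18 * K / (x$2)^2" by (rule q) simp
  show "I \<in> {3,4} \<Longrightarrow> \<bar>pd I f x\<bar> \<le> 18 * K / (x$2)^2" by (rule q) auto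
  have "pd 2 f x = M x / r^3 + M x / r^3 - pd 2 M x / r^2 + pd 2 R x" by (simp add: p)
  moreover have "\<bar>M x / r^3 + M x / r^3 - pd 2 M x / r^2 + pd 2 R x\<bar> \<le> k (0 + 3) + k (0 + 3) + k (Suc 0 + 2) + k (Suc 3)"
    by (intro abs_add_le abs_diff_le k_divide A B)
  moreover have "k (0 + 3) + k (0 + 3) + k (Suc 0 + 2) + k (Suc 3) = k 3 + k 3 + k 3 + k 4" by (simp add: eval_nat_numeral)
  ultimately show "\<bar>pd 2 f x\<bar> \<le> 18 * K / (x$2)^3" unfolding 18 using mono by linarith
qed

lemma uI_bounds:
  assumes rem: "bounded_order U 1 (\<lambda>x. f x - M x) K"
  shows "f differentiable (at x)" "\<bar>f x\<bar> \<le> 18 * K" "\<bar>pd 1 f x\<bar> \<le> 18 * K"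
    "\<bar>pd 2 f x\<bar> \<le> 18 * K / x$2" "I \<in> {3,4} \<Longrightarrow> \<bar>pd I f x\<bar> \<le> 18 * K"
proof -
  define R where "R = (\<lambda>x. f x - (0 + M x * 1))"
  have R: "bounded_order U 1 R K" using rem by (simp add: R_def)
  note A = bounds[OF M] and B = bounds[OF R]
  note E = pd_expansion[OF differentiable_const A(1) differentiable_const B(1)[unfolded R_def], folded R_def]
  show "f differentiable (at x)" by (rule E)
  have p: "pd a f x = pd a M x + pd a R x" for a
    unfolding E(2) by (simp add: pd_const)
  note mono = k_antimono[of 0 1] k_antimono[of 1 2] k_nonneg[of 0] k_nonneg[of 1]
  have 18: "18 * K = 18 * k 0" "18 * k 0 / x$2 = 18 * k 1" by (auto simp: k_def r(2))
  have "f x = M x + R x" by (simp add: R_def)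
  moreover have "\<bar>M x + R x\<bar> \<le> k 0 + k 1" by (intro abs_add_le A B)
  ultimately show "\<bar>f x\<bar> \<le> 18 * K" unfolding 18 add_0 using mono by linarith
  have q: "\<bar>pd I f x\<bar> \<le> 18 * K" if "I \<noteq> 2" for I
  proof -
    have "\<bar>pd I f x\<bar> \<le> k 0 + k 1" unfolding p by (intro abs_add_le A(4) B(4) that)
    then show ?thesis unfolding 18 using mono by linarith
  qed
  show "\<bar>pd 1 f x\<bar> \<le> 18 * K" by (rule q) simp
  show "I \<in> {3,4} \<Longrightarrow> \<bar>pd I f x\<bar> \<le> 18 * K" by (rule q) auto
  have "\<bar>pd 2 f x\<bar> \<le> k (Suc 0) + k (Suc 1)" unfolding p by (intro abs_add_le A B)
  moreover have "k (Suc 0) + k (Suc 1) = k 1 + k 2" by (simp add: eval_nat_numeral)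
  ultimately show "\<bar>pd 2 f x\<bar> \<le> 18 * K / x$2" unfolding 18 using mono by linarith
qed

text \<open>The constant 18 of all four lemmas arises here: 16 bounds the gradient of the round
  metric, and one unit each goes to \<open>M * r\<close> and to the remainder.\<close>

lemma IJ_bounds:
  assumes c: "c differentiable (at x)" and c': "pd 1 c x = 0" "pd 2 c x = 0" "\<And>I. \<bar>pd I c x\<bar> \<le> 16"
    and rem: "bounded_order U 0 (\<lambda>x. f x - (c x * (x$2)\<^sup>2 + M x * x$2)) K"
  shows "f differentiable (at x)" "\<bar>f x - c x * (x$2)^2\<bar> \<le> 18 * K * x$2"
    "\<bar>pd 1 f x - pd 1 M x * x$2\<bar> \<le> 18 * K"
    "\<bar>pd 2 f x - c x * (2 * x$2)\<bar> \<le> 18 * K" "I \<in> {3,4} \<Longrightarrow> \<bar>pd I f x\<bar> \<le> 18 * K * (x$2)^2"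
proof -
  define R where "R = (\<lambda>x. f x - (c x * (x$2)^2 + M x * (x$2) ^ 1))"
  have R: "bounded_order U 0 R K" using rem by (simp add: R_def)
  note A = bounds[OF M] and B = bounds[OF R]
  note E = pd_expansion[OF differentiable_mult[OF c coord_differentiable(1)] A(1) coord_differentiable(1) B(1)[unfolded R_def], folded R_def]
  show "f differentiable (at x)" by (rule E)
  have p: "pd a f x = pd a c x * r^2 + (if a = 2 then c x * (2 * r) + M x else 0) + pd a M x * r + pd a R x" for a
    unfolding E(2) pd_mult[OF c coord_differentiable(1)] pd_coord_power by (simp add: r(2) algebra_simps)
  have k0: "k 0 = K" and k1: "k (Suc 0) \<le> K" using k_antimono[of 0 1] by (auto simp: k_def)
  have rK: "K \<le> K * r" "K * r \<le> K * r^2" "0 \<le> K * r"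
    using r K by (auto simp: power2_eq_square mult_le_cancel_left1 mult_le_cancel_right1)
  have Mr: "\<bar>z * r\<bar> \<le> K * r" if "\<bar>z\<bar> \<le> k 0" for z
    using abs_mult_le[OF that, of r r] r(1) by (simp add: k0)
  have "f x - c x * (x$2)^2 = M x * r + R x" by (simp add: R_def r(2))
  moreover have "\<bar>M x * r + R x\<bar> \<le> K * r + k 0" by (intro abs_add_le Mr A B)
  moreover have "18 * K * x$2 = 18 * (K * r)" by (simp add: r(2))
  ultimately show "\<bar>f x - c x * (x$2)^2\<bar> \<le> 18 * K * x$2" using rK k0 by linarith
  have "pd 1 f x - pd 1 M x * x$2 = pd 1 R x" by (simp add: p c' r(2))
  then show "\<bar>pd 1 f x - pd 1 M x * x$2\<bar> \<le> 18 * K"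
    using B(4)[of 1] K k0 by simp
  have "\<bar>pd 2 M x * r\<bar> \<le> K"
    using abs_mult_le[OF A(3), of r r] r(1) by (simp add: k_def)
  moreover have "pd 2 f x - c x * (2 * x$2) = M x + pd 2 M x * r + pd 2 R x" by (simp add: p c' r(2))
  ultimately have "\<bar>pd 2 f x - c x * (2 * x$2)\<bar> \<le> k 0 + K + k (Suc 0)"
    using A(2) B(3) by (simp only: abs_add_le)
  then show "\<bar>pd 2 f x - c x * (2 * x$2)\<bar> \<le> 18 * K" using k0 k1 K by linarith
  assume "I \<in> {3,4}"
  then have I: "I \<noteq> 2" by auto
  have "\<bar>pd I c x * r^2\<bar> \<le> 16 * r^2" using abs_mult_le[OF c'(3), of "r^2" "r^2"] by simp
  also have "\<dots> \<le> 16 * (K * r^2)" using K by (simp add: mult_le_cancel_right1)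
  finally have "\<bar>pd I c x * r^2 + pd I M x * r + pd I R x\<bar> \<le> 16 * (K * r^2) + K * r + k 0"
    by (intro abs_add_le Mr A(4) B(4) I)
  moreover have "pd I f x = pd I c x * r^2 + pd I M x * r + pd I R x" using I by (simp add: p)
  moreover have "18 * K * (x$2)^2 = 18 * (K * r^2)" by (simp add: r(2))
  ultimately show "\<bar>pd I f x\<bar> \<le> 18 * K * (x$2)^2" using rK k0 by linarith
qed

end

text \<open>With \<open>d\<close> the stereographic denominator, the derivative of
  \<open>4 / d\<^sup>2\<close> along an angle \<open>y\<close> is \<open>- 16 * y / d^3\<close>, and
  \<open>\<bar>y\<bar> \<le> d \<le> d^3\<close>.\<close>

lemma conformal_square_pd:
  shows "(\<lambda>x. (conformal x)\<^sup>2) differentiable (at x)"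
    and "pd 1 (\<lambda>x. (conformal x)\<^sup>2) x = 0" "pd 2 (\<lambda>x. (conformal x)\<^sup>2) x = 0"
    and "\<bar>pd I (\<lambda>x. (conformal x)\<^sup>2) x\<bar> \<le> 16"
proof -
  define d where "d = 1 + (x$3)\<^sup>2 + (x$4)\<^sup>2"
  have d: "1 \<le> d" "d \<noteq> 0" by (auto simp: d_def add_nonneg_eq_0_iff add.assoc)
  have "((\<lambda>x::real^4. 1 + (x$3)\<^sup>2 + (x$4)\<^sup>2) has_derivative (\<lambda>v. 2 * x$3 * v$3 + 2 * x$4 * v$4)) (at x)"
    by (rule has_derivative_eq_rhs, (rule derivative_eq_intros refl)+) (auto simp: fun_eq_iff)
  from has_derivative_power[OF has_derivative_divide[OF has_derivative_const[of 2] this], of 2]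
  have D: "((\<lambda>x. (conformal x)\<^sup>2) has_derivative (\<lambda>v. - (16 * (x$3 * v$3 + x$4 * v$4)) / d^3)) (at x)"
    unfolding conformal_def d_def[symmetric]
    by (rule has_derivative_eq_rhs)
      (use d in \<open>auto simp: fun_eq_iff field_simps power2_eq_square power3_eq_cube\<close>)
  show "(\<lambda>x. (conformal x)\<^sup>2) differentiable (at x)" by (rule differentiableI[OF D])
  have p: "pd a (\<lambda>x. (conformal x)\<^sup>2) x = - (16 * (x$3 * axis a 1 $ 3 + x$4 * axis a 1 $ 4)) / d^3" for a
    by (rule pd_eq[OF D])
  show "pd 1 (\<lambda>x. (conformal x)\<^sup>2) x = 0" "pd 2 (\<lambda>x. (conformal x)\<^sup>2) x = 0"
    unfolding p by (auto simp: axis_def)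
  have b: "\<bar>y\<bar> \<le> d" if "y = x$3 \<or> y = x$4" for y
  proof -
    have "2 * \<bar>y\<bar> \<le> 1 + y\<^sup>2" using sum_squares_bound[of 1 "\<bar>y\<bar>"] by simp
    moreover have "1 + y\<^sup>2 \<le> d" using that by (auto simp: d_def)
    ultimately show ?thesis by linarith
  qed
  have "d \<le> d^3" using d by (simp add: self_le_power)
  have c: "\<bar>16 * y / d^3\<bar> \<le> 16" if "\<bar>y\<bar> \<le> d" for y
  proof -
    have "\<bar>y\<bar> \<le> d^3" using that \<open>d \<le> d^3\<close> by linarith
    then show ?thesis using d by (simp add: abs_div divide_le_eq abs_mult)
  qed
  show "\<bar>pd I (\<lambda>x. (conformal x)\<^sup>2) x\<bar> \<le> 16"
    unfolding p using c[OF b[of "x$3"]] c[OF b[of "x$4"]] exhaust_4[of I] by (auto simp: axis_def)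
qed


section \<open>The metric in a chart satisfies the pointwise assumptions\<close>

lemma
  assumes "bondi_spacetime U R0 A B C h" "x \<in> chart_region U R0" "\<sigma> \<in> {1, -1}"
  shows metric_comp_sym: "metric_comp A B C h \<sigma> x $ a $ b = metric_comp A B C h \<sigma> x $ b $ a"
    and metric_comp_radial: "a \<in> {2,3,4} \<Longrightarrow> metric_comp A B C h \<sigma> x $ 2 $ a = 0"
proof -
  let ?h = "h (x$1) (x$2) (sphere_point \<sigma> x)"
  have "(x$1, x$2, sphere_point \<sigma> x) \<in> near_scri U R0"
    using assms(2) sphere_frame_inner(6)[OF assms(3)] by (auto simp: near_scri_def chart_region_def)
  then have h: "bilinear ?h" "?h v w = ?h w v" for v w
    using assms(1) unfolding bondi_spacetime_def by auto
  show "metric_comp A B C h \<sigma> x $ a $ b = metric_comp A B C h \<sigma> x $ b $ a"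
  proof -
    obtain u1 r1 z1 where a: "coord_vector \<sigma> x a = (u1, r1, z1)" by (metis prod_cases3)
    obtain u2 r2 z2 where b: "coord_vector \<sigma> x b = (u2, r2, z2)" by (metis prod_cases3)
    let ?C = "C (x$1) (x$2) (sphere_point \<sigma> x)"
    have "?h (z1 + u1 *\<^sub>R ?C) (z2 + u2 *\<^sub>R ?C) = ?h (z2 + u2 *\<^sub>R ?C) (z1 + u1 *\<^sub>R ?C)" by (rule h(2))
    then show ?thesis by (simp add: metric_comp_def bondi_metric_def chart_map_def a b)
  qed
  show "a \<in> {2,3,4} \<Longrightarrow> metric_comp A B C h \<sigma> x $ 2 $ a = 0"
    using bilinear_lzero[OF h(1)]
    by (auto simp: metric_comp_def bondi_metric_def chart_map_def coord_vector_eq)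
qed

text \<open>The clauses of \<open>bondi_expansion\<close> in one chart with one constant for all of
  them, the angular indices renumbered as 3 and 4, and \<open>omega_comp\<close> replaced by its
  conformal form.\<close>

definition chart_bounds where
  "chart_bounds U A B C h m B1 h1 C1 \<sigma> K \<longleftrightarrow>
     bounded_order U 0 (\<lambda>x. m (x$1) (sphere_point \<sigma> x)) K \<and>
     bounded_order U 0 (\<lambda>x. B1 (x$1) (sphere_point \<sigma> x)) K \<and>
     (\<forall>i\<in>{3,4}. \<forall>j\<in>{3,4}. bounded_order U 0
        (\<lambda>x. h1 (x$1) (sphere_point \<sigma> x) (sphere_frame \<sigma> x i) (sphere_frame \<sigma> x j)) K) \<and>
     (\<forall>i\<in>{3,4}. bounded_order U 0 (\<lambda>x. C1 (x$1) (sphere_point \<sigma> x) \<bullet> sphere_frame \<sigma> x i) K) \<and>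
     bounded_order U 2 (\<lambda>x. metric_comp A B C h \<sigma> x $ 1 $ 1
        - (- 1 + m (x$1) (sphere_point \<sigma> x) / x$2)) K \<and>
     bounded_order U 3 (\<lambda>x. metric_comp A B C h \<sigma> x $ 1 $ 2
        - (- 1 - B1 (x$1) (sphere_point \<sigma> x) / (x$2)\<^sup>2)) K \<and>
     (\<forall>i\<in>{3,4}. \<forall>j\<in>{3,4}. bounded_order U 0 (\<lambda>x. metric_comp A B C h \<sigma> x $ i $ j
        - ((if i = j then (conformal x)\<^sup>2 else 0) * (x$2)\<^sup>2
           + h1 (x$1) (sphere_point \<sigma> x) (sphere_frame \<sigma> x i) (sphere_frame \<sigma> x j) * x$2)) K) \<and>
     (\<forall>i\<in>{3,4}. bounded_order U 1 (\<lambda>x. metric_comp A B C h \<sigma> x $ 1 $ i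
        - C1 (x$1) (sphere_point \<sigma> x) \<bullet> sphere_frame \<sigma> x i) K)"

lemma ang_surj: "i \<in> {3,4} \<Longrightarrow> \<exists>I. i = ang I"
  using ang_simps by (metis insert_iff empty_iff)

lemma omega_comp_eq:
  assumes "\<sigma> \<in> {1, -1}"
  shows "omega_comp \<sigma> x $ I $ J = (if ang I = ang J then (conformal x)\<^sup>2 else 0)"
  using exhaust_2[of I] exhaust_2[of J] sphere_frame_inner(1-3)[OF assms, of x]
  by (auto simp: omega_comp_def ang_vector_eq inner_commute)

lemma chart_bounds_eventually:
  assumes E: "bondi_expansion U A B C h m B1 h1 C1" and \<sigma>: "\<sigma> \<in> {1, -1}"
  shows "\<forall>\<^sub>F K in at_top. chart_bounds U A B C h m B1 h1 C1 \<sigma> K"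
proof -
  note E' = conjunct2[OF E[unfolded bondi_expansion_def], rule_format, OF \<sigma>]
  have 1: "bigO_r U 0 (\<lambda>x. m (x$1) (sphere_point \<sigma> x))" "bigO_r U 0 (\<lambda>x. B1 (x$1) (sphere_point \<sigma> x))"
    "bigO_r U 2 (\<lambda>x. metric_comp A B C h \<sigma> x $ 1 $ 1 - (- 1 + m (x$1) (sphere_point \<sigma> x) / x$2))"
    "bigO_r U 3 (\<lambda>x. metric_comp A B C h \<sigma> x $ 1 $ 2 - (- 1 - B1 (x$1) (sphere_point \<sigma> x) / (x$2)\<^sup>2))"
    using E' by blast+
  have 2: "bigO_r U 0 (\<lambda>x. C1 (x$1) (sphere_point \<sigma> x) \<bullet> sphere_frame \<sigma> x i)"
    "bigO_r U 1 (\<lambda>x. metric_comp A B C h \<sigma> x $ 1 $ i - C1 (x$1) (sphere_point \<sigma> x) \<bullet> sphere_frame \<sigma> x i)"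
    if i: "i \<in> {3,4}" for i
  proof -
    obtain I where I: "i = ang I" using ang_surj[OF i] by blast
    show "bigO_r U 0 (\<lambda>x. C1 (x$1) (sphere_point \<sigma> x) \<bullet> sphere_frame \<sigma> x i)"
      "bigO_r U 1 (\<lambda>x. metric_comp A B C h \<sigma> x $ 1 $ i - C1 (x$1) (sphere_point \<sigma> x) \<bullet> sphere_frame \<sigma> x i)"
      using E' unfolding ang_vector_eq I by blast+
  qed
  have 3: "bigO_r U 0 (\<lambda>x. h1 (x$1) (sphere_point \<sigma> x) (sphere_frame \<sigma> x i) (sphere_frame \<sigma> x j))"
    "bigO_r U 0 (\<lambda>x. metric_comp A B C h \<sigma> x $ i $ j
        - ((if i = j then (conformal x)\<^sup>2 else 0) * (x$2)\<^sup>2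
           + h1 (x$1) (sphere_point \<sigma> x) (sphere_frame \<sigma> x i) (sphere_frame \<sigma> x j) * x$2))"
    if ij: "i \<in> {3,4}" "j \<in> {3,4}" for i j
  proof -
    obtain I J where I: "i = ang I" "j = ang J" using ang_surj[OF ij(1)] ang_surj[OF ij(2)] by blast
    show "bigO_r U 0 (\<lambda>x. h1 (x$1) (sphere_point \<sigma> x) (sphere_frame \<sigma> x i) (sphere_frame \<sigma> x j))"
      "bigO_r U 0 (\<lambda>x. metric_comp A B C h \<sigma> x $ i $ j
        - ((if i = j then (conformal x)\<^sup>2 else 0) * (x$2)\<^sup>2
           + h1 (x$1) (sphere_point \<sigma> x) (sphere_frame \<sigma> x i) (sphere_frame \<sigma> x j) * x$2))"
      using E' unfolding ang_vector_eq omega_comp_eq[OF \<sigma>] I by blast+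
  qed
  show ?thesis
    unfolding chart_bounds_def
    by (intro eventually_conj eventually_ball_finite ballI bigO_r_eventually 1 2 3) auto
qed

text \<open>The constant of the locale is \<open>18 * K\<close>, and its demand
  \<open>100 * (18 * K) \<le> r\<close> fixes the radius \<open>1800 * K\<close>.\<close>

lemma metric_asymptotic_point:
  assumes U: "open U" and st: "bondi_spacetime U R0 A B C h" and \<sigma>: "\<sigma> \<in> {1, -1}"
    and cb: "chart_bounds U A B C h m B1 h1 C1 \<sigma> K" and K: "1 \<le> K" "R0 \<le> K"
    and x: "x \<in> chart_region U (1800 * K)"
  shows "asymptotic_point (\<lambda>a b. metric_comp A B C h \<sigma> x $ a $ b)
    (\<lambda>c a b. pd c (\<lambda>y. metric_comp A B C h \<sigma> y $ a $ b) x) (18 * K) (x$2) (conformal x)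
    (pd 1 (\<lambda>x. m (x$1) (sphere_point \<sigma> x)) x)
    (\<lambda>i j. pd 1 (\<lambda>x. h1 (x$1) (sphere_point \<sigma> x) (sphere_frame \<sigma> x i) (sphere_frame \<sigma> x j)) x)"
proof -
  have xK: "x \<in> chart_region U K" and xR: "x \<in> chart_region U R0" and r: "1800 * K \<le> x$2" "1 \<le> x$2"
    using x K by (auto simp: chart_region_def)
  note cb' = cb[unfolded chart_bounds_def]
  have m: "bounded_order U 0 (\<lambda>x. m (x$1) (sphere_point \<sigma> x)) K"
    and b1: "bounded_order U 0 (\<lambda>x. B1 (x$1) (sphere_point \<sigma> x)) K"
    and h1: "\<And>i j. i \<in> {3,4} \<Longrightarrow> j \<in> {3,4} \<Longrightarrow> bounded_order U 0
        (\<lambda>x. h1 (x$1) (sphere_point \<sigma> x) (sphere_frame \<sigma> x i) (sphere_frame \<sigma> x j)) K"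
    and c1: "\<And>i. i \<in> {3,4} \<Longrightarrow> bounded_order U 0 (\<lambda>x. C1 (x$1) (sphere_point \<sigma> x) \<bullet> sphere_frame \<sigma> x i) K"
    and guu: "bounded_order U 2 (\<lambda>x. metric_comp A B C h \<sigma> x $ 1 $ 1
        - (- 1 + m (x$1) (sphere_point \<sigma> x) / x$2)) K"
    and gur: "bounded_order U 3 (\<lambda>x. metric_comp A B C h \<sigma> x $ 1 $ 2
        - (- 1 - B1 (x$1) (sphere_point \<sigma> x) / (x$2)\<^sup>2)) K"
    and gij: "\<And>i j. i \<in> {3,4} \<Longrightarrow> j \<in> {3,4} \<Longrightarrow> bounded_order U 0 (\<lambda>x. metric_comp A B C h \<sigma> x $ i $ j
        - ((if i = j then (conformal x)\<^sup>2 else 0) * (x$2)\<^sup>2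
           + h1 (x$1) (sphere_point \<sigma> x) (sphere_frame \<sigma> x i) (sphere_frame \<sigma> x j) * x$2)) K"
    and gui: "\<And>i. i \<in> {3,4} \<Longrightarrow> bounded_order U 1 (\<lambda>x. metric_comp A B C h \<sigma> x $ 1 $ i
        - C1 (x$1) (sphere_point \<sigma> x) \<bullet> sphere_frame \<sigma> x i) K"
    using cb' by blast+
  define \<delta> where "\<delta> i j = (\<lambda>x. if i = j then (conformal x)\<^sup>2 else (0::real))" for i j :: 4
  have delta: "\<delta> i j differentiable (at x)" "pd 1 (\<delta> i j) x = 0" "pd 2 (\<delta> i j) x = 0" "\<bar>pd I (\<delta> i j) x\<bar> \<le> 16"
    for i j I
    using conformal_square_pd[where x = x] by (cases "i = j"; simp add: \<delta>_def pd_const)+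
  have gij': "bounded_order U 0 (\<lambda>x. metric_comp A B C h \<sigma> x $ i $ j - (\<delta> i j x * (x$2)\<^sup>2
      + h1 (x$1) (sphere_point \<sigma> x) (sphere_frame \<sigma> x i) (sphere_frame \<sigma> x j) * x$2)) K"
    if "i \<in> {3,4}" "j \<in> {3,4}" for i j
    using gij[OF that] by (simp add: \<delta>_def)
  note u = expansion_point.uu_bounds[OF expansion_point.intro[OF m xK K(1)] guu]
  note r' = expansion_point.ur_bounds[OF expansion_point.intro[OF b1 xK K(1)] gur]
  note i' = expansion_point.uI_bounds[OF expansion_point.intro[OF c1 xK K(1)] gui]
  note ij = expansion_point.IJ_bounds[OF expansion_point.intro[OF h1 xK K(1)] delta gij']
  note ij' = ij[unfolded \<delta>_def]
  have op: "open (chart_region U R0)" by (rule open_chart_region[OF U])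
  show ?thesis
  proof
    show "1 \<le> 18 * K" "100 * (18 * K) \<le> x$2" using K r by auto
    show "2/5 \<le> conformal x" "conformal x \<le> 2" by (rule conformal_bounds[OF x])+
    show "metric_comp A B C h \<sigma> x $ a $ b = metric_comp A B C h \<sigma> x $ b $ a" for a b
      by (rule metric_comp_sym[OF st xR \<sigma>])
    \<comment> \<open>Symmetry and the radial gauge hold throughout an open region, so they may be
      differentiated.\<close>
    show "pd c (\<lambda>y. metric_comp A B C h \<sigma> y $ a $ b) x = pd c (\<lambda>y. metric_comp A B C h \<sigma> y $ b $ a) x" for a b c
      by (rule pd_cong_open[OF op xR]) (rule metric_comp_sym[OF st _ \<sigma>])
    show "metric_comp A B C h \<sigma> x $ 2 $ a = 0" if "a \<in> {2,3,4}" for a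
      by (rule metric_comp_radial[OF st xR \<sigma> that])
    show "pd c (\<lambda>y. metric_comp A B C h \<sigma> y $ 2 $ a) x = 0" if "a \<in> {2,3,4}" for a c
      by (rule trans[OF pd_cong_open[OF op xR] pd_const[where c = 0]]) (rule metric_comp_radial[OF st _ \<sigma> that])
    show "\<bar>pd 1 (\<lambda>x. m (x$1) (sphere_point \<sigma> x)) x\<bar> \<le> 18 * K"
      using bounded_orderD(4)[OF m xK, of 1] K by simp
    show "\<bar>pd 1 (\<lambda>x. h1 (x$1) (sphere_point \<sigma> x) (sphere_frame \<sigma> x I) (sphere_frame \<sigma> x J)) x\<bar> \<le> 18 * K"
      if "I \<in> {3,4}" "J \<in> {3,4}" for I J
      using bounded_orderD(4)[OF h1[OF that] xK, of 1] K by simp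
  qed (rule u(2-5) r'(2-5) i'(2-5) ij'(2-5), (assumption+)?)+
qed

section \<open>The geodesic equation with a lowered index\<close>

lemma matrix_inv_right_inverse:
  fixes g :: "real^'n^'n"
  assumes "\<And>v. g *v v = 0 \<Longrightarrow> v = 0"
  shows "g ** matrix_inv g = mat 1"
proof -
  have "\<exists>B. B ** g = mat 1" using assms by (simp add: matrix_left_invertible_ker)
  then have "invertible g" by (simp add: invertible_left_inverse)
  then have "g ** matrix_inv g = mat 1 \<and> matrix_inv g ** g = mat 1"
    unfolding invertible_def matrix_inv_def by (rule someI_ex)
  then show ?thesis ..
qed

text \<open>Contraction with the metric cancels the inverse in the Christoffel symbols; what is left
  are first derivatives of metric components, exactly the data that the expansion controls.\<close>

lemma lowered_geodesic_equation:
  fixes g :: "real^4 \<Rightarrow> real^4^4" and x v :: "real^4"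
  assumes inj: "\<And>v. g x *v v = 0 \<Longrightarrow> v = 0"
  defines "a \<equiv> \<lambda>i. - (\<Sum>c\<in>UNIV. \<Sum>d\<in>UNIV. christoffel g x i c d * v$c * v$d)"
  shows "(\<Sum>i\<in>UNIV. g x $ e $ i * a i) = - (\<Sum>c\<in>UNIV. \<Sum>d\<in>UNIV. 1/2 *
     (pd c (\<lambda>y. g y $ e $ d) x + pd d (\<lambda>y. g y $ e $ c) x - pd e (\<lambda>y. g y $ c $ d) x) * v$c * v$d)"
proof -
  define T where "T k c d = pd c (\<lambda>y. g y $ k $ d) x + pd d (\<lambda>y. g y $ k $ c) x - pd k (\<lambda>y. g y $ c $ d) x"
    for k c d
  have delta: "(\<Sum>i\<in>UNIV. g x $ e $ i * matrix_inv (g x) $ i $ k) = (if e = k then 1 else 0)" for k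
  proof -
    have "(g x ** matrix_inv (g x)) $ e $ k = (mat 1 :: real^4^4) $ e $ k"
      using matrix_inv_right_inverse[OF inj] by simp
    then show ?thesis by (simp add: matrix_matrix_mult_def mat_def)
  qed
  have low: "(\<Sum>i\<in>UNIV. g x $ e $ i * christoffel g x i c d) = 1/2 * T e c d" for c d
  proof -
    have "(\<Sum>i\<in>UNIV. g x $ e $ i * christoffel g x i c d)
        = (\<Sum>i\<in>UNIV. \<Sum>k\<in>UNIV. 1/2 * (g x $ e $ i * matrix_inv (g x) $ i $ k) * T k c d)"
      unfolding christoffel_def T_def[symmetric] by (simp add: sum_distrib_left mult_ac)
    also have "\<dots> = (\<Sum>k\<in>UNIV. \<Sum>i\<in>UNIV. 1/2 * (g x $ e $ i * matrix_inv (g x) $ i $ k) * T k c d)"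
      by (rule sum.swap)
    also have "\<dots> = (\<Sum>k\<in>UNIV. 1/2 * (\<Sum>i\<in>UNIV. g x $ e $ i * matrix_inv (g x) $ i $ k) * T k c d)"
      by (simp add: sum_distrib_left sum_distrib_right)
    also have "\<dots> = 1/2 * T e c d"
      unfolding delta by (simp add: if_distrib[of "\<lambda>z. _ * z"] if_distrib[of "\<lambda>z. z * _"] cong: if_cong)
    finally show ?thesis .
  qed
  have "(\<Sum>i\<in>UNIV. g x $ e $ i * a i)
      = - (\<Sum>i\<in>UNIV. \<Sum>c\<in>UNIV. \<Sum>d\<in>UNIV. g x $ e $ i * christoffel g x i c d * v$c * v$d)"
    unfolding a_def by (simp add: sum_distrib_left sum_negf mult_ac)
  also have "(\<Sum>i\<in>UNIV. \<Sum>c\<in>UNIV. \<Sum>d\<in>UNIV. g x $ e $ i * christoffel g x i c d * v$c * v$d)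
      = (\<Sum>c\<in>UNIV. \<Sum>i\<in>UNIV. \<Sum>d\<in>UNIV. g x $ e $ i * christoffel g x i c d * v$c * v$d)"
    by (rule sum.swap)
  also have "\<dots> = (\<Sum>c\<in>UNIV. \<Sum>d\<in>UNIV. \<Sum>i\<in>UNIV. g x $ e $ i * christoffel g x i c d * v$c * v$d)"
    by (intro sum.cong refl sum.swap)
  also have "\<dots> = (\<Sum>c\<in>UNIV. \<Sum>d\<in>UNIV. (\<Sum>i\<in>UNIV. g x $ e $ i * christoffel g x i c d) * v$c * v$d)"
    by (simp add: sum_distrib_right)
  finally show ?thesis unfolding low T_def .
qed

section \<open>Photons\<close>


lemma sphere_point_cong: "y$3 = x$3 \<Longrightarrow> y$4 = x$4 \<Longrightarrow> sphere_point \<sigma> y = sphere_point \<sigma> x"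
  and sphere_frame_cong: "y$3 = x$3 \<Longrightarrow> y$4 = x$4 \<Longrightarrow> sphere_frame \<sigma> y i = sphere_frame \<sigma> x i"
  by (simp_all add: sphere_point_def sphere_frame_def Let_def)

lemma Omega_inf_le:
  fixes z3 z4 :: real
  assumes U: "open U" and bil: "\<And>u \<xi>. u \<in> U \<Longrightarrow> norm \<xi> = 1 \<Longrightarrow> bilinear (h1 u \<xi>)"
    and \<sigma>: "\<sigma> \<in> {1, -1}" and cb: "chart_bounds U A B C h m B1 h1 C1 \<sigma> K" and x: "x \<in> chart_region U K"
    and pos: "\<And>u \<xi> \<phi>. u \<in> U \<Longrightarrow> norm \<xi> = 1 \<Longrightarrow> \<phi> \<bullet> \<xi> = 0 \<Longrightarrow> \<phi> \<noteq> 0 \<Longrightarrow> 0 < Omega_form m h1 u \<xi> \<phi> \<phi>"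
    and mneg: "\<And>u \<xi>. u \<in> U \<Longrightarrow> norm \<xi> = 1 \<Longrightarrow> mdot m u \<xi> \<le> 0"
  defines "\<eta> \<equiv> \<lambda>i j. pd 1 (\<lambda>x. h1 (x$1) (sphere_point \<sigma> x) (sphere_frame \<sigma> x i) (sphere_frame \<sigma> x j)) x"
  shows "(conformal x)\<^sup>2 * (z3\<^sup>2 + z4\<^sup>2) * Omega_inf U m h1 \<le> (conformal x)\<^sup>2 * (z3\<^sup>2 + z4\<^sup>2)
     - 1/2 * (\<eta> 3 3 * z3 * z3 + \<eta> 3 4 * z3 * z4 + \<eta> 4 3 * z4 * z3 + \<eta> 4 4 * z4 * z4)"
proof -
  define Q where "Q = (conformal x)\<^sup>2 * (z3\<^sup>2 + z4\<^sup>2)"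
  define u \<xi> where "u = x$1" and "\<xi> = sphere_point \<sigma> x"
  define E where "E = \<eta> 3 3 * z3 * z3 + \<eta> 3 4 * z3 * z4 + \<eta> 4 3 * z4 * z3 + \<eta> 4 4 * z4 * z4"
  note frame = sphere_frame_inner[OF \<sigma>, of x]
  have u: "u \<in> U" and \<xi>: "norm \<xi> = 1" using x frame(6) by (auto simp: u_def \<xi>_def chart_region_def)
  have cpos: "0 < conformal x" using conformal_bounds(1)[OF x] by simp
  show ?thesis
  proof (cases "z3\<^sup>2 + z4\<^sup>2 = 0")
    case True
    then have "z3 = 0" "z4 = 0" by (auto simp: sum_power2_eq_zero_iff)
    then show ?thesis by simp
  next
    case False
    then have Q: "0 < Q" using cpos by (simp add: Q_def sum_power2_gt_zero_iff[symmetric] less_le)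
    define \<psi> where "\<psi> = z3 *\<^sub>R sphere_frame \<sigma> x 3 + z4 *\<^sub>R sphere_frame \<sigma> x 4"
    define \<phi> where "\<phi> = (1 / sqrt Q) *\<^sub>R \<psi>"
    have psi: "\<psi> \<bullet> \<psi> = Q" "\<psi> \<bullet> \<xi> = 0"
      using frame by (simp_all add: \<psi>_def \<xi>_def Q_def inner_add_left inner_add_right inner_commute
          power2_eq_square algebra_simps)
    have phi: "\<phi> \<bullet> \<phi> = 1" "\<phi> \<bullet> \<xi> = 0"
      using psi Q by (simp_all add: \<phi>_def)
    have hexp: "h1 t \<xi> \<phi> \<phi> = (1 / Q) *
        (h1 t \<xi> (sphere_frame \<sigma> x 3) (sphere_frame \<sigma> x 3) * (z3 * z3)
         + h1 t \<xi> (sphere_frame \<sigma> x 3) (sphere_frame \<sigma> x 4) * (z3 * z4)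
         + h1 t \<xi> (sphere_frame \<sigma> x 4) (sphere_frame \<sigma> x 3) * (z4 * z3)
         + h1 t \<xi> (sphere_frame \<sigma> x 4) (sphere_frame \<sigma> x 4) * (z4 * z4))" if "t \<in> U" for t
    proof -
      note b = bil[OF that \<xi>]
      have "h1 t \<xi> \<phi> \<phi> = (1 / sqrt Q) * (1 / sqrt Q) * h1 t \<xi> \<psi> \<psi>"
        by (simp add: \<phi>_def bilinear_lmul[OF b] bilinear_rmul[OF b])
      also have "(1 / sqrt Q) * (1 / sqrt Q) = 1 / Q" using Q by simp
      finally show ?thesis
        by (simp add: \<psi>_def bilinear_ladd[OF b] bilinear_radd[OF b] bilinear_lmul[OF b] bilinear_rmul[OF b]
            algebra_simps)
    qed
    have dh: "((\<lambda>t. h1 t \<xi> (sphere_frame \<sigma> x i) (sphere_frame \<sigma> x j)) has_real_derivative \<eta> i j) (at u)"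
      if "i \<in> {3,4}" "j \<in> {3,4}" for i j
      unfolding \<eta>_def u_def
    proof (rule pd_1_eq_deriv)
      have "bounded_order U 0 (\<lambda>x. h1 (x$1) (sphere_point \<sigma> x) (sphere_frame \<sigma> x i) (sphere_frame \<sigma> x j)) K"
        using cb that unfolding chart_bounds_def by blast
      then show "(\<lambda>x. h1 (x$1) (sphere_point \<sigma> x) (sphere_frame \<sigma> x i) (sphere_frame \<sigma> x j)) differentiable (at x)"
        by (rule bounded_orderD[OF _ x])
      fix y :: "real^4" assume "y$3 = x$3" "y$4 = x$4"
      then show "h1 (y$1) (sphere_point \<sigma> y) (sphere_frame \<sigma> y i) (sphere_frame \<sigma> y j)
          = h1 (y$1) \<xi> (sphere_frame \<sigma> x i) (sphere_frame \<sigma> x j)"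
        by (simp only: \<xi>_def sphere_point_cong[of y x] sphere_frame_cong[of y x])
    qed
    have "((\<lambda>t. (1 / Q) *
        (h1 t \<xi> (sphere_frame \<sigma> x 3) (sphere_frame \<sigma> x 3) * (z3 * z3)
         + h1 t \<xi> (sphere_frame \<sigma> x 3) (sphere_frame \<sigma> x 4) * (z3 * z4)
         + h1 t \<xi> (sphere_frame \<sigma> x 4) (sphere_frame \<sigma> x 3) * (z4 * z3)
         + h1 t \<xi> (sphere_frame \<sigma> x 4) (sphere_frame \<sigma> x 4) * (z4 * z4))) has_real_derivative
        (1 / Q) * (\<eta> 3 3 * (z3 * z3) + \<eta> 3 4 * (z3 * z4) + \<eta> 4 3 * (z4 * z3) + \<eta> 4 4 * (z4 * z4))) (at u)"
      by (intro DERIV_cmult DERIV_add DERIV_cmult_right dh) auto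
    also have "(1 / Q) * (\<eta> 3 3 * (z3 * z3) + \<eta> 3 4 * (z3 * z4) + \<eta> 4 3 * (z4 * z3) + \<eta> 4 4 * (z4 * z4)) = E / Q"
      by (simp add: E_def mult.assoc)
    \<comment> \<open>Bilinearity of \<open>h1\<close> is available only at times in
      \<open>U\<close>; openness of \<open>U\<close> lets the expanded expression be differentiated
      in its place.\<close>
    finally have "((\<lambda>t. h1 t \<xi> \<phi> \<phi>) has_real_derivative E / Q) (at u)"
      by (rule has_field_derivative_transform_within_open[OF _ U u]) (rule hexp[symmetric])
    then have d: "deriv (\<lambda>t. h1 t \<xi> \<phi> \<phi>) u = E / Q" by (rule DERIV_imp_deriv)
    have "bdd_below {Omega_form m h1 u \<xi> \<phi> \<phi> | u \<xi> \<phi>. u \<in> U \<and> norm \<xi> = 1 \<and> \<phi> \<bullet> \<xi> = 0 \<and> norm \<phi> = 1}"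
      using pos by (intro bdd_belowI[of _ 0]) (fastforce intro: less_imp_le)
    moreover have "Omega_form m h1 u \<xi> \<phi> \<phi> \<in>
        {Omega_form m h1 u \<xi> \<phi> \<phi> | u \<xi> \<phi>. u \<in> U \<and> norm \<xi> = 1 \<and> \<phi> \<bullet> \<xi> = 0 \<and> norm \<phi> = 1}"
      using u \<xi> phi by (auto simp: norm_eq_1)
    ultimately have "Omega_inf U m h1 \<le> Omega_form m h1 u \<xi> \<phi> \<phi>"
      unfolding Omega_inf_def by (rule cInf_lower[rotated])
    also have "\<dots> \<le> 1 - 1/2 * (E / Q)"
      using mneg[OF u \<xi>] by (simp add: Omega_form_def d phi)
    finally have "Q * Omega_inf U m h1 \<le> Q * (1 - 1/2 * (E / Q))"
      using Q by (intro mult_left_mono) auto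
    also have "\<dots> = Q - 1/2 * E" using Q by (simp add: field_simps)
    finally show ?thesis by (simp add: Q_def E_def)
  qed
qed

text \<open>The null condition and the right side of the geodesic equation are homogeneous of degree
  two in the velocity, so dividing by powers of \<open>v$1\<close> reaches the normalisation of
  \<open>asymptotic_photon\<close>.\<close>

lemma photon_estimates:
  fixes v :: "real^4"
  assumes U: "open U" and st: "bondi_spacetime U R0 A B C h" and \<sigma>: "\<sigma> \<in> {1, -1}"
    and bil: "\<And>u \<xi>. u \<in> U \<Longrightarrow> norm \<xi> = 1 \<Longrightarrow> bilinear (h1 u \<xi>)"
    and cb: "chart_bounds U A B C h m B1 h1 C1 \<sigma> K" and K: "1 \<le> K" "R0 \<le> K"
    and x: "x \<in> chart_region U (1800 * K)"
    and pos: "\<And>u \<xi> \<phi>. u \<in> U \<Longrightarrow> norm \<xi> = 1 \<Longrightarrow> \<phi> \<bullet> \<xi> = 0 \<Longrightarrow> \<phi> \<noteq> 0 \<Longrightarrow> 0 < Omega_form m h1 u \<xi> \<phi> \<phi>"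
    and mneg: "\<And>u \<xi>. u \<in> U \<Longrightarrow> norm \<xi> = 1 \<Longrightarrow> mdot m u \<xi> \<le> 0"
    and null: "v \<bullet> (metric_comp A B C h \<sigma> x *v v) = 0" and w: "0 < v$1"
  defines "N \<equiv> 12000 * (18 * K) ^ 5" and "r \<equiv> x$2" and "X \<equiv> v$2 / v$1"
    and "acc \<equiv> \<lambda>i. - (\<Sum>c\<in>UNIV. \<Sum>d\<in>UNIV. christoffel (metric_comp A B C h \<sigma>) x i c d * v$c * v$d)"
    and "F \<equiv> \<lambda>x. m (x$1) (sphere_point \<sigma> x)"
  obtains q where "0 \<le> q" and "\<bar>q - 1 - 2 * X\<bar> \<le> N * (1 + q) / r"
    and "\<bar>acc 1 / (v$1)\<^sup>2\<bar> \<le> N * (1 + q)"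
    and "norm (v$3 *\<^sub>R sphere_frame \<sigma> x 3 + v$4 *\<^sub>R sphere_frame \<sigma> x 4) \<le> N * (1 + q) * v$1"
    and "\<bar>F x\<bar> \<le> N" and "F differentiable (at x)"
    and "q * (Omega_inf U m h1 + X) / r - N * (1 + q)\<^sup>2 / r\<^sup>2
      \<le> acc 2 / (v$1)\<^sup>2 - X * (acc 1 / (v$1)\<^sup>2)
        - ((\<Sum>a\<in>UNIV. v$a * pd a F x) / v$1 / (2 * r) - F x * X / (2 * r\<^sup>2))"
proof -
  define g where "g a b = metric_comp A B C h \<sigma> x $ a $ b" for a b
  define dg where "dg c a b = pd c (\<lambda>y. metric_comp A B C h \<sigma> y $ a $ b) x" for c a b
  define \<mu> where "\<mu> = pd 1 F x"
  define \<eta> where "\<eta> i j = pd 1 (\<lambda>x. h1 (x$1) (sphere_point \<sigma> x) (sphere_frame \<sigma> x i) (sphere_frame \<sigma> x j)) x" for i j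
  interpret P: asymptotic_point g dg "18 * K" r "conformal x" \<mu> \<eta>
    using metric_asymptotic_point[OF U st \<sigma> cb K x]
    unfolding g_def[abs_def] dg_def[abs_def] \<mu>_def \<eta>_def[abs_def] r_def F_def .
  have inj: "u = 0" if "metric_comp A B C h \<sigma> x *v u = 0" for u
  proof -
    have "g e 1 * u$1 + g e 2 * u$2 + g e 3 * u$3 + g e 4 * u$4 = 0" for e
      using arg_cong[OF that, of "\<lambda>y. y $ e"] by (simp add: matrix_vector_mult_def sum_4 g_def)
    from P.nondegenerate[of "\<lambda>i. u$i", OF this] show "u = 0"
      by (simp add: vec_eq_iff forall_4)
  qed
  interpret Q: asymptotic_photon g dg "18 * K" r "conformal x" \<mu> \<eta> "\<lambda>i. v$i / v$1" "\<lambda>i. acc i / (v$1)\<^sup>2"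
  proof
    show "v$1 / v$1 = 1" using w by simp
    have "(\<Sum>c\<in>UNIV. \<Sum>d\<in>UNIV. g c d * (v$c / v$1) * (v$d / v$1)) = (v \<bullet> (metric_comp A B C h \<sigma> x *v v)) / (v$1)\<^sup>2"
      by (simp add: inner_vec_def matrix_vector_mult_def g_def sum_divide_distrib sum_distrib_left power2_eq_square mult_ac)
    then show "(\<Sum>c\<in>UNIV. \<Sum>d\<in>UNIV. g c d * (v$c / v$1) * (v$d / v$1)) = 0" using null by simp
    fix e
    have "(\<Sum>c\<in>UNIV. g e c * (acc c / (v$1)\<^sup>2)) = (\<Sum>c\<in>UNIV. g e c * acc c) / (v$1)\<^sup>2"
      by (simp add: sum_divide_distrib)
    also have "(\<Sum>c\<in>UNIV. g e c * acc c) = - (\<Sum>c\<in>UNIV. \<Sum>d\<in>UNIV. 1/2 * (dg c e d + dg d e c - dg e c d) * v$c * v$d)"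
      unfolding g_def dg_def acc_def by (rule lowered_geodesic_equation[OF inj])
    also have "\<dots> / (v$1)\<^sup>2 = - (\<Sum>c\<in>UNIV. \<Sum>d\<in>UNIV. 1/2 * (dg c e d + dg d e c - dg e c d) * (v$c / v$1) * (v$d / v$1))"
      by (simp add: sum_divide_distrib power2_eq_square mult.assoc)
    finally show "(\<Sum>c\<in>UNIV. g e c * (acc c / (v$1)\<^sup>2))
      = - (\<Sum>c\<in>UNIV. \<Sum>d\<in>UNIV. 1/2 * (dg c e d + dg d e c - dg e c d) * (v$c / v$1) * (v$d / v$1))" .
  qed
  have xK: "x \<in> chart_region U K" using x K by (auto simp: chart_region_def)
  have Fb: "bounded_order U 0 F K" using cb unfolding chart_bounds_def F_def by blast
  note F = bounded_orderD[OF Fb xK, folded r_def]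
  define q where "q = Q.q"
  have q: "0 \<le> q" by (simp add: q_def Q.q_nonneg)
  have KN: "18 * K \<le> (18 * K) ^ 5" by (rule self_le_power) (use K in auto)
  have NK: "39 * (18 * K) \<le> N" "K \<le> N" "1 \<le> N" using KN K unfolding N_def by linarith+
  have r: "1 \<le> r" "0 < r" using P.r1 by auto
  show thesis
  proof (rule that[of q])
    show "0 \<le> q" by (rule q)
    have "\<bar>q - 1 - 2 * X\<bar> \<le> 39 * (18 * K) * (1 + q) / r"
      using Q.null_estimate by (simp add: q_def X_def)
    also have "\<dots> \<le> N * (1 + q) / r"
      using NK q r by (intro divide_right_mono mult_right_mono) auto
    finally show "\<bar>q - 1 - 2 * X\<bar> \<le> N * (1 + q) / r" .
    have "\<bar>acc 1 / (v$1)\<^sup>2\<bar> \<le> 26 * (18 * K) * (1 + q) / r"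
      using Q.u_acceleration_le by (simp add: q_def)
    also have "\<dots> \<le> 26 * (18 * K) * (1 + q) / 1"
      using q r K by (intro divide_left_mono) auto
    also have "\<dots> \<le> N * (1 + q) / 1"
      using NK q K by (intro divide_right_mono mult_right_mono) auto
    finally show "\<bar>acc 1 / (v$1)\<^sup>2\<bar> \<le> N * (1 + q)" by simp
    show "\<bar>F x\<bar> \<le> N" using F(2) NK by simp
    show "F differentiable (at x)" by (rule F)
    define \<psi> where "\<psi> = v$3 *\<^sub>R sphere_frame \<sigma> x 3 + v$4 *\<^sub>R sphere_frame \<sigma> x 4"
    note frame = sphere_frame_inner[OF \<sigma>, of x]
    have "\<psi> \<bullet> \<psi> = (conformal x)\<^sup>2 * ((v$3)\<^sup>2 + (v$4)\<^sup>2)"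
      using frame by (simp add: \<psi>_def inner_add_left inner_add_right inner_commute power2_eq_square algebra_simps)
    also have "\<dots> = (v$1)\<^sup>2 * ((conformal x)\<^sup>2 * ((v$3 / v$1)\<^sup>2 + (v$4 / v$1)\<^sup>2))"
      using w by (simp add: field_simps)
    finally have "norm \<psi> = v$1 * (conformal x * sqrt ((v$3 / v$1)\<^sup>2 + (v$4 / v$1)\<^sup>2))"
      using w conformal_bounds(1)[OF x] by (simp add: norm_eq_sqrt_inner real_sqrt_mult)
    also have "\<dots> \<le> v$1 * (1 + q)"
      using Q.angular_speed w by (intro mult_left_mono) (auto simp: q_def)
    also have "\<dots> \<le> N * (v$1 * (1 + q))"
      using NK(3) w q mult_right_mono[OF NK(3), of "v$1 * (1 + q)"] by simp
    finally show "norm (v$3 *\<^sub>R sphere_frame \<sigma> x 3 + v$4 *\<^sub>R sphere_frame \<sigma> x 4) \<le> N * (1 + q) * v$1"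
      by (simp add: \<psi>_def mult_ac)
    define n where "n = (\<Sum>a\<in>UNIV. v$a * pd a F x) / v$1"
    \<comment> \<open>Per unit of \<open>u\<close>, the mass aspect changes along the ray by its own
      \<open>u\<close>-derivative \<open>\<mu>\<close> and by transport in the radial and angular
      directions; the transport is small.\<close>
    have "n - \<mu> = v$2 / v$1 * pd 2 F x + (pd 3 F x * (v$3 / v$1) + pd 4 F x * (v$4 / v$1))"
      using w by (simp add: n_def \<mu>_def sum_4 field_simps)
    moreover have "\<bar>v$2 / v$1 * pd 2 F x\<bar> \<le> (1 + q) * (18 * K / r)"
    proof (rule abs_mult_le)
      show "\<bar>v$2 / v$1\<bar> \<le> 1 + q" using Q.rdot_le by (simp add: q_def)
      have "K / r \<le> 18 * K / r" using K r by (intro divide_right_mono) auto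
      then show "\<bar>pd 2 F x\<bar> \<le> 18 * K / r" using F(3) by simp
    qed
    moreover have "\<bar>pd 3 F x * (v$3 / v$1) + pd 4 F x * (v$4 / v$1)\<bar> \<le> 4 * (18 * K) * (1 + q) / r"
      unfolding q_def
    proof (rule Q.linear_form)
      fix I :: 4 assume "I \<in> {3,4}"
      then have "\<bar>pd I F x\<bar> \<le> K" using F(4)[of I] by auto
      then show "\<bar>pd I F x\<bar> \<le> 18 * K" using K by linarith
    qed
    ultimately have "\<bar>n - \<mu>\<bar> \<le> (1 + q) * (18 * K / r) + 4 * (18 * K) * (1 + q) / r"
      by (simp only: abs_add_le)
    also have "\<dots> = 5 * (18 * K) * (1 + q) / r" using r by (simp add: field_simps)
    finally have n: "\<bar>n - \<mu>\<bar> \<le> 5 * (18 * K) * (1 + Q.q) / r" by (simp add: q_def)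
    have "r\<^sup>2 * ((conformal x)\<^sup>2 * ((v$3 / v$1)\<^sup>2 + (v$4 / v$1)\<^sup>2) * Omega_inf U m h1)
       \<le> r\<^sup>2 * ((conformal x)\<^sup>2 * ((v$3 / v$1)\<^sup>2 + (v$4 / v$1)\<^sup>2) - 1/2 * Q.eta_form)"
      unfolding Q.eta_form_def \<eta>_def
      by (intro mult_left_mono Omega_inf_le[OF U bil \<sigma> cb xK pos mneg]) auto
    then have "Q.q * Omega_inf U m h1 \<le> Q.q - r\<^sup>2 / 2 * Q.eta_form"
      by (simp add: Q.q_def algebra_simps)
    from Q.modified_acceleration[OF n _ this, of "F x"]
    show "q * (Omega_inf U m h1 + X) / r - N * (1 + q)\<^sup>2 / r\<^sup>2
      \<le> acc 2 / (v$1)\<^sup>2 - X * (acc 1 / (v$1)\<^sup>2)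
        - ((\<Sum>a\<in>UNIV. v$a * pd a F x) / v$1 / (2 * r) - F x * X / (2 * r\<^sup>2))"
      using F(2) K unfolding n_def X_def q_def N_def by simp
  qed
qed

section \<open>From curves in local charts to global functions of the parameter\<close>

lemma at_param_domain_neq_bot:
  assumes "t \<in> param_domain b"
  shows "at t within param_domain b \<noteq> bot"
proof -
  have "ereal t < b" "0 \<le> t" using assms by (auto simp: param_domain_def)
  then obtain s where s: "t < s" "ereal s < b" by (metis ereal_dense2 less_ereal.simps(1))
  then have "{t<..<s} \<subseteq> param_domain b"
    using \<open>0 \<le> t\<close> by (auto simp: param_domain_def intro: order.strict_trans[of "ereal _" "ereal s"])
  then have "t islimpt param_domain b"
    using islimpt_greaterThanLessThan1[OF s(1)] islimpt_subset by blast
  then show ?thesis by (simp add: trivial_limit_within)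
qed

text \<open>One function on the whole parameter interval, whereas a geodesic supplies its velocity
  only locally and in varying charts. Taken within the interval, it is the one-sided derivative at
  0.\<close>

definition velocity :: "ereal \<Rightarrow> (real \<Rightarrow> real) \<Rightarrow> real \<Rightarrow> real" where
  "velocity b f t = vector_derivative f (at t within param_domain b)"

lemma velocity_eq:
  "t \<in> param_domain b \<Longrightarrow> (f has_vector_derivative y) (at t within param_domain b) \<Longrightarrow> velocity b f t = y"
  unfolding velocity_def by (rule vector_derivative_within[OF at_param_domain_neq_bot])

text \<open>Both charts share the coordinates \<open>u\<close> and \<open>r\<close>, so the first
  two components of the local velocity agree with \<open>velocity\<close> on a whole neighbourhood
  and can be differentiated once more. The angles appear only through the point of the
  sphere.\<close>

lemma geodesic_in_chart:
  fixes \<gamma> :: "real \<Rightarrow> event"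
  assumes geo: "future_null_geodesic U R0 A B C h b \<gamma>" and t: "t \<in> param_domain b"
  defines "u \<equiv> \<lambda>t. fst (\<gamma> t)" and "r \<equiv> \<lambda>t. fst (snd (\<gamma> t))" and "\<xi> \<equiv> \<lambda>t. snd (snd (\<gamma> t))"
  obtains \<sigma> x v where "\<sigma> \<in> {1, -1}" and "x \<in> chart_region U R0" and "\<gamma> t = chart_map \<sigma> x"
    and "v$1 = velocity b u t" and "v$2 = velocity b r t"
    and "(u has_real_derivative v$1) (at t within param_domain b)"
    and "(r has_real_derivative v$2) (at t within param_domain b)"
    and "(\<xi> has_vector_derivative v$3 *\<^sub>R sphere_frame \<sigma> x 3 + v$4 *\<^sub>R sphere_frame \<sigma> x 4) (at t within param_domain b)"
    and "(velocity b u has_real_derivative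
       - (\<Sum>c\<in>UNIV. \<Sum>d\<in>UNIV. christoffel (metric_comp A B C h \<sigma>) x 1 c d * v$c * v$d)) (at t within param_domain b)"
    and "(velocity b r has_real_derivative
       - (\<Sum>c\<in>UNIV. \<Sum>d\<in>UNIV. christoffel (metric_comp A B C h \<sigma>) x 2 c d * v$c * v$d)) (at t within param_domain b)"
    and "future_null (metric_comp A B C h \<sigma>) x v"
    and "\<And>F f. F differentiable (at x) \<Longrightarrow> (\<And>y. F y = f (y$1) (sphere_point \<sigma> y)) \<Longrightarrow>
       ((\<lambda>t. f (u t) (\<xi> t)) has_real_derivative (\<Sum>a\<in>UNIV. v$a * pd a F x)) (at t within param_domain b)"
proof -
  let ?D = "param_domain b"
  obtain \<sigma> \<epsilon> x v where \<sigma>: "\<sigma> \<in> {1, -1}" and \<epsilon>: "0 < \<epsilon>"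
    and loc: "\<forall>s\<in>?D. \<bar>s - t\<bar> < \<epsilon> \<longrightarrow>
          x s \<in> chart_region U R0 \<and> \<gamma> s = chart_map \<sigma> (x s) \<and>
          (x has_vector_derivative v s) (at s within ?D) \<and>
          (v has_vector_derivative
             (\<chi> a. - (\<Sum>c\<in>UNIV. \<Sum>d\<in>UNIV.
                christoffel (metric_comp A B C h \<sigma>) (x s) a c d * v s $ c * v s $ d)))
            (at s within ?D) \<and>
          future_null (metric_comp A B C h \<sigma>) (x s) (v s)"
    using geo t unfolding future_null_geodesic_def by blast
  have near: "x s \<in> chart_region U R0" "\<gamma> s = chart_map \<sigma> (x s)" "(x has_vector_derivative v s) (at s within ?D)"
      "(v has_vector_derivative
             (\<chi> a. - (\<Sum>c\<in>UNIV. \<Sum>d\<in>UNIV.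
                christoffel (metric_comp A B C h \<sigma>) (x s) a c d * v s $ c * v s $ d)))
            (at s within ?D)" "future_null (metric_comp A B C h \<sigma>) (x s) (v s)"
    if "s \<in> ?D" "dist s t < \<epsilon>" for s
    using loc that by (auto simp: dist_real_def)
  have comp: "((\<lambda>s. f s $ i) has_vector_derivative f' $ i) (at s within ?D)"
    if "(f has_vector_derivative f') (at s within ?D)" for f :: "real \<Rightarrow> real^4" and f' s i
    using bounded_linear.has_vector_derivative[OF bounded_linear_vec_nth that] .
  \<comment> \<open>The radius \<open>\<epsilon> - dist s t\<close> keeps the comparison inside the
    neighbourhood of \<open>t\<close> on which the chart is valid.\<close>
  have local: "(f has_vector_derivative f') (at s within ?D)"
    if "s \<in> ?D" "dist s t < \<epsilon>" "(f0 has_vector_derivative f') (at s within ?D)"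
      "\<And>z. z \<in> ?D \<Longrightarrow> dist z t < \<epsilon> \<Longrightarrow> f0 z = f z" for f f0 :: "real \<Rightarrow> 'a::real_normed_vector" and f' s
  proof (rule has_vector_derivative_transform_within[OF that(3), of "\<epsilon> - dist s t"])
    show "0 < \<epsilon> - dist s t" "s \<in> ?D" using that by auto
    fix z assume "z \<in> ?D" "dist z s < \<epsilon> - dist s t"
    then show "f0 z = f z" using that(4)[of z] dist_triangle[of z t s] by auto
  qed
  have eqs: "u s = x s $ 1" "r s = x s $ 2" "\<xi> s = sphere_point \<sigma> (x s)" if "s \<in> ?D" "dist s t < \<epsilon>" for s
    using near(2)[OF that] by (auto simp: u_def r_def \<xi>_def chart_map_def)
  have du: "(u has_vector_derivative v s $ 1) (at s within ?D)"
    and dr: "(r has_vector_derivative v s $ 2) (at s within ?D)" if s: "s \<in> ?D" "dist s t < \<epsilon>" for s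
    by (rule local[OF s comp[OF near(3)[OF s]]], simp add: eqs)+
  have vel: "velocity b u s = v s $ 1" "velocity b r s = v s $ 2" if s: "s \<in> ?D" "dist s t < \<epsilon>" for s
    using velocity_eq[OF s(1)] du[OF s] dr[OF s] by auto
  have tt: "t \<in> ?D" "dist t t < \<epsilon>" using t \<epsilon> by auto
  note real = has_real_derivative_iff_has_vector_derivative
  show thesis
  proof (rule that[OF \<sigma> near(1,2)[OF tt] vel[OF tt, symmetric]])
    show "(u has_real_derivative v t $ 1) (at t within ?D)" "(r has_real_derivative v t $ 2) (at t within ?D)"
      using du[OF tt] dr[OF tt] by (simp_all add: real)
    have "((\<lambda>s. sphere_point \<sigma> (x s)) has_vector_derivative
        v t $ 3 *\<^sub>R sphere_frame \<sigma> (x t) 3 + v t $ 4 *\<^sub>R sphere_frame \<sigma> (x t) 4) (at t within ?D)"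
      using vector_derivative_diff_chain_within[OF near(3)[OF tt]
          has_derivative_at_withinI[OF has_derivative_sphere_point]] by (simp add: o_def)
    then show "(\<xi> has_vector_derivative v t $ 3 *\<^sub>R sphere_frame \<sigma> (x t) 3 + v t $ 4 *\<^sub>R sphere_frame \<sigma> (x t) 4) (at t within ?D)"
      by (rule local[OF tt]) (simp add: eqs)
    have "(velocity b u has_vector_derivative
       - (\<Sum>c\<in>UNIV. \<Sum>d\<in>UNIV. christoffel (metric_comp A B C h \<sigma>) (x t) 1 c d * v t $ c * v t $ d)) (at t within ?D)"
      by (rule local[OF tt]) (use comp[OF near(4)[OF tt], of 1] in \<open>simp_all add: vel\<close>)
    then show "(velocity b u has_real_derivative
       - (\<Sum>c\<in>UNIV. \<Sum>d\<in>UNIV. christoffel (metric_comp A B C h \<sigma>) (x t) 1 c d * v t $ c * v t $ d)) (at t within ?D)"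
      by (simp add: real)
    have "(velocity b r has_vector_derivative
       - (\<Sum>c\<in>UNIV. \<Sum>d\<in>UNIV. christoffel (metric_comp A B C h \<sigma>) (x t) 2 c d * v t $ c * v t $ d)) (at t within ?D)"
      by (rule local[OF tt]) (use comp[OF near(4)[OF tt], of 2] in \<open>simp_all add: vel\<close>)
    then show "(velocity b r has_real_derivative
       - (\<Sum>c\<in>UNIV. \<Sum>d\<in>UNIV. christoffel (metric_comp A B C h \<sigma>) (x t) 2 c d * v t $ c * v t $ d)) (at t within ?D)"
      by (simp add: real)
    show "future_null (metric_comp A B C h \<sigma>) (x t) (v t)" by (rule near(5)[OF tt])
    fix F :: "real^4 \<Rightarrow> real" and f
    assume F: "F differentiable (at (x t))" and Ff: "\<And>y. F y = f (y$1) (sphere_point \<sigma> y)"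
    have "((\<lambda>s. F (x s)) has_vector_derivative (\<Sum>a\<in>UNIV. v t $ a * pd a F (x t))) (at t within ?D)"
      using vector_derivative_diff_chain_within[OF near(3)[OF tt] has_derivative_at_withinI[OF has_derivative_pd[OF F]]]
      by (simp add: o_def)
    then have "((\<lambda>s. f (u s) (\<xi> s)) has_vector_derivative (\<Sum>a\<in>UNIV. v t $ a * pd a F (x t))) (at t within ?D)"
      by (rule local[OF tt]) (simp add: eqs Ff)
    then show "((\<lambda>s. f (u s) (\<xi> s)) has_real_derivative (\<Sum>a\<in>UNIV. v t $ a * pd a F (x t))) (at t within ?D)"
      by (simp add: real)
  qed
qed


section \<open>Photons as null rays\<close>

lemma Omega_inf_nonneg:
  assumes "U \<noteq> {}"
    and pos: "\<And>u \<xi> \<phi>. u \<in> U \<Longrightarrow> norm \<xi> = 1 \<Longrightarrow> \<phi> \<bullet> \<xi> = 0 \<Longrightarrow> \<phi> \<noteq> 0 \<Longrightarrow> 0 < Omega_form m h1 u \<xi> \<phi> \<phi>"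
  shows "0 \<le> Omega_inf U m h1"
  unfolding Omega_inf_def
proof (rule cInf_greatest)
  obtain u where "u \<in> U" using assms by blast
  moreover have "norm (axis 1 1 :: real^3) = 1" "norm (axis 2 1 :: real^3) = 1"
    "axis 2 1 \<bullet> (axis 1 1 :: real^3) = 0"
    by (auto simp: inner_axis_axis)
  ultimately show "{Omega_form m h1 u \<xi> \<phi> \<phi> | u \<xi> \<phi>. u \<in> U \<and> norm \<xi> = 1 \<and> \<phi> \<bullet> \<xi> = 0 \<and> norm \<phi> = 1} \<noteq> {}"
    by blast
next
  fix y assume "y \<in> {Omega_form m h1 u \<xi> \<phi> \<phi> | u \<xi> \<phi>. u \<in> U \<and> norm \<xi> = 1 \<and> \<phi> \<bullet> \<xi> = 0 \<and> norm \<phi> = 1}"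
  then obtain u \<xi> \<phi> where "u \<in> U" "norm \<xi> = 1" "\<phi> \<bullet> \<xi> = 0" "norm \<phi> = 1" "y = Omega_form m h1 u \<xi> \<phi> \<phi>"
    by blast
  moreover from this have "\<phi> \<noteq> 0" by auto
  ultimately show "0 \<le> y" using pos less_imp_le by blast
qed

text \<open>The expansion speaks only about large radii, but a function of \<open>u\<close> and the
  angles does not change under a shift along the radial axis. This gives continuity of the mass
  aspect along the whole worldline.\<close>

lemma r_independent_differentiable:
  fixes f :: "real \<Rightarrow> real^3 \<Rightarrow> real"
  assumes b: "bounded_order U 0 (\<lambda>x. f (x$1) (sphere_point \<sigma> x)) K" and x: "x \<in> chart_region U R"
  shows "(\<lambda>x. f (x$1) (sphere_point \<sigma> x)) differentiable (at x)"
proof -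
  define z where "z = (\<bar>K\<bar> + \<bar>x$2\<bar> + 1) *\<^sub>R (axis 2 1 :: real^4)"
  have "x + z \<in> chart_region U K"
    using x by (auto simp: chart_region_def z_def axis_def)
  then have "(\<lambda>x. f (x$1) (sphere_point \<sigma> x)) differentiable (at (x + z))"
    by (rule bounded_orderD[OF b])
  moreover have "(\<lambda>y. y + z) differentiable (at x)" by simp
  ultimately have "((\<lambda>x. f (x$1) (sphere_point \<sigma> x)) \<circ> (\<lambda>y. y + z)) differentiable (at x)"
    by (intro differentiable_chain_at) auto
  moreover have "(\<lambda>x. f (x$1) (sphere_point \<sigma> x)) \<circ> (\<lambda>y. y + z) = (\<lambda>x. f (x$1) (sphere_point \<sigma> x))"
    by (auto simp: fun_eq_iff z_def axis_def sphere_point_def)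
  ultimately show ?thesis by simp
qed

lemma estimate_constant_ge:
  fixes K :: real
  assumes "1 \<le> K"
  shows "1800 * K \<le> 12000 * (18 * K) ^ 5" "K \<le> 12000 * (18 * K) ^ 5"
proof -
  have "18 * K \<le> (18 * K) ^ 5" by (rule self_le_power) (use assms in auto)
  then show "1800 * K \<le> 12000 * (18 * K) ^ 5" "K \<le> 12000 * (18 * K) ^ 5"
    using assms by linarith+
qed

lemma photon_null_ray:
  fixes \<gamma> :: "real \<Rightarrow> event"
  assumes U: "open U" and st: "bondi_spacetime U R0 A B C h"
    and bil: "\<And>u \<xi>. u \<in> U \<Longrightarrow> norm \<xi> = 1 \<Longrightarrow> bilinear (h1 u \<xi>)"
    and cb: "\<And>\<sigma>. \<sigma> \<in> {1, -1} \<Longrightarrow> chart_bounds U A B C h m B1 h1 C1 \<sigma> K" and K: "1 \<le> K" "R0 \<le> K"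
    and \<Omega>: "0 \<le> Omega_inf U m h1"
    and pos: "\<And>u \<xi> \<phi>. u \<in> U \<Longrightarrow> norm \<xi> = 1 \<Longrightarrow> \<phi> \<bullet> \<xi> = 0 \<Longrightarrow> \<phi> \<noteq> 0 \<Longrightarrow> 0 < Omega_form m h1 u \<xi> \<phi> \<phi>"
    and mneg: "\<And>u \<xi>. u \<in> U \<Longrightarrow> norm \<xi> = 1 \<Longrightarrow> mdot m u \<xi> \<le> 0"
    and b: "0 < b" and geo: "future_null_geodesic U R0 A B C h b \<gamma>"
  defines "u \<equiv> \<lambda>t. fst (\<gamma> t)" and "r \<equiv> \<lambda>t. fst (snd (\<gamma> t))" and "\<xi> \<equiv> \<lambda>t. snd (snd (\<gamma> t))"
  shows "null_ray b u r (velocity b u) (velocity b r) (\<lambda>t. m (u t) (\<xi> t)) \<xi> (12000 * (18 * K) ^ 5) (Omega_inf U m h1)"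
proof
  note local = geodesic_in_chart[OF geo, folded u_def r_def \<xi>_def]
  show "0 < b" "0 \<le> Omega_inf U m h1" by fact+
  have N: "1800 * K \<le> 12000 * (18 * K) ^ 5" "K \<le> 12000 * (18 * K) ^ 5"
    using estimate_constant_ge[OF K(1)] by auto
  then show "1 \<le> 12000 * (18 * K) ^ 5" using K by linarith
  have m: "bounded_order U 0 (\<lambda>x. m (x$1) (sphere_point \<sigma> x)) K" if "\<sigma> \<in> {1, -1}" for \<sigma>
    using cb[OF that] by (simp add: chart_bounds_def)
  fix t assume t: "t \<in> param_domain b"
  show "(u has_real_derivative velocity b u t) (at t within param_domain b)"
    "(r has_real_derivative velocity b r t) (at t within param_domain b)"
    by (rule local[OF t], simp)+
  show "norm (\<xi> t) = 1"
    by (rule local[OF t]) (simp add: \<xi>_def chart_map_def sphere_frame_inner(6))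
next
  note local = geodesic_in_chart[OF geo, folded u_def r_def \<xi>_def]
  have m: "bounded_order U 0 (\<lambda>x. m (x$1) (sphere_point \<sigma> x)) K" if "\<sigma> \<in> {1, -1}" for \<sigma>
    using cb[OF that] by (simp add: chart_bounds_def)
  show "continuous_on (param_domain b) (velocity b u)" "continuous_on (param_domain b) (velocity b r)"
    "continuous_on (param_domain b) \<xi>" "continuous_on (param_domain b) (\<lambda>t. m (u t) (\<xi> t))"
    unfolding continuous_on_eq_continuous_within
  proof safe
    fix t assume t: "t \<in> param_domain b"
    show "continuous (at t within param_domain b) (velocity b u)"
      "continuous (at t within param_domain b) (velocity b r)"
      by (rule local[OF t], rule DERIV_continuous, assumption)+
    show "continuous (at t within param_domain b) \<xi>"
      by (rule local[OF t], rule has_vector_derivative_continuous, assumption)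
    show "continuous (at t within param_domain b) (\<lambda>t. m (u t) (\<xi> t))"
    proof (rule local[OF t])
      fix \<sigma> x v assume \<sigma>: "\<sigma> \<in> {1, -1::real}" and x: "x \<in> chart_region U R0"
        and chain: "\<And>F f. F differentiable (at x) \<Longrightarrow> (\<And>y. F y = f (y$1) (sphere_point \<sigma> y)) \<Longrightarrow>
          ((\<lambda>t. f (fst (\<gamma> t)) (snd (snd (\<gamma> t)))) has_real_derivative (\<Sum>a\<in>UNIV. v$a * pd a F x)) (at t within param_domain b)"
      from chain[OF r_independent_differentiable[OF m[OF \<sigma>] x] refl]
      show ?thesis unfolding u_def \<xi>_def by (rule DERIV_continuous)
    qed
  qed
next
  note local = geodesic_in_chart[OF geo, folded u_def r_def \<xi>_def]
  let ?D = "param_domain b" and ?N = "12000 * (18 * K) ^ 5"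
  fix t assume t: "t \<in> ?D" and r: "?N < r t" and w: "0 < velocity b u t"
  have N: "1800 * K \<le> ?N"
    by (rule estimate_constant_ge[OF K(1)])
  show "\<exists>a1 a2 n q \<xi>'.
       (velocity b u has_real_derivative a1 * (velocity b u t)\<^sup>2) (at t within ?D) \<and>
       (velocity b r has_real_derivative a2 * (velocity b u t)\<^sup>2) (at t within ?D) \<and>
       ((\<lambda>t. m (u t) (\<xi> t)) has_real_derivative n * velocity b u t) (at t within ?D) \<and>
       (\<xi> has_vector_derivative \<xi>') (at t within ?D) \<and>
       \<bar>m (u t) (\<xi> t)\<bar> \<le> ?N \<and> 0 \<le> q \<and>
       \<bar>q - 1 - 2 * (velocity b r t / velocity b u t)\<bar> \<le> ?N * (1 + q) / r t \<and>
       \<bar>a1\<bar> \<le> ?N * (1 + q) \<and> norm \<xi>' \<le> ?N * (1 + q) * velocity b u t \<and>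
       q * (Omega_inf U m h1 + velocity b r t / velocity b u t) / r t - ?N * (1 + q)\<^sup>2 / (r t)\<^sup>2
         \<le> a2 - velocity b r t / velocity b u t * a1
           - (n / (2 * r t) - m (u t) (\<xi> t) * (velocity b r t / velocity b u t) / (2 * (r t)\<^sup>2))"
  proof (rule local[OF t])
    fix \<sigma> x v
    assume \<sigma>: "\<sigma> \<in> {1, -1::real}" and x: "x \<in> chart_region U R0" and g: "\<gamma> t = chart_map \<sigma> x"
      and v: "v$1 = velocity b u t" "v$2 = velocity b r t"
      and dxi: "(\<xi> has_vector_derivative v$3 *\<^sub>R sphere_frame \<sigma> x 3 + v$4 *\<^sub>R sphere_frame \<sigma> x 4) (at t within ?D)"
      and dw: "(velocity b u has_real_derivative
       - (\<Sum>c\<in>UNIV. \<Sum>d\<in>UNIV. christoffel (metric_comp A B C h \<sigma>) x 1 c d * v$c * v$d)) (at t within ?D)"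
      and dp: "(velocity b r has_real_derivative
       - (\<Sum>c\<in>UNIV. \<Sum>d\<in>UNIV. christoffel (metric_comp A B C h \<sigma>) x 2 c d * v$c * v$d)) (at t within ?D)"
      and null: "future_null (metric_comp A B C h \<sigma>) x v"
      and chain: "\<And>F f. F differentiable (at x) \<Longrightarrow> (\<And>y. F y = f (y$1) (sphere_point \<sigma> y)) \<Longrightarrow>
       ((\<lambda>t. f (fst (\<gamma> t)) (snd (snd (\<gamma> t)))) has_real_derivative (\<Sum>a\<in>UNIV. v$a * pd a F x)) (at t within ?D)"
    have coords: "u t = x$1" "r t = x$2" "\<xi> t = sphere_point \<sigma> x"
      using g by (auto simp: u_def r_def \<xi>_def chart_map_def)
    have xK: "x \<in> chart_region U (1800 * K)" using x N r coords by (auto simp: chart_region_def)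
    have w1: "0 < v$1" using w v by simp
    have null': "v \<bullet> (metric_comp A B C h \<sigma> x *v v) = 0" using null by (simp add: future_null_def)
    show ?thesis
    proof (rule photon_estimates[OF U st \<sigma> bil cb[OF \<sigma>] K xK pos mneg null' w1], assumption+)
      fix q
      let ?F = "\<lambda>x. m (x$1) (sphere_point \<sigma> x)"
      let ?acc = "\<lambda>i. - (\<Sum>c\<in>UNIV. \<Sum>d\<in>UNIV. christoffel (metric_comp A B C h \<sigma>) x i c d * v$c * v$d)"
      let ?S = "\<Sum>a\<in>UNIV. v$a * pd a ?F x"
      assume est: "0 \<le> q" "\<bar>q - 1 - 2 * (v$2 / v$1)\<bar> \<le> ?N * (1 + q) / x$2"
        "\<bar>?acc 1 / (v$1)\<^sup>2\<bar> \<le> ?N * (1 + q)"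
        "norm (v$3 *\<^sub>R sphere_frame \<sigma> x 3 + v$4 *\<^sub>R sphere_frame \<sigma> x 4) \<le> ?N * (1 + q) * v$1"
        "\<bar>?F x\<bar> \<le> ?N" and F: "?F differentiable (at x)"
        and acc: "q * (Omega_inf U m h1 + v$2 / v$1) / x$2 - ?N * (1 + q)\<^sup>2 / (x$2)\<^sup>2
          \<le> ?acc 2 / (v$1)\<^sup>2 - v$2 / v$1 * (?acc 1 / (v$1)\<^sup>2)
            - (?S / v$1 / (2 * x$2) - ?F x * (v$2 / v$1) / (2 * (x$2)\<^sup>2))"
      have "((\<lambda>t. m (u t) (\<xi> t)) has_real_derivative ?S / v$1 * v$1) (at t within ?D)"
        using chain[OF F refl] w1 by (simp add: u_def \<xi>_def)
      moreover have "(velocity b u has_real_derivative ?acc 1 / (v$1)\<^sup>2 * (v$1)\<^sup>2) (at t within ?D)"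
        using dw w1 by simp
      moreover have "(velocity b r has_real_derivative ?acc 2 / (v$1)\<^sup>2 * (v$1)\<^sup>2) (at t within ?D)"
        using dp w1 by simp
      ultimately show ?thesis
        unfolding coords v[symmetric] using est acc dxi by blast
    qed
  qed
qed

section \<open>Arrival at future null infinity\<close>

lemma at_left_neq_bot:
  fixes b :: ereal
  assumes "0 < b"
  shows "at_left b \<noteq> bot"
proof -
  have "b islimpt {0<..<b}" by (rule islimpt_greaterThanLessThan2[OF assms])
  then have "b islimpt {..<b}" by (rule islimpt_subset) auto
  then show ?thesis by (simp add: trivial_limit_within)
qed

theorem mainTheorem1:
  fixes U :: "real set" and R0 :: real
    and A B :: scalar_field and C :: sphere_vector_field and h :: sphere_form_field
    and m B1 :: "real \<Rightarrow> real^3 \<Rightarrow> real"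
    and h1 :: "real \<Rightarrow> real^3 \<Rightarrow> real^3 \<Rightarrow> real^3 \<Rightarrow> real"
    and C1 :: "real \<Rightarrow> real^3 \<Rightarrow> real^3"
  assumes "open U" and "U \<noteq> {}" and "\<And>u u'. u \<in> U \<Longrightarrow> u \<le> u' \<Longrightarrow> u' \<in> U"
    and "0 < R0"
    and "bondi_spacetime U R0 A B C h"
    and "bondi_expansion U A B C h m B1 h1 C1"
    and "\<And>u \<xi> \<phi>. u \<in> U \<Longrightarrow> norm \<xi> = 1 \<Longrightarrow> \<phi> \<bullet> \<xi> = 0 \<Longrightarrow> \<phi> \<noteq> 0 \<Longrightarrow>
           0 < Omega_form m h1 u \<xi> \<phi> \<phi>"
    and "\<And>u \<xi>. u \<in> U \<Longrightarrow> norm \<xi> = 1 \<Longrightarrow> mdot m u \<xi> \<le> 0"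
  shows "0 \<le> Omega_inf U m h1 \<and> rdot_crit (Omega_inf U m h1) \<le> 0 \<and>
    (\<forall>f \<in> o(\<lambda>r::real. r). \<exists>R\<ge>R0. \<forall>r0>R. \<forall>u0\<in>U. \<forall>\<xi>0. norm \<xi>0 = 1 \<longrightarrow>
       (\<forall>b \<gamma> rdot. photon_from U R0 A B C h (u0, r0, \<xi>0) b \<gamma> \<longrightarrow> initial_rdot b \<gamma> rdot \<longrightarrow>
          0 < 1 / (rdot - rdot_crit (Omega_inf U m h1)) \<longrightarrow>
          1 / (rdot - rdot_crit (Omega_inf U m h1)) \<le> f r0 \<longrightarrow>
          reaches_scri b \<gamma>))"
proof -
  define \<Omega> where "\<Omega> = Omega_inf U m h1"
  have bil: "bilinear (h1 u \<xi>)" if "u \<in> U" "norm \<xi> = 1" for u \<xi>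
    using assms(6) that unfolding bondi_expansion_def by blast
  have \<Omega>: "0 \<le> \<Omega>" unfolding \<Omega>_def using Omega_inf_nonneg[of U m h1] assms(2,7) by blast
  have "\<forall>\<^sub>F K in at_top. (\<forall>\<sigma>\<in>{1, -1}. chart_bounds U A B C h m B1 h1 C1 \<sigma> K) \<and> max 1 R0 \<le> K"
    by (intro eventually_conj eventually_ball_finite ballI chart_bounds_eventually[OF assms(6)]
        eventually_ge_at_top) auto
  then obtain K where cb: "\<And>\<sigma>. \<sigma> \<in> {1, -1} \<Longrightarrow> chart_bounds U A B C h m B1 h1 C1 \<sigma> K" and K: "1 \<le> K" "R0 \<le> K"
    by (auto dest!: eventually_happens)
  \<comment> \<open>The constants of \<open>null_ray\<close> are written out here because
    \<open>R\<close> has to be chosen before a photon is given.\<close>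
  define N where "N = 12000 * (18 * K) ^ 5"
  define c where "c = exp (- (18 / \<bar>rdot_crit \<Omega>\<bar>)) / 2"
  define K4 where "K4 = 48 * N * (\<Omega> + 5)"
  define M0 where "M0 = N / 2 + (K4 + N) / (2 * c)"
  have N: "1 \<le> N" using estimate_constant_ge(2)[OF K(1)] K(1) unfolding N_def by linarith
  have c: "0 < c" by (simp add: c_def)
  have "0 < K4" using N \<Omega> by (simp add: K4_def)
  then have M0: "0 < M0" using N c by (auto simp: M0_def intro!: add_pos_pos divide_pos_pos)
  have reach: "\<exists>R\<ge>R0. \<forall>r0>R. \<forall>u0\<in>U. \<forall>\<xi>0. norm \<xi>0 = 1 \<longrightarrow>
       (\<forall>b \<gamma> rdot. photon_from U R0 A B C h (u0, r0, \<xi>0) b \<gamma> \<longrightarrow> initial_rdot b \<gamma> rdot \<longrightarrow>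
          0 < 1 / (rdot - rdot_crit \<Omega>) \<longrightarrow> 1 / (rdot - rdot_crit \<Omega>) \<le> f r0 \<longrightarrow> reaches_scri b \<gamma>)"
    if f: "f \<in> o(\<lambda>r::real. r)" for f
  proof -
    \<comment> \<open>With the factor \<open>1 / M0\<close>, the Landau condition becomes the
      requirement that the excess at emission is at least \<open>M0 / r0\<close>.\<close>
    have "\<forall>\<^sub>F r in at_top. norm (f r) \<le> 1 / M0 * norm r"
      using landau_o.smallD[OF f, of "1 / M0"] M0 by simp
    then obtain R1 where R1: "\<And>r. R1 \<le> r \<Longrightarrow> \<bar>f r\<bar> \<le> 1 / M0 * \<bar>r\<bar>"
      by (auto simp: eventually_at_top_linorder)
    \<comment> \<open>\<open>K4 / c\<close> serves the growth estimates; \<open>R0 / c\<close>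
      ensures that a limiting radius, which is at least \<open>c * r0\<close>, still lies beyond
      \<open>R0\<close>.\<close>
    define R where "R = max (max R0 R1) (max (K4 / c) (R0 / c))"
    have "reaches_scri b \<gamma>"
      if r0: "R < r0" and u0: "u0 \<in> U"
        and photon: "photon_from U R0 A B C h (u0, r0, \<xi>0) b \<gamma>" and init: "initial_rdot b \<gamma> y"
        and y: "0 < 1 / (y - rdot_crit \<Omega>)" "1 / (y - rdot_crit \<Omega>) \<le> f r0"
      for r0 u0 \<xi>0 b \<gamma> y
    proof -
      have r0': "R0 < r0" "R1 \<le> r0" "K4 \<le> c * r0" "R0 < c * r0" "0 < r0"
        using r0 c assms(4) by (auto simp: R_def field_simps)
      have b: "0 < b" and g0: "\<gamma> 0 = (u0, r0, \<xi>0)" and geo: "future_null_geodesic U R0 A B C h b \<gamma>"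
        and inext: "\<not> (\<exists>q\<in>near_scri U R0. ((\<lambda>s. \<gamma> (real_of_ereal s)) \<longlongrightarrow> q) (at_left b))"
        using photon by (auto simp: photon_from_def)
      define u where "u = (\<lambda>t. fst (\<gamma> t))"
      define r where "r = (\<lambda>t. fst (snd (\<gamma> t)))"
      define \<xi> where "\<xi> = (\<lambda>t. snd (snd (\<gamma> t)))"
      interpret ray: null_ray b u r "velocity b u" "velocity b r" "\<lambda>t. m (u t) (\<xi> t)" \<xi> N \<Omega>
        unfolding u_def r_def \<xi>_def N_def \<Omega>_def
        by (rule photon_null_ray[OF assms(1,5) bil cb K \<Omega>[unfolded \<Omega>_def] assms(7,8) b geo])
      have ray_consts: "ray.c = c" "ray.K4 = K4" "ray.M0 = M0" "ray.xc = rdot_crit \<Omega>"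
        by (simp_all add: ray.c_def ray.L_def ray.xc_def ray.K4_def ray.M0_def c_def K4_def M0_def)
      have init0: "r 0 = r0" "u 0 = u0" by (auto simp: r_def u_def g0)
      have D0: "0 \<in> param_domain b" using b by (simp add: param_domain_def zero_ereal_def)
      obtain du dr where d: "(u has_real_derivative du) (at 0 within param_domain b)"
        "(r has_real_derivative dr) (at 0 within param_domain b)" "du \<noteq> 0" "y = dr / du"
        using init unfolding initial_rdot_def u_def r_def by blast
      have vel: "velocity b u 0 = du" "velocity b r 0 = dr"
        using d(1,2) by (auto intro!: velocity_eq[OF D0] simp: has_real_derivative_iff_has_vector_derivative)
      \<comment> \<open>Future direction alone allows \<open>du = 0\<close>; the existence of the
        initial \<open>dr/du\<close> excludes it.\<close>
      have "0 \<le> velocity b u 0"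
        by (rule geodesic_in_chart[OF geo D0, folded u_def r_def \<xi>_def]) (auto simp: future_null_def)
      then have w0: "0 < velocity b u 0" using d vel by simp
      have "1 / (y - rdot_crit \<Omega>) \<le> 1 / M0 * r0"
        using y(2) R1[OF r0'(2)] r0'(5) by linarith
      then have "M0 / r0 \<le> y - rdot_crit \<Omega>"
        using y(1) M0 r0'(5) by (simp add: field_simps zero_less_divide_iff)
      then have start: "ray.M0 / r 0 \<le> ray.rdot 0 - ray.xc"
        by (simp add: ray_consts init0 ray.rdot_def vel d(4))
      have far: "ray.K4 \<le> ray.c * r 0" using r0' by (simp add: ray_consts init0)
      note good = ray.all_good[OF w0 start far]
      show ?thesis
      proof (rule ray.escape_or_limit[OF good(1)])
        fix u_end
        assume ulim: "((\<lambda>s. u (real_of_ereal s)) \<longlongrightarrow> u_end) (at_left b)"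
          and ule: "\<And>t. t \<in> param_domain b \<Longrightarrow> u t \<le> u_end"
          and cases: "filterlim (\<lambda>s. r (real_of_ereal s)) at_top (at_left b) \<or>
            (\<exists>r_end \<xi>_end. ((\<lambda>s. r (real_of_ereal s)) \<longlongrightarrow> r_end) (at_left b) \<and>
              ((\<lambda>s. \<xi> (real_of_ereal s)) \<longlongrightarrow> \<xi>_end) (at_left b))"
        \<comment> \<open>A finite limit would be an endpoint inside \<open>near_scri\<close>: its
          time lies in \<open>U\<close> because \<open>U\<close> contains all later times, its
          radius exceeds \<open>R0\<close>, and its direction is a unit vector. Inextendibility
          forbids this.\<close>
        have "False" if rlim: "((\<lambda>s. r (real_of_ereal s)) \<longlongrightarrow> r_end) (at_left b)"
          and xlim: "((\<lambda>s. \<xi> (real_of_ereal s)) \<longlongrightarrow> \<xi>_end) (at_left b)" for r_end \<xi>_end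
        proof -
          have ev: "\<forall>\<^sub>F s in at_left b. real_of_ereal s \<in> param_domain b"
            using eventually_at_left_param_domain[OF D0] by eventually_elim simp
          have "u_end \<in> U" using ule[OF D0] u0 assms(3) by (simp add: init0)
          moreover have "R0 < r_end"
          proof -
            have "\<forall>\<^sub>F s in at_left b. c * r0 \<le> r (real_of_ereal s)"
              using ev by eventually_elim (use good(2) in \<open>simp add: ray_consts init0 less_imp_le\<close>)
            then have "c * r0 \<le> r_end"
              by (rule tendsto_lowerbound[OF rlim _ at_left_neq_bot[OF b]])
            with r0' show ?thesis by simp
          qed
          moreover have "norm \<xi>_end = 1"
          proof (rule tendsto_unique[OF at_left_neq_bot[OF b] tendsto_norm[OF xlim]])
            show "((\<lambda>s. norm (\<xi> (real_of_ereal s))) \<longlongrightarrow> 1) (at_left b)"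
              by (rule tendsto_eventually) (use ev in \<open>eventually_elim, simp add: ray.norm_xi\<close>)
          qed
          ultimately have "(u_end, r_end, \<xi>_end) \<in> near_scri U R0" by (simp add: near_scri_def)
          moreover have "((\<lambda>s. \<gamma> (real_of_ereal s)) \<longlongrightarrow> (u_end, r_end, \<xi>_end)) (at_left b)"
            using tendsto_Pair[OF ulim tendsto_Pair[OF rlim xlim]] by (simp add: u_def r_def \<xi>_def)
          ultimately show False using inext by blast
        qed
        with cases ulim show ?thesis unfolding reaches_scri_def u_def r_def by blast
      qed
    qed
    moreover have "R0 \<le> R" by (simp add: R_def)
    ultimately show ?thesis by blast
  qed
  show ?thesis
    using \<Omega> rdot_crit_bounds(1)[OF \<Omega>] reach unfolding \<Omega>_def by blast
qed

end
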